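(* Let $h_1,h_2,h_3>0$. 1. Let $\Omega=(0,h_1)\times(0,h_2)\subset\mathbb{R}^2$ and $\Gamma=\{x_1=0,\ x_2\in[0,h_2]\}$. Then the sharp constants $C_1(\Omega,\Gamma)$ and $C_2(\Omega,\Gamma)$ are equal to $$\frac1\pi\max\{2h_1;h_2\}\qquad\text{and}\qquad \left(\frac{\pi}{h_2}\tanh\Big(\frac{\pi h_1}{h_2}\Big)\right)^{-\frac12},$$ respectively. 2. Let $\Omega=(0,h_1)\times(0,h_2)\times(0,h_3)\subset\mathbb{R}^3$ and $\Gamma=\partial\Omega\cap\{x_1=0\}$. Then the sharp constants $C_1(\Omega,\Gamma)$ and $C_2(\Omega,\Gamma)$ are equal to $$\frac1\pi\max\{2h_1;h_2;h_3\}\qquad\text{and}\qquad \left(\frac{\pi}{\max\{h_2;h_3\}}\tanh\Big(\frac{\pi h_1}{\max\{h_2;h_3\}}\Big)\right)^{-\frac12},$$ respectively.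
   Context: For a bounded connected Lipschitz domain $\Omega\subset\mathbb{R}^d$ and a measurable part $\Gamma\subset\partial\Omega$ of positive $(d-1)$-dimensional measure, let $\widetilde H^1(\Omega,\Gamma)=\{w\in H^1(\Omega): \text{the mean value of (the trace of) } w \text{ on } \Gamma \text{ is zero}\}$. The norm in $L^2(\omega)$ is denoted $\|\cdot\|_{2,\omega}$. The sharp (exact) constant $C_1(\Omega,\Gamma)$ is the smallest constant $C$ such that $\|w\|_{2,\Omega}\le C\|\nabla w\|_{2,\Omega}$ for all $w\in\widetilde H^1(\Omega,\Gamma)$. The sharp constant $C_2(\Omega,\Gamma)$ is the smallest constant $C$ such that $\|w\|_{2,\Gamma}\le C\|\nabla w\|_{2,\Omega}$ for all $w\in\widetilde H^1(\Omega,\Gamma)$. *)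

theory Defs
  imports "HOL-Analysis.Analysis"
begin

(* L2 spaces of functions (not of equivalence classes) with values in a Euclidean space. *)

definition L2 :: "'a measure \<Rightarrow> ('a \<Rightarrow> 'b::euclidean_space) set" where
  "L2 M = {f \<in> borel_measurable M. integrable M (\<lambda>x. (norm (f x))\<^sup>2)}"

definition L2_norm :: "'a measure \<Rightarrow> ('a \<Rightarrow> 'b::euclidean_space) \<Rightarrow> real" where
  "L2_norm M f = sqrt (LINT x|M. (norm (f x))\<^sup>2)"

definition mean_value :: "'a measure \<Rightarrow> ('a \<Rightarrow> real) \<Rightarrow> real" where
  "mean_value M f = (LINT x|M. f x) / measure M (space M)"

definition partial :: "'a::euclidean_space \<Rightarrow> ('a \<Rightarrow> real) \<Rightarrow> 'a \<Rightarrow> real" where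
  "partial b f x = frechet_derivative f (at x) b"

primrec Ck :: "nat \<Rightarrow> ('a::euclidean_space \<Rightarrow> real) \<Rightarrow> bool" where
  "Ck 0 f \<longleftrightarrow> continuous_on UNIV f"
| "Ck (Suc k) f \<longleftrightarrow> (\<forall>x. f differentiable (at x)) \<and> (\<forall>b\<in>Basis. Ck k (partial b f))"

definition smooth :: "('a::euclidean_space \<Rightarrow> real) \<Rightarrow> bool" where
  "smooth f \<longleftrightarrow> (\<forall>k. Ck k f)"

definition test_function :: "'a::euclidean_space set \<Rightarrow> ('a \<Rightarrow> real) \<Rightarrow> bool" where
  "test_function \<Omega> \<phi> \<longleftrightarrow>
     smooth \<phi> \<and> compact (closure {x. \<phi> x \<noteq> 0}) \<and> closure {x. \<phi> x \<noteq> 0} \<subseteq> \<Omega>"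

definition is_weak_gradient ::
    "'a::euclidean_space set \<Rightarrow> ('a \<Rightarrow> real) \<Rightarrow> ('a \<Rightarrow> 'a) \<Rightarrow> bool" where
  "is_weak_gradient \<Omega> w g \<longleftrightarrow>
     (\<forall>\<phi> b. test_function \<Omega> \<phi> \<longrightarrow> b \<in> Basis \<longrightarrow>
       (LINT x|lebesgue_on \<Omega>. w x * partial b \<phi> x) = - (LINT x|lebesgue_on \<Omega>. (g x \<bullet> b) * \<phi> x))"

definition H1 :: "'a::euclidean_space set \<Rightarrow> ('a \<Rightarrow> real) set" where
  "H1 \<Omega> = {w \<in> L2 (lebesgue_on \<Omega>). \<exists>g \<in> L2 (lebesgue_on \<Omega>). is_weak_gradient \<Omega> w g}"

(* For w in H1 the choice exists by definition; on an open set it is unique almost everywhere. *)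

definition weak_grad :: "'a::euclidean_space set \<Rightarrow> ('a \<Rightarrow> real) \<Rightarrow> 'a \<Rightarrow> 'a" where
  "weak_grad \<Omega> w = (SOME g. g \<in> L2 (lebesgue_on \<Omega>) \<and> is_weak_gradient \<Omega> w g)"

definition H1_norm :: "'a::euclidean_space set \<Rightarrow> ('a \<Rightarrow> real) \<Rightarrow> real" where
  "H1_norm \<Omega> w =
     sqrt ((L2_norm (lebesgue_on \<Omega>) w)\<^sup>2 + (L2_norm (lebesgue_on \<Omega>) (weak_grad \<Omega> w))\<^sup>2)"

(* (d-1)-dimensional Lebesgue measure on the coordinate hyperplane orthogonal to the basis
   vector e, restricted to a part G of that hyperplane.  The construction is that of lborel,
   with the coordinate e omitted. *)

definition flat_surface_measure :: "'a::euclidean_space \<Rightarrow> 'a set \<Rightarrow> 'a measure" where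
  "flat_surface_measure e G = restrict_space
     (completion (distr (\<Pi>\<^sub>M b\<in>Basis - {e}. (lborel :: real measure)) borel
       (\<lambda>f. \<Sum>b\<in>Basis - {e}. f b *\<^sub>R b))) G"

(* The trace operator is the extension by continuity, from H1 to L2 of the boundary part, of
   the restriction of functions smooth up to the boundary; is_trace is the graph of that
   extension.  Here \<Omega> is a bounded Lipschitz domain (so smooth functions on the whole space
   belong to H1 and are dense in it), and \<sigma> is the surface measure on the boundary part.
   Traces are determined up to \<sigma>-null sets. *)

definition is_trace ::
    "'a::euclidean_space set \<Rightarrow> 'a measure \<Rightarrow> ('a \<Rightarrow> real) \<Rightarrow> ('a \<Rightarrow> real) \<Rightarrow> bool" where
  "is_trace \<Omega> \<sigma> w t \<longleftrightarrow> t \<in> L2 \<sigma> \<and>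
     (\<exists>\<phi> :: nat \<Rightarrow> 'a \<Rightarrow> real. (\<forall>n. smooth (\<phi> n)) \<and>
        (\<lambda>n. H1_norm \<Omega> (\<lambda>x. \<phi> n x - w x)) \<longlonglongrightarrow> 0 \<and>
        (\<lambda>n. L2_norm \<sigma> (\<lambda>x. \<phi> n x - t x)) \<longlonglongrightarrow> 0)"

definition H1_tilde :: "'a::euclidean_space set \<Rightarrow> 'a measure \<Rightarrow> ('a \<Rightarrow> real) set" where
  "H1_tilde \<Omega> \<sigma> = {w \<in> H1 \<Omega>. \<exists>t. is_trace \<Omega> \<sigma> w t \<and> mean_value \<sigma> t = 0}"

definition is_smallest :: "real set \<Rightarrow> real \<Rightarrow> bool" where
  "is_smallest S c \<longleftrightarrow> c \<in> S \<and> (\<forall>C\<in>S. c \<le> C)"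

definition is_sharp_C1 :: "'a::euclidean_space set \<Rightarrow> 'a measure \<Rightarrow> real \<Rightarrow> bool" where
  "is_sharp_C1 \<Omega> \<sigma> = is_smallest
     {C. \<forall>w \<in> H1_tilde \<Omega> \<sigma>.
           L2_norm (lebesgue_on \<Omega>) w \<le> C * L2_norm (lebesgue_on \<Omega>) (weak_grad \<Omega> w)}"

definition is_sharp_C2 :: "'a::euclidean_space set \<Rightarrow> 'a measure \<Rightarrow> real \<Rightarrow> bool" where
  "is_sharp_C2 \<Omega> \<sigma> = is_smallest
     {C. \<forall>w \<in> H1_tilde \<Omega> \<sigma>. \<forall>t. is_trace \<Omega> \<sigma> w t \<longrightarrow>
           L2_norm \<sigma> t \<le> C * L2_norm (lebesgue_on \<Omega>) (weak_grad \<Omega> w)}"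

end

theory Submission
  imports Defs
begin

text \<open>
  Both parts are instances of one statement about a box \<open>\<Omega> = box 0 H\<close> in a Euclidean space of dimension
  at least two and its face \<open>{x \<bullet> e = 0}\<close>; \<open>m\<close> denotes the longest side of the face and \<open>h = H \<bullet> e\<close>
  the length of the box in the normal direction.
  
  For a function \<open>f\<close> that is \<open>C\<^sup>1\<close> up to the boundary and has mean zero on the face, split \<open>f = a + v\<close>,
  where \<open>a\<close> depends on \<open>x \<bullet> e\<close> only and is the mean of \<open>f\<close> over the parallel slice. The two parts are
  orthogonal on every slice, \<open>a\<close> vanishes on the face, and \<open>v\<close> has mean zero on every slice. The
  one-dimensional inequality for functions vanishing at one end bounds \<open>a\<close> with the constant
  \<open>2 * h / pi\<close>, and the Poincare inequality on the cross-section (one-dimensional inequalities put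
  together by tensorisation of the variance, \<open>box_variance_le\<close>) bounds \<open>v\<close> with the constant \<open>m / pi\<close>.
  This is \<open>box_poincare_inequality\<close>. For the trace only \<open>v\<close> matters, because \<open>a\<close> vanishes on the face.
  With \<open>k = pi / m\<close> the cross-section inequality leaves the one-dimensional problem of minimising
  \<open>\<integral> F'\<^sup>2 + k\<^sup>2 F\<^sup>2\<close> over \<open>(0, h)\<close> relative to \<open>F(0)\<^sup>2\<close>, whose minimum is \<open>k * tanh (k * h)\<close>; this is
  \<open>box_trace_inequality\<close>.
  
  All one-dimensional inequalities are proved by one device: if \<open>p' = c - p\<^sup>2\<close>, then completing
  the square turns the inequality into the fundamental theorem of calculus for \<open>p * F\<close>
  (\<open>riccati_comparison\<close>). Logarithmic derivatives of the extremal functions provide \<open>p\<close>.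
  
  The inequalities extend to the Sobolev space because traces are defined by approximation
  with smooth functions (\<open>inequality_by_density\<close>). This needs that the weak gradient is determined
  almost everywhere, hence the fundamental lemma of the calculus of variations on a box
  (\<open>fundamental_lemma_box\<close>), and that the integral of the trace over the face does not depend on the
  approximating sequence (\<open>trace_integral_unique\<close>).
  
  The constants are attained: the first one by \<open>sin (pi * (x \<bullet> e) / (2 * h))\<close> or
  \<open>cos (pi * (x \<bullet> c) / m)\<close>, the second one by the harmonic function
  \<open>cosh (k * (h - x \<bullet> e)) * cos (k * (x \<bullet> c))\<close>, where \<open>c\<close> is the direction of a longest side of the face.
\<close>

section \<open>Riccati comparison and one-dimensional inequalities\<close>

text \<open>
  By the Riccati equation the derivative of \<open>p * F\<close> is \<open>p * F' - p\<^sup>2 * F + c * F\<close>, and the hypothesis bounds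
  this by \<open>G + c * F\<close>. The hypothesis on \<open>G\<close> is what completing a square gives, for instance with \<open>F = u\<^sup>2\<close>
  and \<open>G = u'\<^sup>2\<close>. It is phrased for a general \<open>F\<close> so that \<open>F\<close> can also be an integral of squares over
  slices of a box.
\<close>

lemma riccati_comparison:
  fixes F F' G p :: "real \<Rightarrow> real"
  assumes dF: "\<And>x. (F has_real_derivative F' x) (at x)" and cF': "continuous_on UNIV F'"
    and cG: "continuous_on UNIV G" and L: "0 \<le> L"
    and dp: "\<And>x. x \<in> {0..L} \<Longrightarrow> (p has_real_derivative (c - (p x)\<^sup>2)) (at x)"
    and le: "\<And>x. x \<in> {0..L} \<Longrightarrow> p x * F' x - (p x)\<^sup>2 * F x \<le> G x"
  shows "p L * F L - p 0 * F 0 \<le> integral {0..L} G + c * integral {0..L} F"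
proof -
  have cF: "continuous_on S F" for S
    by (rule DERIV_continuous_on[of _ _ F']) (use dF has_field_derivative_at_within in blast)
  have int: "G integrable_on {0..L}" "F integrable_on {0..L}"
    using cF cG by (auto intro!: integrable_continuous_real continuous_on_subset[OF cG])
  have "((\<lambda>x. p x * F' x + (c - (p x)\<^sup>2) * F x) has_integral (p L * F L - p 0 * F 0)) {0..L}"
    using L
    by (rule fundamental_theorem_of_calculus)
      (auto intro!: derivative_eq_intros dp[THEN has_field_derivative_at_within]
        dF[THEN has_field_derivative_at_within]
        simp: has_real_derivative_iff_has_vector_derivative[symmetric])
  moreover have "((\<lambda>x. G x + c * F x) has_integral (integral {0..L} G + c * integral {0..L} F)) {0..L}"
    using int by (auto intro!: has_integral_add has_integral_mult_right)
  ultimately show ?thesis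
    by (rule has_integral_le) (use le in \<open>fastforce simp: algebra_simps\<close>)
qed

text \<open>
  The Riccati solution is \<open>p x = k * cot (k * x + \<delta>)\<close>. The shift \<open>\<delta>\<close> moves the pole of the cotangent out of the
  interval, so that no asymptotics of \<open>u\<close> at \<open>0\<close> are needed; it costs a little of the optimal \<open>k\<close>, which
  is recovered in the limit.
\<close>

lemma dirichlet_poincare_shifted:
  fixes u u' :: "real \<Rightarrow> real"
  assumes du: "\<And>x. (u has_real_derivative u' x) (at x)" and cu': "continuous_on UNIV u'"
    and L: "0 \<le> L" and \<delta>: "0 < \<delta>" "k * L + \<delta> < pi" and k: "0 < k"
    and u0: "u 0 = 0" and uL: "0 \<le> cot (k * L + \<delta>) * (u L)\<^sup>2"
  shows "k\<^sup>2 * integral {0..L} (\<lambda>x. (u x)\<^sup>2) \<le> integral {0..L} (\<lambda>x. (u' x)\<^sup>2)"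
proof -
  define p where "p x = k * cot (k * x + \<delta>)" for x
  have cu: "continuous_on S u" for S
    by (rule DERIV_continuous_on[of _ _ u']) (use du has_field_derivative_at_within in blast)
  have pos: "0 < sin (k * x + \<delta>)" if "x \<in> {0..L}" for x
  proof (rule sin_gt_zero)
    show "0 < k * x + \<delta>" using that k \<delta> by (simp add: add_nonneg_pos)
    have "k * x \<le> k * L" using that k by simp
    then show "k * x + \<delta> < pi" using \<delta> by linarith
  qed
  have dp: "(p has_real_derivative (- k\<^sup>2 - (p x)\<^sup>2)) (at x)" if "x \<in> {0..L}" for x
    unfolding p_def using pos[OF that]
    by (auto intro!: derivative_eq_intros simp: cot_def field_simps power2_eq_square)
  have "p L * (u L)\<^sup>2 - p 0 * (u 0)\<^sup>2
      \<le> integral {0..L} (\<lambda>x. (u' x)\<^sup>2) + (- k\<^sup>2) * integral {0..L} (\<lambda>x. (u x)\<^sup>2)"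
  proof (rule riccati_comparison[where F' = "\<lambda>x. 2 * u x * u' x"])
    show "((\<lambda>x. (u x)\<^sup>2) has_real_derivative 2 * u x * u' x) (at x)" for x
      by (auto intro!: derivative_eq_intros du)
    show "p x * (2 * u x * u' x) - (p x)\<^sup>2 * (u x)\<^sup>2 \<le> (u' x)\<^sup>2" for x
      using zero_le_power2[of "u' x - p x * u x"] by (simp add: power2_eq_square algebra_simps)
  qed (use L dp cu cu' in \<open>auto intro!: continuous_intros\<close>)
  moreover have "0 \<le> p L * (u L)\<^sup>2"
    using uL k unfolding p_def by (simp add: mult.assoc)
  ultimately show ?thesis using u0 by simp
qed

text \<open>
  Removes the loss in \<open>k\<close> caused by the shift of the cotangent.
\<close>

lemma poincare_limit:
  fixes I J K :: real
  assumes "\<And>k. 0 < k \<Longrightarrow> k < K \<Longrightarrow> k\<^sup>2 * I \<le> J" and K: "0 < K"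
  shows "I \<le> (1 / K)\<^sup>2 * J"
proof -
  have "((\<lambda>k. k\<^sup>2 * I) \<longlongrightarrow> K\<^sup>2 * I) (at_left K)"
    by (intro tendsto_intros)
  moreover have "eventually (\<lambda>k. k\<^sup>2 * I \<le> J) (at_left K)"
    using assms by (auto simp: eventually_at_left_field intro!: exI[of _ 0])
  ultimately have "K\<^sup>2 * I \<le> J"
    by (rule tendsto_upperbound) simp
  then show ?thesis using K by (simp add: field_simps power2_eq_square)
qed

text \<open>
  The choice \<open>\<delta> = pi / 2 - k * L\<close> makes the cotangent vanish at \<open>L\<close>, so the boundary term there disappears
  without a condition on \<open>u L\<close>.
\<close>

lemma poincare_vanishing_at_endpoint:
  fixes u u' :: "real \<Rightarrow> real"
  assumes du: "\<And>x. (u has_real_derivative u' x) (at x)" and cu': "continuous_on UNIV u'"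
    and L: "0 < L" and u0: "u 0 = 0"
  shows "integral {0..L} (\<lambda>x. (u x)\<^sup>2) \<le> (2 * L / pi)\<^sup>2 * integral {0..L} (\<lambda>x. (u' x)\<^sup>2)"
proof -
  have "k\<^sup>2 * integral {0..L} (\<lambda>x. (u x)\<^sup>2) \<le> integral {0..L} (\<lambda>x. (u' x)\<^sup>2)"
    if k: "0 < k" "k < pi / (2 * L)" for k
  proof (rule dirichlet_poincare_shifted[where \<delta> = "pi/2 - k * L", OF du cu'])
    show "0 < pi / 2 - k * L" using k L by (simp add: field_simps)
  qed (use k L u0 in \<open>auto simp: cot_def\<close>)
  then show ?thesis using poincare_limit[of "pi / (2*L)"] L by simp
qed

lemma poincare_vanishing_at_both_endpoints:
  fixes u u' :: "real \<Rightarrow> real"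
  assumes du: "\<And>x. (u has_real_derivative u' x) (at x)" and cu': "continuous_on UNIV u'"
    and L: "0 < L" and u0: "u 0 = 0" and uL: "u L = 0"
  shows "integral {0..L} (\<lambda>x. (u x)\<^sup>2) \<le> (L / pi)\<^sup>2 * integral {0..L} (\<lambda>x. (u' x)\<^sup>2)"
proof -
  have "k\<^sup>2 * integral {0..L} (\<lambda>x. (u x)\<^sup>2) \<le> integral {0..L} (\<lambda>x. (u' x)\<^sup>2)"
    if k: "0 < k" "k < pi / L" for k
  proof (rule dirichlet_poincare_shifted[where \<delta> = "(pi - k * L) / 2", OF du cu'])
    have "k * L < pi" using k L by (simp add: field_simps)
    then show "0 < (pi - k * L) / 2" "k * L + (pi - k * L) / 2 < pi"
      by (simp_all add: field_simps)
  qed (use k L u0 uL in auto)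
  then show ?thesis using poincare_limit[of "pi / L"] L by simp
qed

text \<open>
  The primitive \<open>u\<close> of \<open>f\<close> vanishes at both end points exactly because \<open>f\<close> has mean zero. Integration by parts
  gives \<open>\<integral> f\<^sup>2 = - \<integral> f' * u\<close>, and the inequality for \<open>u\<close> bounds \<open>\<integral> u\<^sup>2\<close> by \<open>\<integral> f\<^sup>2\<close> with the same constant.
\<close>

lemma poincare_mean_zero:
  fixes f f' :: "real \<Rightarrow> real"
  assumes df: "\<And>x. (f has_real_derivative f' x) (at x)" and cf': "continuous_on UNIV f'"
    and L: "0 < L" and mean: "integral {0..L} f = 0"
  shows "integral {0..L} (\<lambda>x. (f x)\<^sup>2) \<le> (L / pi)\<^sup>2 * integral {0..L} (\<lambda>x. (f' x)\<^sup>2)"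
proof -
  have cf: "continuous_on S f" for S
    by (rule DERIV_continuous_on[of _ _ f']) (use df has_field_derivative_at_within in blast)
  have cf'S: "continuous_on S f'" for S using cf' continuous_on_subset by blast
  obtain g where g: "\<And>x. (g has_real_derivative f x) (at x)"
  proof -
    have "isCont f x" for x using df DERIV_isCont by blast
    then have "\<exists>F. \<forall>x. (F has_vector_derivative f x) (at x)"
      using einterval_antiderivative[of "-\<infinity>" "\<infinity>" f] by simp
    then obtain F where "\<And>x. (F has_vector_derivative f x) (at x)" by blast
    then show ?thesis
      by (intro that[of F]) (simp add: has_real_derivative_iff_has_vector_derivative)
  qed
  define u where "u x = g x - g 0" for x
  have du: "(u has_real_derivative f x) (at x)" for x
    unfolding u_def by (auto intro!: derivative_eq_intros g)
  have cu: "continuous_on S u" for S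
    by (rule DERIV_continuous_on[of _ _ f]) (use du has_field_derivative_at_within in blast)
  have "(f has_integral (u L - u 0)) {0..L}"
    using L by (intro fundamental_theorem_of_calculus)
      (auto intro!: du[THEN has_field_derivative_at_within]
        simp: has_real_derivative_iff_has_vector_derivative[symmetric])
  then have u0: "u 0 = 0" "u L = 0"
    using mean by (auto simp: u_def dest!: integral_unique)
  have parts: "((\<lambda>x. f' x * u x + f x * f x) has_integral (f L * u L - f 0 * u 0)) {0..L}"
    using L by (intro fundamental_theorem_of_calculus)
      (auto intro!: derivative_eq_intros du[THEN has_field_derivative_at_within]
        df[THEN has_field_derivative_at_within]
        simp: has_real_derivative_iff_has_vector_derivative[symmetric])
  define A B C where "A = integral {0..L} (\<lambda>x. (f x)\<^sup>2)" and "B = integral {0..L} (\<lambda>x. (f' x)\<^sup>2)"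
    and "C = integral {0..L} (\<lambda>x. (u x)\<^sup>2)"
  have C: "C \<le> (L / pi)\<^sup>2 * A"
    unfolding A_def C_def
    by (rule poincare_vanishing_at_both_endpoints[OF du _ L u0]) (rule cf)
  \<comment> \<open>Youngs inequality with this weight balances the two squares\<close>
  define r where "r = (L / pi)\<^sup>2"
  have r: "r > 0" unfolding r_def using L by simp
  have "((\<lambda>x. r * (f' x)\<^sup>2 + (1 / r) * (u x)\<^sup>2 + 2 * (f' x * u x + f x * f x) - 2 * (f x)\<^sup>2) has_integral
      (r * B + (1 / r) * C + 2 * (f L * u L - f 0 * u 0) - 2 * A)) {0..L}"
    unfolding A_def B_def C_def
    by (intro has_integral_diff has_integral_add has_integral_mult_right parts integrable_integral
        integrable_continuous_real continuous_intros cf cf'S cu)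
  then have "0 \<le> r * B + (1 / r) * C + 2 * (f L * u L - f 0 * u 0) - 2 * A"
  proof (rule has_integral_nonneg)
    fix x
    have "r * (f' x)\<^sup>2 + (1 / r) * (u x)\<^sup>2 + 2 * (f' x * u x + f x * f x) - 2 * (f x)\<^sup>2
       = r * (f' x + u x / r)\<^sup>2"
      using r by (simp add: field_simps power2_eq_square)
    then show "0 \<le> r * (f' x)\<^sup>2 + (1 / r) * (u x)\<^sup>2 + 2 * (f' x * u x + f x * f x) - 2 * (f x)\<^sup>2"
      using r by simp
  qed
  moreover have "(1 / r) * C \<le> A"
    using C r unfolding r_def[symmetric] by (simp add: field_simps)
  ultimately have "A \<le> r * B" using u0 by simp
  then show ?thesis unfolding A_def B_def r_def .
qed

section \<open>Iterated integrals over coordinate slices\<close>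

definition set_coord :: "'a::euclidean_space \<Rightarrow> real \<Rightarrow> 'a \<Rightarrow> 'a" where
  "set_coord b s x = x + (s - x \<bullet> b) *\<^sub>R b"

lemma set_coord_inner: "\<lbrakk>b \<in> Basis; c \<in> Basis\<rbrakk> \<Longrightarrow> set_coord b s x \<bullet> c = (if c = b then s else x \<bullet> c)"
  by (auto simp: set_coord_def inner_add_left inner_Basis)

lemma set_coord_set_coord [simp]: "b \<in> Basis \<Longrightarrow> set_coord b s (set_coord b t x) = set_coord b s x"
  by (rule euclidean_eqI) (simp add: set_coord_inner)

lemma set_coord_commute: "\<lbrakk>b \<in> Basis; c \<in> Basis; b \<noteq> c\<rbrakk> \<Longrightarrow> set_coord b s (set_coord c t x) = set_coord c t (set_coord b s x)"
  by (rule euclidean_eqI) (simp add: set_coord_inner)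

lemma set_coord_zero [simp]: "set_coord b s 0 = s *\<^sub>R b"
  by (simp add: set_coord_def)

lemma continuous_on_set_coord [continuous_intros]:
  "\<lbrakk>continuous_on S f; continuous_on S g\<rbrakk> \<Longrightarrow> continuous_on S (\<lambda>x. set_coord b (f x) (g x))"
  unfolding set_coord_def by (intro continuous_intros)

lemma continuous_on_compose_UNIV:
  "\<lbrakk>continuous_on UNIV f; continuous_on S g\<rbrakk> \<Longrightarrow> continuous_on S (\<lambda>x. f (g x))"
  by (rule continuous_on_compose2[of UNIV f]) auto

text \<open>
  Integrating out one coordinate is made an operator on functions on the whole space: the result
  does not depend on that coordinate, and the operators for different coordinates can be iterated without
  changing the type. For continuous integrands this replaces measures on cross-sections by repeated
  one-dimensional integrals.
\<close>

definition slice_integral :: "'a::euclidean_space \<Rightarrow> 'a \<Rightarrow> ('a \<Rightarrow> real) \<Rightarrow> 'a \<Rightarrow> real" where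
  "slice_integral H b f x = integral {0..H \<bullet> b} (\<lambda>s. f (set_coord b s x))"

definition iter_integral :: "'a::euclidean_space \<Rightarrow> 'a list \<Rightarrow> ('a \<Rightarrow> real) \<Rightarrow> 'a \<Rightarrow> real" where
  "iter_integral H bs f = fold (slice_integral H) bs f"

lemma iter_integral_simps [simp]:
  "iter_integral H [] f = f"
  "iter_integral H (b # bs) f = iter_integral H bs (slice_integral H b f)"
  "iter_integral H (bs @ cs) f = iter_integral H cs (iter_integral H bs f)"
  by (simp_all add: iter_integral_def)

text \<open>
  Continuity of both functions is part of the notion, because it is what differentiation under the
  integral sign needs, and it is inherited by slice integrals.
\<close>

definition has_partial :: "'a::euclidean_space \<Rightarrow> ('a \<Rightarrow> real) \<Rightarrow> ('a \<Rightarrow> real) \<Rightarrow> bool" where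
  "has_partial b f f' \<longleftrightarrow> continuous_on UNIV f \<and> continuous_on UNIV f' \<and>
     (\<forall>x s. ((\<lambda>s. f (set_coord b s x)) has_real_derivative f' (set_coord b s x)) (at s))"

lemma has_partial_mult:
  assumes "has_partial b f f'" "has_partial b g g'"
  shows "has_partial b (\<lambda>x. f x * g x) (\<lambda>x. f x * g' x + f' x * g x)"
  using assms unfolding has_partial_def
  by (auto intro!: continuous_intros derivative_eq_intros)

lemma slice_integrable:
  fixes f :: "'a::euclidean_space \<Rightarrow> real"
  assumes "continuous_on UNIV f"
  shows "(\<lambda>s. f (set_coord b s x)) integrable_on {a..c}"
  by (intro integrable_continuous_real continuous_on_compose_UNIV[OF assms] continuous_intros)

lemma slice_integral_continuous:
  assumes "continuous_on UNIV f"
  shows "continuous_on UNIV (slice_integral H b f)"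
proof -
  have "continuous_on (UNIV \<times> cbox 0 (H \<bullet> b)) (\<lambda>(x, s). f (set_coord b s x))"
    unfolding case_prod_unfold by (intro continuous_on_compose_UNIV[OF assms] continuous_intros)
  then show ?thesis
    unfolding slice_integral_def[abs_def] box_real(2)[symmetric]
    by (rule integral_continuous_on_param)
qed

lemma iter_integral_continuous:
  "continuous_on UNIV f \<Longrightarrow> continuous_on UNIV (iter_integral H bs f)"
  by (induction bs arbitrary: f) (auto intro: slice_integral_continuous)

lemma slice_integral_add:
  assumes "continuous_on UNIV f" "continuous_on UNIV g"
  shows "slice_integral H b (\<lambda>x. f x + g x) = (\<lambda>x. slice_integral H b f x + slice_integral H b g x)"
  unfolding slice_integral_def using assms by (intro ext integral_add slice_integrable)

lemma slice_integral_mult: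
  "slice_integral H b (\<lambda>x. c * f x) = (\<lambda>x. c * slice_integral H b f x)"
  unfolding slice_integral_def by simp

lemma slice_integral_mono:
  assumes "continuous_on UNIV f" "continuous_on UNIV g" "\<And>x. f x \<le> g x"
  shows "slice_integral H b f x \<le> slice_integral H b g x"
  unfolding slice_integral_def using assms by (intro integral_le slice_integrable)

lemma iter_integral_add:
  assumes "continuous_on UNIV f" "continuous_on UNIV g"
  shows "iter_integral H bs (\<lambda>x. f x + g x) = (\<lambda>x. iter_integral H bs f x + iter_integral H bs g x)"
  using assms by (induction bs arbitrary: f g) (auto simp: slice_integral_add slice_integral_continuous)

lemma iter_integral_mult:
  "iter_integral H bs (\<lambda>x. c * f x) = (\<lambda>x. c * iter_integral H bs f x)"
  by (induction bs arbitrary: f) (auto simp: slice_integral_mult)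

lemma iter_integral_diff:
  assumes "continuous_on UNIV f" "continuous_on UNIV g"
  shows "iter_integral H bs (\<lambda>x. f x - g x) = (\<lambda>x. iter_integral H bs f x - iter_integral H bs g x)"
  using iter_integral_add[OF assms(1), of "\<lambda>x. -1 * g x" H bs] assms(2)
    iter_integral_mult[of H bs "-1" g]
  by (simp add: continuous_intros)

lemma iter_integral_mono:
  assumes "continuous_on UNIV f" "continuous_on UNIV g" "\<And>x. f x \<le> g x"
  shows "iter_integral H bs f x \<le> iter_integral H bs g x"
  using assms
proof (induction bs arbitrary: f g)
  case (Cons b bs)
  show ?case
    unfolding iter_integral_simps
    by (rule Cons.IH) (intro slice_integral_continuous slice_integral_mono Cons.prems)+
qed simp

definition side_product :: "'a::euclidean_space \<Rightarrow> 'a list \<Rightarrow> real" where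
  "side_product H bs = (\<Prod>b\<leftarrow>bs. H \<bullet> b)"

lemma side_product_pos:
  "(\<And>b. b \<in> set bs \<Longrightarrow> 0 < H \<bullet> b) \<Longrightarrow> 0 < side_product H bs"
  unfolding side_product_def by (induction bs) auto

lemma iter_integral_const:
  assumes "\<And>b. b \<in> set bs \<Longrightarrow> 0 < H \<bullet> b"
  shows "iter_integral H bs (\<lambda>_. c) = (\<lambda>_. c * side_product H bs)"
  using assms
proof (induction bs arbitrary: c)
  case (Cons b bs)
  have "slice_integral H b (\<lambda>_. c) = (\<lambda>_. c * (H \<bullet> b))"
    using Cons.prems[of b] by (auto simp: slice_integral_def)
  then show ?case using Cons by (simp add: side_product_def mult.assoc)
qed (simp add: side_product_def)

text \<open>
  Integrate \<open>(f - c)\<^sup>2 \<ge> 0\<close>, where \<open>c\<close> is the mean of \<open>f\<close>; linearity and monotonicity of the iterated integral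
  are enough.
\<close>

lemma iter_integral_cauchy_schwarz:
  assumes f: "continuous_on UNIV f" and H: "\<And>b. b \<in> set bs \<Longrightarrow> 0 < H \<bullet> b"
  shows "(iter_integral H bs f x)\<^sup>2 \<le> side_product H bs * iter_integral H bs (\<lambda>x. (f x)\<^sup>2) x"
proof -
  define V where "V = side_product H bs"
  define c where "c = iter_integral H bs f x / V"
  have V: "V > 0" unfolding V_def using side_product_pos H by blast
  have "0 = iter_integral H bs (\<lambda>_. 0) x" using iter_integral_const[OF H] by simp
  also have "\<dots> \<le> iter_integral H bs (\<lambda>x. ((f x)\<^sup>2 - (2 * c) * f x) + c\<^sup>2) x"
  proof (rule iter_integral_mono)
    show "0 \<le> (f x)\<^sup>2 - (2 * c) * f x + c\<^sup>2" for x
      using zero_le_power2[of "f x - c"] by (simp add: power2_eq_square algebra_simps)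
  qed (intro continuous_intros f)+
  also have "\<dots> = iter_integral H bs (\<lambda>x. (f x)\<^sup>2) x - 2 * c * iter_integral H bs f x + c\<^sup>2 * V"
    using f iter_integral_const[OF H]
    by (simp add: iter_integral_add iter_integral_diff iter_integral_mult continuous_intros V_def
        del: mult.assoc)
  finally show ?thesis
    using V unfolding c_def V_def[symmetric] by (simp add: field_simps power2_eq_square)
qed

text \<open>
  Differentiation under the integral sign.
\<close>

lemma slice_integral_has_partial:
  assumes f: "has_partial b f f'" and bc: "b \<noteq> c" "b \<in> Basis" "c \<in> Basis"
  shows "has_partial b (slice_integral H c f) (slice_integral H c f')"
  unfolding has_partial_def
proof (intro conjI allI)
  fix x s
  have cf: "continuous_on UNIV f" "continuous_on UNIV f'" using f by (auto simp: has_partial_def)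
  then show "continuous_on UNIV (slice_integral H c f)" "continuous_on UNIV (slice_integral H c f')"
    by (auto intro: slice_integral_continuous)
  have "((\<lambda>s. integral (cbox 0 (H \<bullet> c)) (\<lambda>t. f (set_coord b s (set_coord c t x)))) has_field_derivative
      integral (cbox 0 (H \<bullet> c)) (\<lambda>t. f' (set_coord b s (set_coord c t x)))) (at s within UNIV)"
  proof (rule leibniz_rule_field_derivative)
    show "continuous_on (UNIV \<times> cbox 0 (H \<bullet> c)) (\<lambda>(s, t). f' (set_coord b s (set_coord c t x)))"
      unfolding case_prod_unfold
      by (intro continuous_on_compose_UNIV[OF cf(2)] continuous_intros)
    show "(\<lambda>t. f (set_coord b s (set_coord c t x))) integrable_on cbox 0 (H \<bullet> c)" for s
      by (intro integrable_continuous continuous_on_compose_UNIV[OF cf(1)] continuous_intros)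
  qed (use f in \<open>auto simp: has_partial_def\<close>)
  then show "((\<lambda>s. slice_integral H c f (set_coord b s x)) has_real_derivative
      slice_integral H c f' (set_coord b s x)) (at s)"
    unfolding slice_integral_def using bc by (simp add: set_coord_commute[of c b])
qed

lemma iter_integral_has_partial:
  assumes "has_partial b f f'" "b \<in> Basis" "b \<notin> set cs" "set cs \<subseteq> Basis"
  shows "has_partial b (iter_integral H cs f) (iter_integral H cs f')"
  using assms by (induction cs arbitrary: f f') (auto simp: slice_integral_has_partial)

lemma slice_integral_variance_le:
  assumes f: "has_partial b f f'" and b: "b \<in> Basis" "0 < H \<bullet> b"
  shows "slice_integral H b (\<lambda>x. (f x)\<^sup>2) x - (slice_integral H b f x)\<^sup>2 / (H \<bullet> b)
    \<le> (H \<bullet> b / pi)\<^sup>2 * slice_integral H b (\<lambda>x. (f' x)\<^sup>2) x"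
proof -
  define L where "L = H \<bullet> b"
  define c where "c = slice_integral H b f x / L"
  have L: "L > 0" using b by (simp add: L_def)
  have cf: "continuous_on UNIV f" "continuous_on UNIV f'" using f by (auto simp: has_partial_def)
  have "integral {0..L} (\<lambda>s. (f (set_coord b s x) - c)\<^sup>2)
      \<le> (L / pi)\<^sup>2 * integral {0..L} (\<lambda>s. (f' (set_coord b s x))\<^sup>2)"
  proof (rule poincare_mean_zero)
    show "((\<lambda>s. f (set_coord b s x) - c) has_real_derivative f' (set_coord b s x)) (at s)" for s
      using f unfolding has_partial_def by (auto intro!: derivative_eq_intros)
    show "continuous_on UNIV (\<lambda>s. f' (set_coord b s x))"
      by (intro continuous_on_compose_UNIV[OF cf(2)] continuous_intros)
    show "integral {0..L} (\<lambda>s. f (set_coord b s x) - c) = 0"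
      using slice_integrable[OF cf(1), of b x 0 L] L
      by (subst integral_diff) (auto simp: c_def slice_integral_def L_def)
  qed (rule L)
  moreover have "((\<lambda>s. (f (set_coord b s x) - c)\<^sup>2) has_integral
      (slice_integral H b (\<lambda>x. (f x)\<^sup>2) x - 2 * c * slice_integral H b f x + c\<^sup>2 * L)) {0..L}"
  proof -
    have "((\<lambda>s. (f (set_coord b s x))\<^sup>2) has_integral slice_integral H b (\<lambda>x. (f x)\<^sup>2) x) {0..L}"
      unfolding slice_integral_def L_def using cf(1)
      by (intro integrable_integral slice_integrable[of "\<lambda>x. (f x)\<^sup>2"] continuous_intros)
    moreover have "((\<lambda>s. f (set_coord b s x)) has_integral slice_integral H b f x) {0..L}"
      unfolding slice_integral_def L_def using cf(1) by (intro integrable_integral slice_integrable)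
    moreover have "((\<lambda>s. c\<^sup>2) has_integral c\<^sup>2 * L) {0..L}"
      using has_integral_const_real[of "c\<^sup>2" 0 L] L by (simp add: mult.commute)
    ultimately have "((\<lambda>s. (f (set_coord b s x))\<^sup>2 - 2 * c * f (set_coord b s x) + c\<^sup>2) has_integral
      (slice_integral H b (\<lambda>x. (f x)\<^sup>2) x - 2 * c * slice_integral H b f x + c\<^sup>2 * L)) {0..L}"
      by (intro has_integral_add has_integral_diff has_integral_mult_right)
    then show ?thesis by (simp add: power2_diff algebra_simps)
  qed
  moreover have "slice_integral H b (\<lambda>x. (f x)\<^sup>2) x - (slice_integral H b f x)\<^sup>2 / L
     = slice_integral H b (\<lambda>x. (f x)\<^sup>2) x - 2 * c * slice_integral H b f x + c\<^sup>2 * L"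
    using L by (simp add: c_def field_simps power2_eq_square)
  ultimately show ?thesis
    by (simp add: integral_unique slice_integral_def L_def)
qed

text \<open>
  Tensorisation of the variance. Integrating out the coordinate \<open>b\<close> first, the variance of \<open>f\<close> over the box is
  the integral of the variances along the lines in direction \<open>b\<close> plus the variance of the line integral \<open>F\<close>
  over the remaining coordinates, divided by the side length. (Variances are not normalised by the volume.) The first part is controlled by the one-dimensional inequality, the
  second by induction, since the partial derivatives of \<open>F\<close> are line integrals of those of \<open>f\<close> and are
  estimated by the Cauchy--Schwarz inequality.
\<close>

lemma box_variance_le:
  assumes "distinct cs" "set cs \<subseteq> Basis"
    and "\<And>c. c \<in> set cs \<Longrightarrow> has_partial c f (D c)"
    and "\<And>c. c \<in> set cs \<Longrightarrow> 0 < H \<bullet> c" "\<And>c. c \<in> set cs \<Longrightarrow> H \<bullet> c \<le> m"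
    and "continuous_on UNIV f"
  shows "iter_integral H cs (\<lambda>x. (f x)\<^sup>2) x - (iter_integral H cs f x)\<^sup>2 / side_product H cs
    \<le> (m / pi)\<^sup>2 * (\<Sum>c\<in>set cs. iter_integral H cs (\<lambda>x. (D c x)\<^sup>2) x)"
  using assms
proof (induction cs arbitrary: f D)
  case Nil
  then show ?case by (simp add: side_product_def)
next
  case (Cons b bs)
  define F where "F = slice_integral H b f"
  define h where "h = H \<bullet> b"
  define V where "V = side_product H bs"
  have b: "b \<in> Basis" "0 < h" "h \<le> m" "b \<notin> set bs" "set bs \<subseteq> Basis" "has_partial b f (D b)"
    using Cons.prems by (auto simp: h_def)
  have cD: "continuous_on UNIV (D c)" if "c \<in> set (b # bs)" for c
    using Cons.prems(3)[OF that] by (simp add: has_partial_def)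
  have cf: "continuous_on UNIV f" by fact
  have cF: "continuous_on UNIV F" unfolding F_def by (rule slice_integral_continuous[OF cf])
  have IH: "iter_integral H bs (\<lambda>x. (F x)\<^sup>2) x - (iter_integral H bs F x)\<^sup>2 / V
    \<le> (m / pi)\<^sup>2 * (\<Sum>c\<in>set bs. iter_integral H bs (\<lambda>x. (slice_integral H b (D c) x)\<^sup>2) x)"
    unfolding F_def V_def
    by (rule Cons.IH) (use Cons.prems cf in \<open>auto intro!: slice_integral_has_partial slice_integral_continuous\<close>)
  have jensen: "iter_integral H bs (\<lambda>x. (slice_integral H b (D c) x)\<^sup>2) x
      \<le> h * iter_integral H bs (slice_integral H b (\<lambda>x. (D c x)\<^sup>2)) x" if "c \<in> set bs" for c
  proof -
    have "continuous_on UNIV (D c)" using cD that by simp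
    then have "iter_integral H bs (\<lambda>x. (slice_integral H b (D c) x)\<^sup>2) x
      \<le> iter_integral H bs (\<lambda>x. h * slice_integral H b (\<lambda>x. (D c x)\<^sup>2) x) x"
      using iter_integral_cauchy_schwarz[of "D c" "[b]" H] b
      by (intro iter_integral_mono)
        (auto intro!: continuous_intros slice_integral_continuous simp: side_product_def h_def)
    then show ?thesis by (simp add: iter_integral_mult)
  qed
  have "iter_integral H bs (\<lambda>x. slice_integral H b (\<lambda>x. (f x)\<^sup>2) x - (1 / h) * (F x)\<^sup>2) x
     \<le> iter_integral H bs (\<lambda>x. (h / pi)\<^sup>2 * slice_integral H b (\<lambda>x. (D b x)\<^sup>2) x) x"
    using slice_integral_variance_le[OF b(6) b(1)] b(2) cf cF cD[of b]
    by (intro iter_integral_mono)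
      (auto intro!: continuous_intros slice_integral_continuous simp: h_def F_def)
  then have "iter_integral H bs (slice_integral H b (\<lambda>x. (f x)\<^sup>2)) x
       - (1 / h) * iter_integral H bs (\<lambda>x. (F x)\<^sup>2) x
     \<le> (h / pi)\<^sup>2 * iter_integral H bs (slice_integral H b (\<lambda>x. (D b x)\<^sup>2)) x"
    using cf cF
    by (subst (asm) iter_integral_diff)
      (auto intro!: continuous_intros slice_integral_continuous simp: iter_integral_mult simp del: times_divide_eq_left)
  also have "\<dots> \<le> (m / pi)\<^sup>2 * iter_integral H bs (slice_integral H b (\<lambda>x. (D b x)\<^sup>2)) x"
  proof (intro mult_right_mono power_mono divide_right_mono)
    show "0 \<le> iter_integral H bs (slice_integral H b (\<lambda>x. (D b x)\<^sup>2)) x"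
      using iter_integral_mono[of "\<lambda>_. 0" "\<lambda>x. (D b x)\<^sup>2" H "b # bs" x]
        iter_integral_const[of "b # bs" H 0] Cons.prems cD[of b]
      by (auto intro!: continuous_intros)
  qed (use b in auto)
  finally have 1: "iter_integral H bs (slice_integral H b (\<lambda>x. (f x)\<^sup>2)) x
       - (1 / h) * iter_integral H bs (\<lambda>x. (F x)\<^sup>2) x
     \<le> (m / pi)\<^sup>2 * iter_integral H bs (slice_integral H b (\<lambda>x. (D b x)\<^sup>2)) x" .
  have "(1 / h) * (iter_integral H bs (\<lambda>x. (F x)\<^sup>2) x - (iter_integral H bs F x)\<^sup>2 / V)
     \<le> (1 / h) * ((m / pi)\<^sup>2 * (\<Sum>c\<in>set bs. h * iter_integral H bs (slice_integral H b (\<lambda>x. (D c x)\<^sup>2)) x))"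
    using b IH jensen
    by (intro mult_left_mono order.trans[OF IH] sum_mono) auto
  also have "\<dots> = (m / pi)\<^sup>2 * (\<Sum>c\<in>set bs. iter_integral H bs (slice_integral H b (\<lambda>x. (D c x)\<^sup>2)) x)"
    using b by (simp add: sum_distrib_left[symmetric])
  finally have 2: "(1 / h) * iter_integral H bs (\<lambda>x. (F x)\<^sup>2) x - (iter_integral H bs F x)\<^sup>2 / (h * V)
     \<le> (m / pi)\<^sup>2 * (\<Sum>c\<in>set bs. iter_integral H bs (slice_integral H b (\<lambda>x. (D c x)\<^sup>2)) x)"
    by (simp add: right_diff_distrib)
  show ?case
    using 1 2 b by (simp add: side_product_def F_def V_def h_def distrib_left)
qed

section \<open>The two inequalities for continuously differentiable functions\<close>

text \<open>
  The box is \<open>box 0 H\<close>, and the distinguished face lies in the hyperplane orthogonal to \<open>e\<close>. The list \<open>cs\<close> fixes an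
  order of integration over the directions of the face.
\<close>

locale box_with_face =
  fixes H e :: "'a::euclidean_space" and cs :: "'a list"
  assumes sides_pos: "\<And>b. b \<in> Basis \<Longrightarrow> 0 < H \<bullet> b"
    and e_Basis: "e \<in> Basis" and distinct_cs: "distinct cs" and set_cs: "set cs = Basis - {e}"
begin

abbreviation face_integral :: "('a \<Rightarrow> real) \<Rightarrow> 'a \<Rightarrow> real" where
  "face_integral \<equiv> iter_integral H cs"

definition face_area :: real where "face_area = side_product H cs"

definition box_integral :: "('a \<Rightarrow> real) \<Rightarrow> real" where
  "box_integral f = iter_integral H (cs @ [e]) f 0"

lemma face_area_pos: "0 < face_area"
  unfolding face_area_def by (rule side_product_pos) (use set_cs sides_pos in auto)

lemma box_integral_slices:
  "box_integral f = integral {0..H \<bullet> e} (\<lambda>s. face_integral f (s *\<^sub>R e))"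
  by (simp add: box_integral_def slice_integral_def)

lemma face_slices_continuous:
  assumes "continuous_on UNIV f"
  shows "continuous_on S (\<lambda>s. face_integral f (s *\<^sub>R e))"
  by (intro continuous_on_compose_UNIV[OF iter_integral_continuous[OF assms]] continuous_intros)

lemma face_slices_has_derivative:
  assumes "has_partial e f f'"
  shows "((\<lambda>s. face_integral f (s *\<^sub>R e)) has_real_derivative face_integral f' (s *\<^sub>R e)) (at s)"
proof -
  have "has_partial e (face_integral f) (face_integral f')"
    using assms e_Basis set_cs by (intro iter_integral_has_partial) auto
  from this[unfolded has_partial_def] have
    "((\<lambda>s. face_integral f (set_coord e s 0)) has_real_derivative face_integral f' (set_coord e s 0)) (at s)"
    by blast
  then show ?thesis by simp
qed

lemma face_integral_const: "face_integral (\<lambda>_. c) = (\<lambda>_. c * face_area)"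
  unfolding face_area_def using iter_integral_const set_cs sides_pos by (metis Diff_iff)

lemma face_cauchy_schwarz:
  "continuous_on UNIV f \<Longrightarrow> (face_integral f x)\<^sup>2 \<le> face_area * face_integral (\<lambda>x. (f x)\<^sup>2) x"
  unfolding face_area_def using set_cs sides_pos by (intro iter_integral_cauchy_schwarz) auto

lemma face_variance_le:
  assumes "\<And>b. b \<in> Basis \<Longrightarrow> has_partial b f (D b)" and "\<And>c. c \<in> Basis - {e} \<Longrightarrow> H \<bullet> c \<le> m"
  shows "face_integral (\<lambda>x. (f x)\<^sup>2) x - (face_integral f x)\<^sup>2 / face_area
    \<le> (m / pi)\<^sup>2 * (\<Sum>c\<in>Basis - {e}. face_integral (\<lambda>x. (D c x)\<^sup>2) x)"
  using box_variance_le[of cs f D H m x] assms distinct_cs set_cs sides_pos e_Basis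
  by (auto simp: face_area_def has_partial_def)

text \<open>
  With \<open>E\<close> the integral of \<open>f\<^sup>2\<close> and \<open>A\<close> the integral of \<open>f\<close> over a slice, \<open>E = (E - A\<^sup>2 / face_area) + A\<^sup>2 / face_area\<close>.
  The first summand is a variance over the slice and is bounded by the tangential derivatives. The second
  is bounded by the normal derivative, since \<open>A\<close> vanishes at \<open>0\<close> and \<open>A'\<^sup>2\<close> is at most the area times the slice
  integral of the squared normal derivative.
\<close>

lemma box_poincare_inequality:
  assumes D: "\<And>b. b \<in> Basis \<Longrightarrow> has_partial b f (D b)" and m: "\<And>c. c \<in> Basis - {e} \<Longrightarrow> H \<bullet> c \<le> m"
    and m0: "0 < m" and mean: "face_integral f 0 = 0"
  shows "box_integral (\<lambda>x. (f x)\<^sup>2)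
    \<le> (max (2 * (H \<bullet> e)) m / pi)\<^sup>2 * (\<Sum>b\<in>Basis. box_integral (\<lambda>x. (D b x)\<^sup>2))"
proof -
  define h where "h = H \<bullet> e"
  define M where "M = max (2 * h) m"
  define A where "A s = face_integral f (s *\<^sub>R e)" for s
  define A' where "A' s = face_integral (D e) (s *\<^sub>R e)" for s
  define E where "E s = face_integral (\<lambda>x. (f x)\<^sup>2) (s *\<^sub>R e)" for s
  define G where "G b s = face_integral (\<lambda>x. (D b x)\<^sup>2) (s *\<^sub>R e)" for b s
  have h: "h > 0" unfolding h_def using sides_pos e_Basis .
  have cD: "continuous_on UNIV (D b)" if "b \<in> Basis" for b
    using D[OF that] by (auto simp: has_partial_def)
  have cf: "continuous_on UNIV f" using D[OF e_Basis] by (auto simp: has_partial_def)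
  have cA: "continuous_on S A" and cA': "continuous_on S A'" and cE: "continuous_on S E" for S
    unfolding A_def A'_def E_def using cf cD[OF e_Basis]
    by (auto intro!: face_slices_continuous continuous_intros)
  have cG: "continuous_on S (G b)" if "b \<in> Basis" for b S
    unfolding G_def using cD[OF that] by (auto intro!: face_slices_continuous continuous_intros)
  have G0: "0 \<le> integral {0..h} (G b)" if "b \<in> Basis" for b
  proof (rule integral_nonneg)
    show "G b integrable_on {0..h}" using cG[OF that] by (intro integrable_continuous_real)
    show "0 \<le> G b s" for s
      unfolding G_def using iter_integral_mono[of "\<lambda>_. 0" "\<lambda>x. (D b x)\<^sup>2" H cs] face_integral_const[of 0]
        cD[OF that] by (auto intro!: continuous_intros)
  qed
  have A_le: "integral {0..h} (\<lambda>s. (A s)\<^sup>2) \<le> (2 * h / pi)\<^sup>2 * integral {0..h} (\<lambda>s. (A' s)\<^sup>2)"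
  proof (rule poincare_vanishing_at_endpoint)
    show "(A has_real_derivative A' s) (at s)" for s
      unfolding A_def A'_def by (rule face_slices_has_derivative[OF D[OF e_Basis]])
  qed (use cA' h mean in \<open>auto simp: A_def\<close>)
  have "integral {0..h} (\<lambda>s. (A' s)\<^sup>2) \<le> integral {0..h} (\<lambda>s. face_area * G e s)"
  proof (rule integral_le)
    show "(A' s)\<^sup>2 \<le> face_area * G e s" for s
      unfolding A'_def G_def by (rule face_cauchy_schwarz[OF cD[OF e_Basis]])
  qed (use cA' cG e_Basis in \<open>auto intro!: integrable_continuous_real continuous_intros\<close>)
  then have "(2 * h / pi)\<^sup>2 * integral {0..h} (\<lambda>s. (A' s)\<^sup>2) \<le> (2 * h / pi)\<^sup>2 * (face_area * integral {0..h} (G e))"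
    by (intro mult_left_mono) simp_all
  with A_le have "integral {0..h} (\<lambda>s. (A s)\<^sup>2) \<le> (2 * h / pi)\<^sup>2 * (face_area * integral {0..h} (G e))"
    by simp
  then have A_le: "(1 / face_area) * integral {0..h} (\<lambda>s. (A s)\<^sup>2) \<le> (2 * h / pi)\<^sup>2 * integral {0..h} (G e)"
    using face_area_pos by (simp add: field_simps)
  have "integral {0..h} E \<le> integral {0..h} (\<lambda>s. (m / pi)\<^sup>2 * (\<Sum>c\<in>Basis - {e}. G c s) + (1 / face_area) * (A s)\<^sup>2)"
  proof (rule integral_le)
    show "E s \<le> (m / pi)\<^sup>2 * (\<Sum>c\<in>Basis - {e}. G c s) + (1 / face_area) * (A s)\<^sup>2" for s
      using face_variance_le[OF D m, of "s *\<^sub>R e"] unfolding E_def G_def A_def by simp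
  qed (use cE cA cG face_area_pos in \<open>auto intro!: integrable_continuous_real continuous_intros\<close>)
  also have "\<dots> = (m / pi)\<^sup>2 * (\<Sum>c\<in>Basis - {e}. integral {0..h} (G c))
      + (1 / face_area) * integral {0..h} (\<lambda>s. (A s)\<^sup>2)"
    by (intro integral_unique has_integral_add has_integral_mult_right has_integral_sum integrable_integral
        integrable_continuous_real continuous_intros cA cG) auto
  also have "\<dots> \<le> (m / pi)\<^sup>2 * (\<Sum>c\<in>Basis - {e}. integral {0..h} (G c))
      + (2 * h / pi)\<^sup>2 * integral {0..h} (G e)"
    using A_le by (rule add_left_mono)
  also have "\<dots> \<le> (M / pi)\<^sup>2 * (\<Sum>c\<in>Basis - {e}. integral {0..h} (G c))
      + (M / pi)\<^sup>2 * integral {0..h} (G e)"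
    using m0 h G0 e_Basis
    by (intro add_mono mult_right_mono power_mono divide_right_mono sum_nonneg) (auto simp: M_def)
  also have "\<dots> = (M / pi)\<^sup>2 * (\<Sum>b\<in>Basis. integral {0..h} (G b))"
    by (simp add: sum.remove[OF finite_Basis e_Basis] distrib_left)
  finally show ?thesis
    unfolding box_integral_slices E_def G_def M_def h_def .
qed

text \<open>
  For \<open>\<theta> = 1\<close> this concerns the variance of \<open>f\<close> over the slices and for \<open>\<theta> = 0\<close> the plain square integral; both cases
  follow from the square of \<open>f' - p * (f - \<theta> * a)\<close>, where \<open>a\<close> is the slice mean. The first case gives the
  sharp trace inequality, the second a trace bound without a condition on the mean. The Riccati solution
  is \<open>p s = - \<kappa> * tanh (\<kappa> * (h - s))\<close>, which vanishes at the far end of the box.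
\<close>

lemma face_riccati:
  assumes f: "has_partial e f f'" and \<theta>: "\<theta> * \<theta> = \<theta>"
  shows "\<kappa> * tanh (\<kappa> * (H \<bullet> e)) *
      (face_integral (\<lambda>x. (f x)\<^sup>2) 0 - \<theta> * (face_integral f 0)\<^sup>2 / face_area)
    \<le> box_integral (\<lambda>x. (f' x)\<^sup>2) + \<kappa>\<^sup>2 * integral {0..H \<bullet> e}
        (\<lambda>s. face_integral (\<lambda>x. (f x)\<^sup>2) (s *\<^sub>R e) - \<theta> * (face_integral f (s *\<^sub>R e))\<^sup>2 / face_area)"
proof -
  define h where "h = H \<bullet> e"
  define A where "A s = face_integral f (s *\<^sub>R e)" for s
  define A' where "A' s = face_integral f' (s *\<^sub>R e)" for s
  define E where "E s = face_integral (\<lambda>x. (f x)\<^sup>2) (s *\<^sub>R e)" for s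
  define R where "R s = face_integral (\<lambda>x. f x * f' x) (s *\<^sub>R e)" for s
  define G where "G s = face_integral (\<lambda>x. (f' x)\<^sup>2) (s *\<^sub>R e)" for s
  define F where "F s = E s - \<theta> * (A s)\<^sup>2 / face_area" for s
  define p where "p s = - (\<kappa> * tanh (\<kappa> * (h - s)))" for s
  have h: "h > 0" unfolding h_def using sides_pos e_Basis .
  have V: "face_area > 0" by (rule face_area_pos)
  have cf: "continuous_on UNIV f" "continuous_on UNIV f'" using f by (auto simp: has_partial_def)
  have dA: "(A has_real_derivative A' s) (at s)" for s
    unfolding A_def A'_def by (rule face_slices_has_derivative[OF f])
  have dE: "(E has_real_derivative 2 * R s) (at s)" for s
  proof -
    have "has_partial e (\<lambda>x. (f x)\<^sup>2) (\<lambda>x. 2 * (f x * f' x))"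
      using has_partial_mult[OF f f] by (simp add: power2_eq_square mult.commute)
    from face_slices_has_derivative[OF this] show ?thesis
      unfolding E_def R_def by (simp add: iter_integral_mult)
  qed
  have "p h * F h - p 0 * F 0 \<le> integral {0..h} G + \<kappa>\<^sup>2 * integral {0..h} F"
  proof (rule riccati_comparison[where F' = "\<lambda>s. 2 * R s - 2 * \<theta> * A s * A' s / face_area"])
    show "(F has_real_derivative 2 * R s - 2 * \<theta> * A s * A' s / face_area) (at s)" for s
      unfolding F_def using V by (auto intro!: derivative_eq_intros dA dE)
    show "continuous_on UNIV (\<lambda>s. 2 * R s - 2 * \<theta> * A s * A' s / face_area)"
      unfolding R_def A_def A'_def using V cf
      by (auto intro!: continuous_intros face_slices_continuous)
    show "continuous_on UNIV G"
      unfolding G_def using cf by (auto intro!: continuous_intros face_slices_continuous)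
    show "0 \<le> h" using h by simp
    show "(p has_real_derivative \<kappa>\<^sup>2 - (p s)\<^sup>2) (at s)" for s
      unfolding p_def by (auto intro!: derivative_eq_intros simp: power2_eq_square algebra_simps)
    fix s
    define c where "c = \<theta> * A s / face_area"
    have "0 = face_integral (\<lambda>_. 0) (s *\<^sub>R e)" by (simp add: face_integral_const)
    also have "\<dots> \<le> face_integral (\<lambda>x. ((f' x)\<^sup>2 + (2 * p s * c) * f' x + (p s)\<^sup>2 * (f x)\<^sup>2 + (p s)\<^sup>2 * c\<^sup>2)
        - ((2 * p s) * (f x * f' x) + (2 * (p s)\<^sup>2 * c) * f x)) (s *\<^sub>R e)"
    proof (rule iter_integral_mono)
      fix x
      show "0 \<le> ((f' x)\<^sup>2 + (2 * p s * c) * f' x + (p s)\<^sup>2 * (f x)\<^sup>2 + (p s)\<^sup>2 * c\<^sup>2)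
        - ((2 * p s) * (f x * f' x) + (2 * (p s)\<^sup>2 * c) * f x)"
        using zero_le_power2[of "f' x - p s * (f x - c)"] by (simp add: power2_eq_square algebra_simps)
    qed (intro continuous_intros cf)+
    also have "\<dots> = (G s + (2 * p s * c) * A' s + (p s)\<^sup>2 * E s + ((p s)\<^sup>2 * c\<^sup>2) * face_area)
        - ((2 * p s) * R s + (2 * (p s)\<^sup>2 * c) * A s)"
      unfolding G_def A'_def E_def R_def A_def using cf
      by (simp add: iter_integral_add iter_integral_diff iter_integral_mult face_integral_const
          continuous_intros del: mult.assoc)
    finally have *: "0 \<le> (G s + (2 * p s * c) * A' s + (p s)\<^sup>2 * E s + ((p s)\<^sup>2 * c\<^sup>2) * face_area)
        - ((2 * p s) * R s + (2 * (p s)\<^sup>2 * c) * A s)" .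
    have "c\<^sup>2 * face_area = (\<theta> * \<theta>) * (A s)\<^sup>2 / face_area"
      using V by (simp add: c_def power2_eq_square field_simps)
    then have "c\<^sup>2 * face_area = c * A s"
      unfolding \<theta> by (simp add: c_def power2_eq_square)
    then have c2: "(p s)\<^sup>2 * c\<^sup>2 * face_area = (p s)\<^sup>2 * (c * A s)" by (simp add: mult.assoc)
    have F: "F s = E s - c * A s" by (simp add: F_def c_def power2_eq_square)
    have cA': "2 * \<theta> * A s * A' s / face_area = 2 * c * A' s" by (simp add: c_def)
    show "p s * (2 * R s - 2 * \<theta> * A s * A' s / face_area) - (p s)\<^sup>2 * F s \<le> G s"
      using * unfolding c2 F cA' by (simp add: algebra_simps)
  qed
  then show ?thesis
    unfolding box_integral_slices p_def F_def E_def A_def G_def h_def by simp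
qed

text \<open>
  The slice variance costs at least \<open>(pi / m)\<^sup>2\<close> times itself in tangential derivatives, so \<open>\<kappa> = pi / m\<close> is the right
  parameter. On the face itself the variance is the whole square integral because the mean is zero.
\<close>

lemma box_trace_inequality:
  assumes D: "\<And>b. b \<in> Basis \<Longrightarrow> has_partial b f (D b)" and m: "\<And>c. c \<in> Basis - {e} \<Longrightarrow> H \<bullet> c \<le> m"
    and m0: "0 < m" and mean: "face_integral f 0 = 0"
  shows "pi / m * tanh (pi * (H \<bullet> e) / m) * face_integral (\<lambda>x. (f x)\<^sup>2) 0
    \<le> (\<Sum>b\<in>Basis. box_integral (\<lambda>x. (D b x)\<^sup>2))"
proof -
  define h where "h = H \<bullet> e"
  have cD: "continuous_on UNIV (D b)" if "b \<in> Basis" for b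
    using D[OF that] by (auto simp: has_partial_def)
  have cf: "continuous_on UNIV f" using D[OF e_Basis] by (auto simp: has_partial_def)
  have cA: "continuous_on S (\<lambda>s. face_integral f (s *\<^sub>R e))"
    and cE: "continuous_on S (\<lambda>s. face_integral (\<lambda>x. (f x)\<^sup>2) (s *\<^sub>R e))" for S
    using cf by (auto intro!: face_slices_continuous continuous_intros)
  have cG: "continuous_on S (\<lambda>s. face_integral (\<lambda>x. (D b x)\<^sup>2) (s *\<^sub>R e))" if "b \<in> Basis" for b S
    using cD[OF that] by (auto intro!: face_slices_continuous continuous_intros)
  have "integral {0..h} (\<lambda>s. face_integral (\<lambda>x. (f x)\<^sup>2) (s *\<^sub>R e) - 1 * (face_integral f (s *\<^sub>R e))\<^sup>2 / face_area)
      \<le> integral {0..h} (\<lambda>s. (m / pi)\<^sup>2 * (\<Sum>c\<in>Basis - {e}. face_integral (\<lambda>x. (D c x)\<^sup>2) (s *\<^sub>R e)))"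
    using face_variance_le[OF D m] face_area_pos
    by (intro integral_le integrable_continuous_real continuous_intros cA cE cG) auto
  also have "\<dots> = (m / pi)\<^sup>2 * (\<Sum>c\<in>Basis - {e}. integral {0..h} (\<lambda>s. face_integral (\<lambda>x. (D c x)\<^sup>2) (s *\<^sub>R e)))"
    by (intro integral_unique has_integral_mult_right has_integral_sum integrable_integral
        integrable_continuous_real cG) auto
  also have "\<dots> = (m / pi)\<^sup>2 * (\<Sum>c\<in>Basis - {e}. box_integral (\<lambda>x. (D c x)\<^sup>2))"
    by (simp add: box_integral_slices h_def)
  finally have "(pi / m)\<^sup>2 * integral {0..h} (\<lambda>s. face_integral (\<lambda>x. (f x)\<^sup>2) (s *\<^sub>R e) - 1 * (face_integral f (s *\<^sub>R e))\<^sup>2 / face_area)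
     \<le> (pi / m)\<^sup>2 * ((m / pi)\<^sup>2 * (\<Sum>c\<in>Basis - {e}. box_integral (\<lambda>x. (D c x)\<^sup>2)))"
    by (rule mult_left_mono) simp
  also have "\<dots> = (\<Sum>c\<in>Basis - {e}. box_integral (\<lambda>x. (D c x)\<^sup>2))"
    using m0 by (simp add: power_divide)
  finally show ?thesis
    using face_riccati[OF D[OF e_Basis], of 1 "pi / m"] mean
    by (simp add: sum.remove[OF finite_Basis e_Basis] h_def)
qed

lemma box_trace_bound:
  assumes "has_partial e f f'"
  shows "tanh (H \<bullet> e) * face_integral (\<lambda>x. (f x)\<^sup>2) 0
    \<le> box_integral (\<lambda>x. (f x)\<^sup>2) + box_integral (\<lambda>x. (f' x)\<^sup>2)"
  using face_riccati[OF assms, of 0 1] by (simp add: box_integral_slices)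

end

section \<open>Smooth functions and bumps\<close>

lemma has_derivative_partial:
  assumes "f differentiable (at x)"
  shows "(f has_derivative frechet_derivative f (at x)) (at x)"
  using assms by (simp add: frechet_derivative_works)

lemma partial_eqI:
  assumes "(f has_derivative f') (at x)"
  shows "partial b f x = f' b"
  using frechet_derivative_at[OF assms] by (simp add: partial_def)

lemma partial_const: "partial b (\<lambda>_. c) = (\<lambda>_. 0)"
  by (rule ext, rule partial_eqI) (rule derivative_intros)

lemma partial_add:
  assumes "\<And>x. f differentiable (at x)" "\<And>x. g differentiable (at x)"
  shows "partial b (\<lambda>x. f x + g x) = (\<lambda>x. partial b f x + partial b g x)"
proof
  fix x
  show "partial b (\<lambda>x. f x + g x) x = partial b f x + partial b g x"
    unfolding partial_def[of b f] partial_def[of b g]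
    by (rule partial_eqI) (intro has_derivative_add has_derivative_partial assms)
qed

lemma partial_mult:
  assumes "\<And>x. f differentiable (at x)" "\<And>x. g differentiable (at x)"
  shows "partial b (\<lambda>x. f x * g x) = (\<lambda>x. f x * partial b g x + partial b f x * g x)"
proof
  fix x
  show "partial b (\<lambda>x. f x * g x) x = f x * partial b g x + partial b f x * g x"
    unfolding partial_def[of b f] partial_def[of b g]
    by (rule partial_eqI) (intro has_derivative_mult has_derivative_partial assms)
qed

lemma Ck_mono: "Ck (Suc k) f \<Longrightarrow> Ck k f"
proof (induction k arbitrary: f)
  case 0
  then show ?case
    by (simp add: differentiable_imp_continuous_on differentiable_on_def)
next
  case (Suc k)
  then have "Ck k (partial b f)" if "b \<in> Basis" for b
    using that by (metis Ck.simps(2))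
  with Suc.prems show ?case by simp
qed

lemma Ck_const: "Ck k (\<lambda>_. c)"
  by (induction k arbitrary: c) (auto simp: partial_const)

lemma Ck_add: "\<lbrakk>Ck k f; Ck k g\<rbrakk> \<Longrightarrow> Ck k (\<lambda>x. f x + g x)"
  by (induction k arbitrary: f g) (auto simp: partial_add continuous_on_add differentiable_add)

lemma Ck_mult: "\<lbrakk>Ck k f; Ck k g\<rbrakk> \<Longrightarrow> Ck k (\<lambda>x. f x * g x)"
proof (induction k arbitrary: f g)
  case 0
  then show ?case by (simp add: continuous_on_mult)
next
  case (Suc k)
  have "Ck k f" "Ck k g" using Suc.prems Ck_mono by blast+
  with Suc show ?case
    by (auto simp: partial_mult intro!: Ck_add differentiable_mult)
qed

lemma smooth_const: "smooth (\<lambda>_. c)"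
  by (simp add: smooth_def Ck_const)

lemma smooth_add: "\<lbrakk>smooth f; smooth g\<rbrakk> \<Longrightarrow> smooth (\<lambda>x. f x + g x)"
  by (simp add: smooth_def Ck_add)

lemma smooth_mult: "\<lbrakk>smooth f; smooth g\<rbrakk> \<Longrightarrow> smooth (\<lambda>x. f x * g x)"
  by (simp add: smooth_def Ck_mult)

lemma smooth_prod:
  "\<lbrakk>finite A; \<And>a. a \<in> A \<Longrightarrow> smooth (f a)\<rbrakk> \<Longrightarrow> smooth (\<lambda>x. \<Prod>a\<in>A. f a x)"
  by (induction A rule: finite_induct) (auto simp: smooth_const intro!: smooth_mult)

lemma smooth_diff: "\<lbrakk>smooth f; smooth g\<rbrakk> \<Longrightarrow> smooth (\<lambda>x. f x - g x)"
  using smooth_add[of f "\<lambda>x. -1 * g x"] smooth_mult[OF smooth_const[of "-1"], of g] by simp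

text \<open>
  A one-variable function is given with the sequence of all its derivatives, because then an induction on the
  order of differentiability can treat all derivatives simultaneously.
\<close>

lemma smooth_ridge:
  fixes D :: "nat \<Rightarrow> real \<Rightarrow> real" and a :: "'a::euclidean_space"
  assumes D: "\<And>j t. (D j has_real_derivative D (Suc j) t) (at t)"
  shows "smooth (\<lambda>x. D j (x \<bullet> a + \<beta>))"
proof -
  have der: "((\<lambda>x. D j (x \<bullet> a + \<beta>)) has_derivative (\<lambda>h. (h \<bullet> a) * D (Suc j) (x \<bullet> a + \<beta>))) (at x)" for j x
  proof -
    have "((\<lambda>x. x \<bullet> a + \<beta>) has_derivative (\<lambda>h. h \<bullet> a)) (at x)"
      by (auto intro!: derivative_eq_intros)
    from has_derivative_compose[OF this D[of j, THEN has_field_derivative_imp_has_derivative]]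
    show ?thesis by (simp add: mult.commute)
  qed
  have "Ck k (\<lambda>x. D j (x \<bullet> a + \<beta>))" for k j
  proof (induction k arbitrary: j)
    case 0
    have "continuous_on UNIV (D j)"
      by (rule DERIV_continuous_on[of _ _ "D (Suc j)"]) (rule D)
    then have "continuous_on UNIV (\<lambda>x. D j (x \<bullet> a + \<beta>))"
      by (rule continuous_on_compose_UNIV) (intro continuous_intros)
    then show ?case by simp
  next
    case (Suc k)
    have "partial b (\<lambda>x. D j (x \<bullet> a + \<beta>)) = (\<lambda>x. (b \<bullet> a) * D (Suc j) (x \<bullet> a + \<beta>))" for b
      by (rule ext, rule partial_eqI) (rule der)
    then show ?case
      using der[of j] Suc by (auto intro!: Ck_mult Ck_const simp: differentiable_def)
  qed
  then show ?thesis by (simp add: smooth_def)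
qed

lemma smooth_differentiable: "smooth f \<Longrightarrow> f differentiable (at x)"
  unfolding smooth_def by (drule spec[of _ "Suc 0"]) simp

lemma smooth_partial: "\<lbrakk>smooth f; b \<in> Basis\<rbrakk> \<Longrightarrow> smooth (partial b f)"
  unfolding smooth_def by (metis Ck.simps(2))

lemma smooth_continuous: "smooth f \<Longrightarrow> continuous_on UNIV f"
  unfolding smooth_def by (drule spec[of _ 0]) simp

lemma smooth_has_partial:
  assumes f: "smooth f" and b: "b \<in> Basis"
  shows "has_partial b f (partial b f)"
  unfolding has_partial_def
proof (intro conjI allI)
  fix x s
  have "((\<lambda>s. set_coord b s x) has_derivative (\<lambda>h. h *\<^sub>R b)) (at s)"
    unfolding set_coord_def by (auto intro!: derivative_eq_intros simp: algebra_simps)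
  from has_derivative_compose[OF this has_derivative_partial[OF smooth_differentiable[OF f]]]
  have *: "((\<lambda>s. f (set_coord b s x)) has_derivative
    (\<lambda>h. frechet_derivative f (at (set_coord b s x)) (h *\<^sub>R b))) (at s)" .
  have "linear (frechet_derivative f (at (set_coord b s x)))"
    by (rule linear_frechet_derivative[OF smooth_differentiable[OF f]])
  then have "(\<lambda>h. frechet_derivative f (at (set_coord b s x)) (h *\<^sub>R b)) = (*) (partial b f (set_coord b s x))"
    by (simp add: partial_def linear_scale fun_eq_iff)
  with * show "((\<lambda>s. f (set_coord b s x)) has_real_derivative partial b f (set_coord b s x)) (at s)"
    by (simp add: has_field_derivative_def)
qed (use smooth_continuous smooth_partial f b in auto)

lemma poly_times_exp_neg_tendsto_0:
  fixes q :: "real poly"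
  assumes c: "0 < c"
  shows "((\<lambda>y. poly q y * exp (- (c * y))) \<longlongrightarrow> 0) at_top"
proof -
  have "((\<lambda>y. y ^ k * exp (- (c * y))) \<longlongrightarrow> 0) at_top" for k
  proof -
    have "filterlim (\<lambda>y. c * y) at_top at_top"
      using c by (intro filterlim_tendsto_pos_mult_at_top[OF tendsto_const]) (auto simp: filterlim_ident)
    from filterlim_compose[OF tendsto_power_div_exp_0[of k] this]
    have "((\<lambda>y. (1 / c) ^ k * ((c * y) ^ k / exp (c * y))) \<longlongrightarrow> (1 / c) ^ k * 0) at_top"
      by (intro tendsto_mult tendsto_const)
    then show ?thesis using c by (simp add: power_mult_distrib power_divide exp_minus field_simps)
  qed
  then have "((\<lambda>y. \<Sum>i\<le>degree q. coeff q i * (y ^ i * exp (- (c * y)))) \<longlongrightarrow> (\<Sum>i\<le>degree q. coeff q i * 0)) at_top"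
    by (intro tendsto_sum tendsto_mult tendsto_const)
  then show ?thesis by (simp add: poly_altdef sum_distrib_right mult.assoc)
qed

text \<open>
  The function \<open>exp (- c / t)\<close>, continued by \<open>0\<close> to \<open>t \<le> 0\<close>, is smooth: its derivatives for \<open>t > 0\<close> are polynomials in
  \<open>1 / t\<close> times the function itself. The polynomials obey the recursion below, and \<open>flat c j\<close> is the \<open>j\<close>-th
  derivative.
\<close>

fun flat_poly :: "real \<Rightarrow> nat \<Rightarrow> real poly" where
  "flat_poly c 0 = 1"
| "flat_poly c (Suc j) = [:0, 0, 1:] * (smult c (flat_poly c j) - pderiv (flat_poly c j))"

definition flat :: "real \<Rightarrow> nat \<Rightarrow> real \<Rightarrow> real" where
  "flat c j t = (if t \<le> 0 then 0 else poly (flat_poly c j) (1 / t) * exp (- (c / t)))"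

lemma flat_has_derivative:
  assumes c: "0 < c"
  shows "(flat c j has_real_derivative flat c (Suc j) t) (at t)"
proof -
  consider "t < 0" | "t = 0" | "t > 0" by linarith
  then show ?thesis
  proof cases
    case 1
    have *: "((\<lambda>_. 0) has_real_derivative flat c (Suc j) t) (at t)"
      using 1 by (simp add: flat_def)
    have "eventually (\<lambda>s. flat c j s = 0) (nhds t)"
      using eventually_nhds_in_open[of "{..<0}" t] 1 by (auto elim!: eventually_mono simp: flat_def)
    from DERIV_cong_ev[OF refl this refl] * show ?thesis by blast
  next
    case 2
    have "((\<lambda>h. poly ([:0, 1:] * flat_poly c j) (inverse h) * exp (- (c * inverse h))) \<longlongrightarrow> 0) (at_right 0)"
      by (rule filterlim_compose[OF poly_times_exp_neg_tendsto_0[OF c] filterlim_inverse_at_top_right])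
    moreover have "eventually (\<lambda>h. poly ([:0, 1:] * flat_poly c j) (inverse h) * exp (- (c * inverse h))
       = flat c j h / h) (at_right 0)"
      using eventually_at_right_less[of 0]
      by eventually_elim (simp add: flat_def inverse_eq_divide)
    ultimately have "((\<lambda>h. flat c j h / h) \<longlongrightarrow> 0) (at_right 0)"
      by (rule Lim_transform_eventually)
    moreover have "((\<lambda>h. flat c j h / h) \<longlongrightarrow> 0) (at_left 0)"
    proof (rule tendsto_eventually)
      show "eventually (\<lambda>h. flat c j h / h = 0) (at_left 0)"
        by (auto simp: eventually_at_left_field flat_def intro!: exI[of _ "-1"])
    qed
    ultimately have "((\<lambda>h. flat c j h / h) \<longlongrightarrow> 0) (at 0)"
      using filterlim_split_at by blast
    then show ?thesis
      using 2 by (simp add: DERIV_def flat_def)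
  next
    case 3
    have *: "((\<lambda>t. poly (flat_poly c j) (1 / t) * exp (- (c / t))) has_real_derivative
      flat c (Suc j) t) (at t)"
    proof -
      have y: "((\<lambda>t. 1 / t) has_real_derivative - ((1 / t) * (1 / t))) (at t)"
        using DERIV_inverse[of t] 3 by (simp add: inverse_eq_divide power2_eq_square)
      have "((\<lambda>t. - (c * (1 / t))) has_real_derivative - (c * (- ((1 / t) * (1 / t))))) (at t)"
        by (intro DERIV_minus DERIV_cmult y)
      from DERIV_mult[OF DERIV_chain2[OF poly_DERIV y] DERIV_fun_exp[OF this], of "flat_poly c j"]
      show ?thesis using 3 by (simp add: flat_def algebra_simps)
    qed
    have "eventually (\<lambda>s. flat c j s = poly (flat_poly c j) (1 / s) * exp (- (c / s))) (nhds t)"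
      using eventually_nhds_in_open[of "{0<..}" t] 3 by (auto elim!: eventually_mono simp: flat_def)
    from DERIV_cong_ev[OF refl this refl] * show ?thesis by blast
  qed
qed

lemma flat_0: "flat c 0 t = (if t \<le> 0 then 0 else exp (- (c / t)))"
  by (simp add: flat_def)

text \<open>
  For \<open>c\<close> tending to \<open>0\<close> these functions converge to the indicator of the box while the box on which they are
  nonzero stays the same.
\<close>

definition box_bump :: "real \<Rightarrow> 'a::euclidean_space \<Rightarrow> 'a \<Rightarrow> 'a \<Rightarrow> real" where
  "box_bump c a d x = (\<Prod>b\<in>Basis. flat c 0 (x \<bullet> b - a \<bullet> b) * flat c 0 (d \<bullet> b - x \<bullet> b))"

lemma smooth_box_bump:
  assumes "0 < c"
  shows "smooth (box_bump c a d)"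
proof -
  have "smooth (\<lambda>x. flat c 0 (x \<bullet> v + \<beta>))" for v :: 'a and \<beta>
    by (rule smooth_ridge[where D = "flat c"]) (rule flat_has_derivative[OF assms])
  from this[of b "- (a \<bullet> b)" for b] this[of "- b" "d \<bullet> b" for b]
  have "smooth (\<lambda>x. flat c 0 (x \<bullet> b - a \<bullet> b))" "smooth (\<lambda>x. flat c 0 (d \<bullet> b - x \<bullet> b))" for b
    by simp_all
  then show ?thesis
    unfolding box_bump_def[abs_def] by (intro smooth_prod smooth_mult) auto
qed

lemma box_bump_range:
  assumes "0 < c"
  shows "0 \<le> box_bump c a d x" "box_bump c a d x \<le> 1"
proof -
  have "0 \<le> flat c 0 t \<and> flat c 0 t \<le> 1" for t
    using assms by (auto simp: flat_0)
  then show "0 \<le> box_bump c a d x" "box_bump c a d x \<le> 1"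
    unfolding box_bump_def by (auto intro!: prod_nonneg prod_le_1 mult_le_one)
qed

lemma box_bump_eq_0: "x \<notin> box a d \<Longrightarrow> box_bump c a d x = 0"
  unfolding box_bump_def
  by (rule prod_zero) (auto simp: mem_box flat_0 not_less split: if_splits)

lemma test_function_box_bump:
  assumes "0 < c" "cbox a d \<subseteq> \<Omega>"
  shows "test_function \<Omega> (box_bump c a d)"
proof -
  have "{x. box_bump c a d x \<noteq> 0} \<subseteq> cbox a d"
    using box_bump_eq_0 box_subset_cbox by blast
  then have "closure {x. box_bump c a d x \<noteq> 0} \<subseteq> cbox a d"
    by (rule closure_minimal) (rule closed_cbox)
  then show ?thesis
    unfolding test_function_def using assms smooth_box_bump bounded_subset[OF bounded_cbox]
    by (auto simp: compact_eq_bounded_closed)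
qed

lemma box_bump_tendsto_indicator:
  "(\<lambda>n. box_bump (1 / real (Suc n)) a d x) \<longlonglongrightarrow> indicator (box a d) x"
proof (cases "x \<in> box a d")
  case True
  have "(\<lambda>n. flat (1 / real (Suc n)) 0 t) \<longlonglongrightarrow> 1" if "t > 0" for t
  proof -
    have "(\<lambda>n. 1 / real (Suc n)) \<longlonglongrightarrow> 0"
      using LIMSEQ_inverse_real_of_nat by (simp add: inverse_eq_divide)
    then have "(\<lambda>n. exp (- (1 / real (Suc n) / t))) \<longlonglongrightarrow> exp (- (0 / t))"
      using that by (intro tendsto_intros) auto
    then show ?thesis using that by (simp add: flat_0)
  qed
  then have "(\<lambda>n. box_bump (1 / real (Suc n)) a d x) \<longlonglongrightarrow> (\<Prod>b\<in>(Basis :: 'a set). 1 * 1)"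
    unfolding box_bump_def using True by (intro tendsto_prod tendsto_mult) (auto simp: mem_box)
  then show ?thesis using True by simp
qed (simp add: box_bump_eq_0)

section \<open>Square-integrable functions and integrals over the box and its face\<close>

lemma L2_borel: "f \<in> L2 M \<Longrightarrow> f \<in> borel_measurable M"
  by (simp add: L2_def)

lemma L2_integrable: "f \<in> L2 M \<Longrightarrow> integrable M (\<lambda>x. (norm (f x))\<^sup>2)"
  by (simp add: L2_def)

lemma L2_norm_nonneg: "0 \<le> L2_norm M f"
  by (simp add: L2_norm_def)

lemma L2_norm_power2: "(L2_norm M f)\<^sup>2 = (LINT x|M. (norm (f x))\<^sup>2)"
  by (simp add: L2_norm_def)

lemma norm_add_power2_le:
  fixes a b :: "'a::real_normed_vector"
  assumes "0 < t"
  shows "(norm (a + b))\<^sup>2 \<le> (1 + t) * (norm a)\<^sup>2 + (1 + 1 / t) * (norm b)\<^sup>2"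
proof -
  have "(norm (a + b))\<^sup>2 \<le> (norm a + norm b)\<^sup>2"
    by (intro power_mono norm_triangle_ineq) simp
  moreover have "0 \<le> (t * norm a - norm b)\<^sup>2 / t"
    using assms by simp
  moreover have "(t * norm a - norm b)\<^sup>2 / t = t * (norm a)\<^sup>2 - 2 * norm a * norm b + (norm b)\<^sup>2 / t"
    using assms by (simp add: field_simps power2_eq_square)
  ultimately show ?thesis
    by (simp add: distrib_right power2_sum)
qed

lemma L2_add:
  assumes "f \<in> L2 M" "g \<in> L2 M"
  shows "(\<lambda>x. f x + g x) \<in> L2 M"
proof -
  note [measurable] = L2_borel[OF assms(1)] L2_borel[OF assms(2)]
  have "integrable M (\<lambda>x. (norm (f x + g x))\<^sup>2)"
  proof (rule Bochner_Integration.integrable_bound)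
    show "integrable M (\<lambda>x. 2 * (norm (f x))\<^sup>2 + 2 * (norm (g x))\<^sup>2)"
      by (intro Bochner_Integration.integrable_add integrable_mult_right L2_integrable assms)
    have "(norm (f x + g x))\<^sup>2 \<le> 2 * (norm (f x))\<^sup>2 + 2 * (norm (g x))\<^sup>2" for x
      using norm_add_power2_le[of 1 "f x" "g x"] by simp
    then show "AE x in M. norm ((norm (f x + g x))\<^sup>2) \<le> norm (2 * (norm (f x))\<^sup>2 + 2 * (norm (g x))\<^sup>2)"
      by simp
  qed measurable
  then show ?thesis by (simp add: L2_def)
qed

lemma L2_scaleR:
  assumes "f \<in> L2 M"
  shows "(\<lambda>x. c *\<^sub>R f x) \<in> L2 M"
proof -
  note [measurable] = L2_borel[OF assms]
  show ?thesis
    using L2_integrable[OF assms] by (simp add: L2_def power_mult_distrib)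
qed

lemma L2_diff:
  assumes "f \<in> L2 M" "g \<in> L2 M"
  shows "(\<lambda>x. f x - g x) \<in> L2 M"
  using L2_add[OF assms(1) L2_scaleR[OF assms(2), of "-1"]] by simp

text \<open>
  Minkowski's inequality follows from the weighted estimate of \<open>(norm (a + b))\<^sup>2\<close> by optimising the weight, which is the
  quotient of the two norms.
\<close>

lemma L2_norm_triangle:
  assumes f: "f \<in> L2 M" and g: "g \<in> L2 M"
  shows "L2_norm M (\<lambda>x. f x + g x) \<le> L2_norm M f + L2_norm M g"
proof -
  define a b c where "a = L2_norm M f" and "b = L2_norm M g" and "c = L2_norm M (\<lambda>x. f x + g x)"
  have nn: "0 \<le> a" "0 \<le> b" "0 \<le> c" unfolding a_def b_def c_def by (simp_all add: L2_norm_nonneg)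
  have *: "c\<^sup>2 \<le> (1 + t) * a\<^sup>2 + (1 + 1 / t) * b\<^sup>2" if t: "0 < t" for t
  proof -
    have "c\<^sup>2 \<le> (LINT x|M. (1 + t) * (norm (f x))\<^sup>2 + (1 + 1 / t) * (norm (g x))\<^sup>2)"
      unfolding c_def L2_norm_power2
    proof (rule integral_mono)
      show "integrable M (\<lambda>x. (norm (f x + g x))\<^sup>2)"
        by (rule L2_integrable[OF L2_add[OF f g]])
      show "integrable M (\<lambda>x. (1 + t) * (norm (f x))\<^sup>2 + (1 + 1 / t) * (norm (g x))\<^sup>2)"
        using f g by (intro Bochner_Integration.integrable_add integrable_mult_right L2_integrable)
    qed (rule norm_add_power2_le[OF t])
    then show ?thesis
      using L2_integrable[OF f] L2_integrable[OF g]
      by (subst (asm) Bochner_Integration.integral_add) (auto simp: a_def b_def L2_norm_power2)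
  qed
  have "c\<^sup>2 \<le> (a + b + \<epsilon>)\<^sup>2" if \<epsilon>: "0 < \<epsilon>" for \<epsilon>
  proof -
    \<comment> \<open>the optimal weight is a quotient of norms; the shift keeps it positive and finite\<close>
    define a' b' where "a' = a + \<epsilon> / 2" and "b' = b + \<epsilon> / 2"
    have p: "0 < a'" "0 < b'" "a \<le> a'" "b \<le> b'" using nn \<epsilon> by (auto simp: a'_def b'_def)
    have "c\<^sup>2 \<le> (1 + b' / a') * a\<^sup>2 + (1 + 1 / (b' / a')) * b\<^sup>2"
      using p by (intro *) simp
    also have "\<dots> \<le> (1 + b' / a') * a'\<^sup>2 + (1 + 1 / (b' / a')) * b'\<^sup>2"
      using p nn by (intro add_mono mult_left_mono power_mono) auto
    also have "\<dots> = (a' + b')\<^sup>2"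
      using p by (simp add: field_simps power2_eq_square)
    also have "a' + b' = a + b + \<epsilon>" by (simp add: a'_def b'_def)
    finally show ?thesis .
  qed
  then have "c \<le> a + b + \<epsilon>" if "0 < \<epsilon>" for \<epsilon>
    using that nn by (intro power2_le_imp_le[of c]) auto
  then show ?thesis
    unfolding a_def b_def c_def by (rule field_le_epsilon)
qed

lemma L2_norm_minus_commute: "L2_norm M (\<lambda>x. f x - g x) = L2_norm M (\<lambda>x. g x - f x)"
  by (simp add: L2_norm_def norm_minus_commute)

lemma L2_norm_le_add_diff:
  assumes "f \<in> L2 M" "g \<in> L2 M"
  shows "L2_norm M f \<le> L2_norm M g + L2_norm M (\<lambda>x. g x - f x)"
  using L2_norm_triangle[OF assms(2) L2_diff[OF assms]] by (subst L2_norm_minus_commute) simp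

lemma L2_norm_cong_AE:
  assumes "f \<in> L2 M" "g \<in> L2 M" "AE x in M. f x = g x"
  shows "L2_norm M f = L2_norm M g"
proof -
  note [measurable] = L2_borel[OF assms(1)] L2_borel[OF assms(2)]
  have "(LINT x|M. (norm (f x))\<^sup>2) = (LINT x|M. (norm (g x))\<^sup>2)"
    using assms(3) by (intro integral_cong_AE) auto
  then show ?thesis by (simp add: L2_norm_def)
qed

lemma L2_mult_integrable:
  fixes f g :: "'a \<Rightarrow> real"
  assumes "f \<in> L2 M" "g \<in> L2 M"
  shows "integrable M (\<lambda>x. f x * g x)"
proof -
  note [measurable] = L2_borel[OF assms(1)] L2_borel[OF assms(2)]
  show ?thesis
  proof (rule Bochner_Integration.integrable_bound)
    show "integrable M (\<lambda>x. (norm (f x))\<^sup>2 + (norm (g x))\<^sup>2)"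
      by (intro Bochner_Integration.integrable_add L2_integrable assms)
    have "\<bar>f x * g x\<bar> \<le> (f x)\<^sup>2 + (g x)\<^sup>2" for x
      using zero_le_power2[of "\<bar>f x\<bar> - \<bar>g x\<bar>"] zero_le_power2[of "f x"] zero_le_power2[of "g x"]
      unfolding power2_diff abs_mult power2_abs by linarith
    then show "AE x in M. norm (f x * g x) \<le> norm ((norm (f x))\<^sup>2 + (norm (g x))\<^sup>2)"
      by simp
  qed measurable
qed

lemma L2_inner:
  fixes g :: "'a \<Rightarrow> 'b::euclidean_space"
  assumes "g \<in> L2 M" "b \<in> Basis"
  shows "(\<lambda>x. g x \<bullet> b) \<in> L2 M"
proof -
  note [measurable] = L2_borel[OF assms(1)]
  have "integrable M (\<lambda>x. (norm (g x \<bullet> b))\<^sup>2)"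
  proof (rule Bochner_Integration.integrable_bound[OF L2_integrable[OF assms(1)]])
    have "\<bar>g x \<bullet> b\<bar>\<^sup>2 \<le> (norm (g x))\<^sup>2" for x
      using Basis_le_norm[OF assms(2), of "g x"] by (intro power_mono) auto
    then show "AE x in M. norm ((norm (g x \<bullet> b))\<^sup>2) \<le> norm ((norm (g x))\<^sup>2)"
      by simp
  qed measurable
  then show ?thesis by (simp add: L2_def)
qed

lemma (in finite_measure) L2_const: "(\<lambda>_. c) \<in> L2 M"
  by (simp add: L2_def)

lemma (in finite_measure) L2_norm_const: "L2_norm M (\<lambda>_. c :: real) = \<bar>c\<bar> * sqrt (measure M (space M))"
  by (simp add: L2_norm_def real_sqrt_mult)

lemma (in finite_measure) L2_imp_integrable:
  fixes f :: "'a \<Rightarrow> real"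
  assumes "f \<in> L2 M" shows "integrable M f"
  using L2_mult_integrable[OF assms L2_const[of 1]] by simp

lemma (in finite_measure) integral_le_L2_norm:
  fixes f :: "'a \<Rightarrow> real"
  assumes f: "f \<in> L2 M"
  shows "\<bar>LINT x|M. f x\<bar> \<le> sqrt (measure M (space M)) * L2_norm M f"
proof -
  define m where "m = measure M (space M)"
  define I where "I = (LINT x|M. f x)"
  have int: "integrable M f" "integrable M (\<lambda>x. (f x)\<^sup>2)"
    using L2_imp_integrable[OF f] L2_integrable[OF f] by auto
  have "0 \<le> (LINT x|M. (m * f x - I)\<^sup>2)" by (rule integral_nonneg_AE) simp
  also have "(LINT x|M. (m * f x - I)\<^sup>2) = (LINT x|M. m\<^sup>2 * (f x)\<^sup>2 - 2 * m * I * f x + I\<^sup>2)"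
    by (simp add: power2_diff power_mult_distrib algebra_simps)
  also have "\<dots> = m\<^sup>2 * (LINT x|M. (f x)\<^sup>2) - 2 * m * I * I + I\<^sup>2 * m"
    using int by (simp add: I_def m_def)
  also have "(LINT x|M. (f x)\<^sup>2) = (L2_norm M f)\<^sup>2"
    by (simp add: L2_norm_power2)
  finally have *: "0 \<le> m * (m * (L2_norm M f)\<^sup>2 - I\<^sup>2)"
    by (simp add: algebra_simps power2_eq_square)
  have "I\<^sup>2 \<le> m * (L2_norm M f)\<^sup>2"
  proof (cases "m = 0")
    case True
    then have "space M \<in> null_sets M"
      by (auto simp: m_def null_sets_def emeasure_eq_measure)
    then have "AE x in M. x \<notin> space M" by (rule AE_not_in)
    then have "AE x in M. f x = 0" by (rule AE_mp) (auto intro!: AE_I2)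
    then have "I = 0" unfolding I_def using integral_eq_zero_AE by blast
    then show ?thesis using True by simp
  next
    case False
    then have "m > 0" unfolding m_def using measure_nonneg[of M "space M"] by linarith
    then show ?thesis using * by (simp add: zero_le_mult_iff)
  qed
  then have "sqrt (I\<^sup>2) \<le> sqrt (m * (L2_norm M f)\<^sup>2)" by (rule real_sqrt_le_mono)
  then show ?thesis
    by (simp add: real_sqrt_mult L2_norm_nonneg I_def m_def)
qed

text \<open>
  Both the Lebesgue measure and the surface measure are images under this map of a product of
  one-dimensional Lebesgue measures.
\<close>

definition coord_sum :: "'a::euclidean_space set \<Rightarrow> ('a \<Rightarrow> real) \<Rightarrow> 'a" where
  "coord_sum I x = (\<Sum>b\<in>I. x b *\<^sub>R b)"

lemma measurable_coord_sum [measurable]: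
  "I \<subseteq> Basis \<Longrightarrow> coord_sum I \<in> (\<Pi>\<^sub>M b\<in>I. (lborel :: real measure)) \<rightarrow>\<^sub>M borel"
  unfolding coord_sum_def[abs_def] by measurable

lemma coord_sum_inner:
  assumes "I \<subseteq> Basis" "c \<in> Basis"
  shows "coord_sum I x \<bullet> c = (if c \<in> I then x c else 0)"
proof -
  have "finite I" using assms finite_subset finite_Basis by blast
  have "coord_sum I x \<bullet> c = (\<Sum>b\<in>I. if b = c then x b else 0)"
    unfolding coord_sum_def inner_sum_left
    using assms by (intro sum.cong) (auto simp: inner_Basis)
  then show ?thesis using \<open>finite I\<close> by (simp add: sum.delta)
qed

lemma PiM_box_integrable:
  fixes H z :: "'a::euclidean_space"
  assumes I: "I \<subseteq> Basis" and f: "continuous_on UNIV f"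
  shows "integrable (\<Pi>\<^sub>M b\<in>I. (lborel :: real measure))
    (\<lambda>x. indicator (\<Pi>\<^sub>E b\<in>I. {0..H \<bullet> b}) x * (f (z + coord_sum I x) :: real))"
proof -
  interpret product_sigma_finite "\<lambda>_ :: 'a. lborel :: real measure" ..
  have fin: "finite I" using I finite_subset finite_Basis by blast
  have fm[measurable]: "f \<in> borel_measurable borel" using f by (rule borel_measurable_continuous_onI)
  have [measurable]: "coord_sum I \<in> (\<Pi>\<^sub>M b\<in>I. (lborel :: real measure)) \<rightarrow>\<^sub>M borel"
    using I by measurable
  have A: "(\<Pi>\<^sub>E b\<in>I. {0..H \<bullet> b}) \<in> sets (\<Pi>\<^sub>M b\<in>I. (lborel :: real measure))"
    using fin by (intro sets_PiM_I_finite) auto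
  define R where "R = norm z + (\<Sum>b\<in>I. \<bar>H \<bullet> b\<bar>)"
  have "compact (f ` cball 0 R)"
    using f by (intro compact_continuous_image continuous_on_subset[OF f]) auto
  then obtain B where B: "\<And>y. y \<in> cball 0 R \<Longrightarrow> norm (f y) \<le> B"
    using compact_imp_bounded bounded_iff by (metis imageI)
  have inR: "z + coord_sum I x \<in> cball 0 R" if "x \<in> (\<Pi>\<^sub>E b\<in>I. {0..H \<bullet> b})" for x
  proof -
    have "norm (coord_sum I x) \<le> (\<Sum>b\<in>I. norm (x b *\<^sub>R b))"
      unfolding coord_sum_def by (rule norm_sum)
    also have "\<dots> \<le> (\<Sum>b\<in>I. \<bar>H \<bullet> b\<bar>)"
      using that I by (intro sum_mono) (auto simp: PiE_iff subset_iff)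
    finally show ?thesis unfolding R_def using norm_triangle_ineq[of z "coord_sum I x"] by simp
  qed
  show ?thesis
  proof (rule integrableI_bounded_set[OF A, where B = B])
    show "emeasure (\<Pi>\<^sub>M b\<in>I. (lborel :: real measure)) (\<Pi>\<^sub>E b\<in>I. {0..H \<bullet> b}) < \<infinity>"
      using fin by (subst emeasure_PiM) (auto simp: emeasure_lborel_Icc_eq ennreal_prod_eq_top less_top[symmetric])
    show "(\<lambda>x. indicator (\<Pi>\<^sub>E b\<in>I. {0..H \<bullet> b}) x * f (z + coord_sum I x))
      \<in> borel_measurable (\<Pi>\<^sub>M b\<in>I. (lborel :: real measure))"
      using A by measurable
  qed (use B[OF inR] in auto)
qed

text \<open>
  Fubini's theorem for the product measure, one coordinate at a time. The base point \<open>z\<close> has to vanish in the integrated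
  coordinates, since adding \<open>coord_sum\<close> must have the effect of replacing them.
\<close>

lemma integral_PiM_box:
  fixes H z :: "'a::euclidean_space"
  assumes "distinct bs" "set bs \<subseteq> Basis" "\<And>b. b \<in> set bs \<Longrightarrow> z \<bullet> b = 0" "continuous_on UNIV f"
  shows "(\<integral>x. indicator (\<Pi>\<^sub>E b\<in>set bs. {0..H \<bullet> b}) x * f (z + coord_sum (set bs) x)
      \<partial>(\<Pi>\<^sub>M b\<in>set bs. (lborel :: real measure))) = iter_integral H bs f z"
  using assms
proof (induction bs arbitrary: f)
  case Nil
  show ?case
    by (simp add: PiM_empty lebesgue_integral_count_space_finite coord_sum_def)
next
  case (Cons b bs)
  interpret product_sigma_finite "\<lambda>_ :: 'a. lborel :: real measure" ..
  define I where "I = set bs"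
  have I: "finite I" "b \<notin> I" "I \<subseteq> Basis" "b \<in> Basis" using Cons.prems by (auto simp: I_def)
  have cf: "continuous_on UNIV f" by fact
  have inner: "(\<integral>y. indicator (\<Pi>\<^sub>E b\<in>insert b I. {0..H \<bullet> b}) (x(b := y)) * f (z + coord_sum (insert b I) (x(b := y))) \<partial>lborel)
     = indicator (\<Pi>\<^sub>E b\<in>I. {0..H \<bullet> b}) x * slice_integral H b f (z + coord_sum I x)"
    if x: "x \<in> space (\<Pi>\<^sub>M b\<in>I. (lborel :: real measure))" for x
  proof -
    define w where "w = z + coord_sum I x"
    have wb: "w \<bullet> b = 0"
      unfolding w_def using Cons.prems I by (simp add: inner_add_left coord_sum_inner)
    have "coord_sum (insert b I) (x(b := y)) = coord_sum I x + y *\<^sub>R b" for y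
      unfolding coord_sum_def using I by (auto simp: sum.insert add.commute intro!: sum.cong)
    then have w: "z + coord_sum (insert b I) (x(b := y)) = set_coord b y w" for y
      by (simp add: set_coord_def wb) (simp add: w_def)
    have "x \<in> extensional I" using x by (auto simp: space_PiM PiE_def)
    then have ind: "indicator (\<Pi>\<^sub>E b\<in>insert b I. {0..H \<bullet> b}) (x(b := y))
        = (indicator (\<Pi>\<^sub>E b\<in>I. {0..H \<bullet> b}) x * indicator {0..H \<bullet> b} y :: real)" for y
      using I by (auto simp: indicator_def PiE_iff extensional_def)
    have "continuous_on {0..H \<bullet> b} (\<lambda>y. f (set_coord b y w))"
      by (intro continuous_on_compose_UNIV[OF cf] continuous_intros)
    then have "(LINT y:{0..H \<bullet> b}|lborel. f (set_coord b y w)) = slice_integral H b f w"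
      unfolding slice_integral_def
      by (intro set_borel_integral_eq_integral borel_integrable_atLeastAtMost')
    then show ?thesis
      unfolding w ind by (simp add: mult.assoc set_lebesgue_integral_def w_def)
  qed
  have "(\<integral>x. indicator (\<Pi>\<^sub>E b\<in>insert b I. {0..H \<bullet> b}) x * f (z + coord_sum (insert b I) x)
      \<partial>(\<Pi>\<^sub>M b\<in>insert b I. (lborel :: real measure)))
    = (\<integral>x. (\<integral>y. indicator (\<Pi>\<^sub>E b\<in>insert b I. {0..H \<bullet> b}) (x(b := y)) * f (z + coord_sum (insert b I) (x(b := y))) \<partial>lborel)
      \<partial>(\<Pi>\<^sub>M b\<in>I. (lborel :: real measure)))"
    using I by (intro product_integral_insert PiM_box_integrable cf) auto
  also have "\<dots> = (\<integral>x. indicator (\<Pi>\<^sub>E b\<in>I. {0..H \<bullet> b}) x * slice_integral H b f (z + coord_sum I x)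
      \<partial>(\<Pi>\<^sub>M b\<in>I. (lborel :: real measure)))"
    by (rule Bochner_Integration.integral_cong[OF refl inner])
  also have "\<dots> = iter_integral H bs (slice_integral H b f) z"
    unfolding I_def using Cons.prems by (intro Cons.IH slice_integral_continuous) auto
  finally show ?case by (simp add: I_def)
qed

lemma box_lebesgue_integral:
  fixes H :: "'a::euclidean_space"
  assumes bs: "distinct bs" "set bs = Basis" and f: "continuous_on UNIV f"
  shows "integrable (lebesgue_on (box 0 H)) f" (is ?int)
    and "(LINT x|lebesgue_on (box 0 H). f x) = iter_integral H bs f 0" (is ?eq)
proof -
  have ci: "integrable lborel (\<lambda>x. indicator (cbox 0 H) x *\<^sub>R f x)"
    using f continuous_on_subset by (intro borel_integrable_compact) auto
  then have "f absolutely_integrable_on (cbox 0 H)"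
    unfolding set_integrable_def by (subst integrable_completion) auto
  then have ab: "f absolutely_integrable_on (box 0 H)"
    by (rule set_integrable_subset) (auto simp: box_subset_cbox)
  then show ?int
    unfolding set_integrable_def by (subst integrable_restrict_space) auto
  then have "(LINT x|lebesgue_on (box 0 H). f x) = integral (box 0 H) f"
    by (rule lebesgue_integral_eq_integral) auto
  also have "\<dots> = integral (cbox 0 H) f" by (rule integral_open_interval)
  also have "\<dots> = (LINT x:cbox 0 H|lborel. f x)"
    using ci by (intro set_borel_integral_eq_integral(2)[symmetric]) (simp add: set_integrable_def)
  also have "\<dots> = (\<integral>x. indicator (cbox 0 H) x * f x \<partial>distr (\<Pi>\<^sub>M b\<in>Basis. lborel) borel (coord_sum Basis))"
    unfolding set_lebesgue_integral_def coord_sum_def by (subst lborel_eq) simp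
  also have "\<dots> = (\<integral>x. indicator (cbox 0 H) (coord_sum Basis x) * f (coord_sum Basis x) \<partial>(\<Pi>\<^sub>M b\<in>Basis. lborel))"
    using borel_measurable_continuous_onI[OF f] by (intro integral_distr) auto
  also have "\<dots> = (\<integral>x. indicator (\<Pi>\<^sub>E b\<in>Basis. {0..H \<bullet> b}) x * f (0 + coord_sum Basis x) \<partial>(\<Pi>\<^sub>M b\<in>Basis. lborel))"
    by (rule Bochner_Integration.integral_cong)
      (auto simp: indicator_def mem_box coord_sum_inner space_PiM PiE_iff)
  also have "\<dots> = iter_integral H bs f 0"
    using integral_PiM_box[of bs 0 f H] bs f by auto
  finally show ?eq .
qed

lemma borel_measurable_lebesgue_on_continuous:
  "continuous_on UNIV f \<Longrightarrow> f \<in> borel_measurable (lebesgue_on S)"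
  by (metis borel_measurable_continuous_onI measurable_completion measurable_lborel2 measurable_restrict_space1)

context box_with_face
begin

definition face :: "'a set" where
  "face = {x. x \<bullet> e = 0 \<and> (\<forall>b\<in>Basis - {e}. 0 \<le> x \<bullet> b \<and> x \<bullet> b \<le> H \<bullet> b)}"

abbreviation \<sigma> :: "'a measure" where "\<sigma> \<equiv> flat_surface_measure e face"

abbreviation \<Omega> :: "'a set" where "\<Omega> \<equiv> box 0 H"

lemma closed_face: "closed face"
proof -
  have "face = {x. x \<bullet> e = 0} \<inter> (\<Inter>b\<in>Basis - {e}. {x. 0 \<le> x \<bullet> b} \<inter> {x. x \<bullet> b \<le> H \<bullet> b})"
    by (auto simp: face_def)
  then show ?thesis
    by (auto intro!: closed_Int closed_INT closed_Collect_eq closed_Collect_le continuous_intros)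
qed

lemma borel_measurable_\<sigma>:
  assumes "continuous_on UNIV f" shows "f \<in> borel_measurable \<sigma>"
  unfolding flat_surface_measure_def
  using borel_measurable_continuous_onI[OF assms]
  by (intro measurable_restrict_space1 measurable_completion) simp

lemma
  assumes f: "continuous_on UNIV f"
  shows \<sigma>_integrable: "integrable \<sigma> f" and \<sigma>_integral: "(LINT x|\<sigma>. f x) = face_integral f 0"
proof -
  define P where "P = (\<Pi>\<^sub>M b\<in>Basis - {e}. (lborel :: real measure))"
  define N where "N = distr P borel (coord_sum (Basis - {e}))"
  have \<sigma>: "\<sigma> = restrict_space (completion N) face"
    by (simp add: flat_surface_measure_def N_def P_def coord_sum_def[abs_def])
  have T [measurable]: "coord_sum (Basis - {e}) \<in> P \<rightarrow>\<^sub>M borel"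
    unfolding P_def by measurable
  have [measurable]: "face \<in> sets borel" using closed_face by (rule borel_closed)
  have face: "face \<inter> space (completion N) \<in> sets (completion N)"
    by (simp add: N_def)
  have [measurable]: "f \<in> borel_measurable borel" by (rule borel_measurable_continuous_onI[OF f])
  have g: "(\<lambda>x. indicator face x *\<^sub>R f x) \<in> borel_measurable N"
    by (simp add: N_def)
  have ind: "indicator face (coord_sum (Basis - {e}) x) = (indicator (\<Pi>\<^sub>E b\<in>Basis - {e}. {0..H \<bullet> b}) x :: real)"
    if "x \<in> space P" for x
    using that e_Basis by (auto simp: indicator_def face_def coord_sum_inner P_def space_PiM PiE_iff)
  have cs: "set cs = Basis - {e}" by (rule set_cs)
  have int: "integrable P (\<lambda>x. indicator face (coord_sum (Basis - {e}) x) *\<^sub>R f (coord_sum (Basis - {e}) x))"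
    using PiM_box_integrable[of "Basis - {e}" f H 0] f ind
    by (subst Bochner_Integration.integrable_cong[OF refl]) (auto simp: P_def)
  then show "integrable \<sigma> f"
    unfolding \<sigma> integrable_restrict_space[OF face] integrable_completion[OF g]
    unfolding N_def by (subst integrable_distr_eq) auto
  have "(LINT x|\<sigma>. f x) = (LINT x|P. indicator face (coord_sum (Basis - {e}) x) *\<^sub>R f (coord_sum (Basis - {e}) x))"
    unfolding \<sigma> integral_restrict_space[OF face] integral_completion[OF g]
    unfolding N_def by (subst integral_distr) auto
  also have "\<dots> = (LINT x|P. indicator (\<Pi>\<^sub>E b\<in>Basis - {e}. {0..H \<bullet> b}) x * f (0 + coord_sum (Basis - {e}) x))"
    by (rule Bochner_Integration.integral_cong) (auto simp: ind)
  also have "\<dots> = face_integral f 0"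
    using integral_PiM_box[of cs 0 f H] f distinct_cs unfolding P_def cs by simp
  finally show "(LINT x|\<sigma>. f x) = face_integral f 0" .
qed

lemma finite_measure_\<sigma>: "finite_measure \<sigma>"
proof (rule finite_measureI)
  have "integrable \<sigma> (\<lambda>_. 1 :: real)" by (rule \<sigma>_integrable) simp
  then show "emeasure \<sigma> (space \<sigma>) \<noteq> \<infinity>"
    by (simp add: integrable_iff_bounded less_top)
qed

lemma measure_\<sigma>: "measure \<sigma> (space \<sigma>) = face_area"
  using \<sigma>_integral[of "\<lambda>_. 1"] by (simp add: face_integral_const)

lemma \<Omega>_integrable:
  fixes f :: "'a \<Rightarrow> real"
  shows "continuous_on UNIV f \<Longrightarrow> integrable (lebesgue_on \<Omega>) f"
  using box_lebesgue_integral(1)[of "cs @ [e]" f H] distinct_cs set_cs e_Basis by fastforce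

lemma \<Omega>_integral: "continuous_on UNIV f \<Longrightarrow> (LINT x|lebesgue_on \<Omega>. f x) = box_integral f"
  unfolding box_integral_def
  using box_lebesgue_integral(2)[of "cs @ [e]" f H] distinct_cs set_cs e_Basis by fastforce

lemma finite_measure_\<Omega>: "finite_measure (lebesgue_on \<Omega>)"
  by (rule finite_measure_lebesgue_on) auto

lemma continuous_L2_\<Omega>:
  fixes f :: "'a \<Rightarrow> 'b::euclidean_space"
  assumes "continuous_on UNIV f" shows "f \<in> L2 (lebesgue_on \<Omega>)"
  unfolding L2_def using assms
  by (auto intro!: \<Omega>_integrable continuous_intros borel_measurable_lebesgue_on_continuous)

lemma continuous_L2_\<sigma>:
  fixes f :: "'a \<Rightarrow> real"
  assumes "continuous_on UNIV f" shows "f \<in> L2 \<sigma>"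
  unfolding L2_def using assms
  by (auto intro!: \<sigma>_integrable continuous_intros borel_measurable_\<sigma>)

end

section \<open>Weak gradients on a box\<close>

lemma integral_indicator_box_eq_0:
  fixes f :: "'a::euclidean_space \<Rightarrow> real"
  assumes S: "S \<in> sets lebesgue" and f: "integrable (lebesgue_on S) f"
    and test: "\<And>\<phi>. test_function S \<phi> \<Longrightarrow> (LINT x|lebesgue_on S. f x * \<phi> x) = 0"
    and sub: "cbox a d \<subseteq> S"
  shows "(LINT x|lebesgue_on S. f x * indicator (box a d) x) = 0"
proof -
  note [measurable] = borel_measurable_integrable[OF f]
  have "(\<lambda>n. LINT x|lebesgue_on S. f x * box_bump (1 / real (Suc n)) a d x)
      \<longlonglongrightarrow> (LINT x|lebesgue_on S. f x * indicator (box a d) x)"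
  proof (rule integral_dominated_convergence[where w = "\<lambda>x. \<bar>f x\<bar>"])
    have "box_bump (1 / real (Suc n)) a d \<in> borel_measurable (lebesgue_on S)" for n
      by (intro borel_measurable_lebesgue_on_continuous smooth_continuous smooth_box_bump) simp
    then show "(\<lambda>x. f x * box_bump (1 / real (Suc n)) a d x) \<in> borel_measurable (lebesgue_on S)" for n
      by measurable
    have "(indicator (box a d) :: _ \<Rightarrow> real) \<in> borel_measurable (lebesgue_on S)"
      by (intro measurable_restrict_space1 measurable_completion) simp
    then show "(\<lambda>x. f x * indicator (box a d) x) \<in> borel_measurable (lebesgue_on S)"
      by measurable
    show "AE x in lebesgue_on S. (\<lambda>n. f x * box_bump (1 / real (Suc n)) a d x) \<longlonglongrightarrow> f x * indicator (box a d) x"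
      by (intro AE_I2 tendsto_mult tendsto_const box_bump_tendsto_indicator)
    show "AE x in lebesgue_on S. norm (f x * box_bump (1 / real (Suc n)) a d x) \<le> \<bar>f x\<bar>" for n
      using box_bump_range[of "1 / real (Suc n)" a d]
      by (intro AE_I2) (simp add: abs_mult mult_left_le)
  qed (use f in simp)
  moreover have "(LINT x|lebesgue_on S. f x * box_bump (1 / real (Suc n)) a d x) = 0" for n
    by (intro test test_function_box_bump sub) simp
  ultimately show ?thesis
    by (simp add: LIMSEQ_const_iff)
qed

text \<open>
  A test function must vanish near the boundary, so boxes whose closure reaches the boundary of the domain are
  exhausted by smaller closed boxes.
\<close>

lemma box_indicator_inner_approx:
  fixes a d x :: "'a::euclidean_space"
  assumes "box a d \<noteq> {}"
  defines "c n \<equiv> (1 / real (n + 3)) *\<^sub>R (d - a)"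
  shows "cbox (a + c n) (d - c n) \<subseteq> box a d"
    and "(\<lambda>n. indicator (box (a + c n) (d - c n)) x :: real) \<longlonglongrightarrow> indicator (box a d) x"
proof -
  have ad: "a \<bullet> b < d \<bullet> b" if "b \<in> Basis" for b
    using assms(1) that by (simp add: box_ne_empty)
  have pos: "0 < c n \<bullet> b" if "b \<in> Basis" for b n
    using ad[OF that] by (simp add: c_def inner_diff_left)
  show sub: "cbox (a + c n) (d - c n) \<subseteq> box a d" for n
  proof
    fix y assume y: "y \<in> cbox (a + c n) (d - c n)"
    show "y \<in> box a d"
      unfolding mem_box
    proof
      fix b :: 'a assume b: "b \<in> Basis"
      then have "a \<bullet> b + c n \<bullet> b \<le> y \<bullet> b" "y \<bullet> b \<le> d \<bullet> b - c n \<bullet> b"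
        using y by (auto simp: mem_box inner_add_left inner_diff_left)
      then show "a \<bullet> b < y \<bullet> b \<and> y \<bullet> b < d \<bullet> b"
        using pos[OF b, of n] by linarith
    qed
  qed
  show "(\<lambda>n. indicator (box (a + c n) (d - c n)) x :: real) \<longlonglongrightarrow> indicator (box a d) x"
  proof (cases "x \<in> box a d")
    case True
    have c0: "c \<longlonglongrightarrow> 0"
    proof -
      have "(\<lambda>n. 1 / real (n + 3)) \<longlonglongrightarrow> 0"
        using LIMSEQ_ignore_initial_segment[OF LIMSEQ_inverse_real_of_nat, of 2]
        by (simp add: inverse_eq_divide add.commute)
      from tendsto_scaleR[OF this tendsto_const[of "d - a"]] show ?thesis
        by (simp add: c_def[abs_def])
    qed
    have "eventually (\<lambda>n. x \<in> box (a + c n) (d - c n)) sequentially"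
      unfolding mem_box
    proof (intro eventually_ball_finite[OF finite_Basis] ballI eventually_conj)
      fix b :: 'a assume b: "b \<in> Basis"
      have "(\<lambda>n. (a + c n) \<bullet> b) \<longlonglongrightarrow> (a + 0) \<bullet> b" by (intro tendsto_intros c0)
      then show "eventually (\<lambda>n. (a + c n) \<bullet> b < x \<bullet> b) sequentially"
        using True b by (intro order_tendstoD(2)) (auto simp: mem_box)
      have "(\<lambda>n. (d - c n) \<bullet> b) \<longlonglongrightarrow> (d - 0) \<bullet> b" by (intro tendsto_intros c0)
      then show "eventually (\<lambda>n. x \<bullet> b < (d - c n) \<bullet> b) sequentially"
        using True b by (intro order_tendstoD(1)) (auto simp: mem_box)
    qed
    then have "eventually (\<lambda>n. indicator (box (a + c n) (d - c n)) x = (1 :: real)) sequentially"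
      by (rule eventually_mono) simp
    then show ?thesis using True by (simp add: tendsto_eventually)
  next
    case False
    then have "x \<notin> box (a + c n) (d - c n)" for n
      using sub[of n] box_subset_cbox by blast
    then show ?thesis using False by simp
  qed
qed

text \<open>
  The bumps show that \<open>f\<close> has integral zero over every sub-box. Boxes are closed under intersections and generate
  the Borel sets, so \<open>f\<close> has integral zero over every Borel set. The domain being a box itself starts the
  induction: complements are handled because the integral over the whole domain vanishes.
\<close>

lemma fundamental_lemma_box:
  fixes f :: "'a::euclidean_space \<Rightarrow> real"
  assumes f: "integrable (lebesgue_on (box p q)) f"
    and test: "\<And>\<phi>. test_function (box p q) \<phi> \<Longrightarrow> (LINT x|lebesgue_on (box p q). f x * \<phi> x) = 0"
  shows "AE x in lebesgue_on (box p q). f x = 0"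
proof -
  define S where "S = box p q"
  have S: "S \<in> sets lebesgue" by (simp add: S_def)
  have fS: "integrable (lebesgue_on S) f" using f by (simp add: S_def)
  note [measurable] = borel_measurable_integrable[OF fS]
  have meas_ind: "(indicator A :: 'a \<Rightarrow> real) \<in> borel_measurable (lebesgue_on S)" if "A \<in> sets borel" for A
    using that by (intro measurable_restrict_space1 measurable_completion) simp
  have sub_box: "(LINT x|lebesgue_on S. f x * indicator (box a d) x) = 0" if sub: "box a d \<subseteq> S" for a d
  proof (cases "box a d = {}")
    case False
    define c where "c n = (1 / real (n + 3)) *\<^sub>R (d - a)" for n
    note approx = box_indicator_inner_approx[OF False, folded c_def]
    have "(\<lambda>n. LINT x|lebesgue_on S. f x * indicator (box (a + c n) (d - c n)) x)
      \<longlonglongrightarrow> (LINT x|lebesgue_on S. f x * indicator (box a d) x)"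
    proof (rule integral_dominated_convergence[where w = "\<lambda>x. \<bar>f x\<bar>"])
      show "(\<lambda>x. f x * indicator (box a d) x) \<in> borel_measurable (lebesgue_on S)"
        and "(\<lambda>x. f x * indicator (box (a + c n) (d - c n)) x) \<in> borel_measurable (lebesgue_on S)" for n
        using meas_ind by measurable
      show "AE x in lebesgue_on S. (\<lambda>n. f x * indicator (box (a + c n) (d - c n)) x)
          \<longlonglongrightarrow> f x * indicator (box a d) x"
        by (intro AE_I2 tendsto_mult tendsto_const approx(2))
      show "AE x in lebesgue_on S. norm (f x * indicator (box (a + c n) (d - c n)) x) \<le> \<bar>f x\<bar>" for n
        by (intro AE_I2) (simp add: indicator_def)
    qed (use fS in simp)
    moreover have "(LINT x|lebesgue_on S. f x * indicator (box (a + c n) (d - c n)) x) = 0" for n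
      using approx(1)[of n] sub
      by (intro integral_indicator_box_eq_0[OF S fS]) (auto simp: S_def intro: test)
    ultimately show ?thesis by (simp add: LIMSEQ_const_iff)
  qed simp
  define F where "F x = indicator S x * f x" for x
  have F: "integrable lebesgue F"
    using fS unfolding F_def by (subst (asm) integrable_restrict_space) (auto simp: S_def)
  obtain F' where F'm [measurable]: "F' \<in> borel_measurable lborel" and FF': "AE x in lborel. F x = F' x"
    using completion_ex_borel_measurable_real borel_measurable_integrable[OF F] by blast
  have ae: "AE x in lebesgue. F x = F' x" by (rule AE_completion[OF FF'])
  have F'mL: "F' \<in> borel_measurable lebesgue" by (rule measurable_completion[OF F'm])
  have "integrable lebesgue F'"
    using integrable_cong_AE[OF borel_measurable_integrable[OF F] F'mL ae] F by simp
  then have F': "integrable lborel F'" using integrable_completion[OF F'm] by simp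
  have setint: "(LINT x:A|lborel. F' x) = (LINT x|lebesgue_on S. f x * indicator A x)"
    if A: "A \<in> sets borel" for A
  proof -
    have m: "(\<lambda>x. indicator A x *\<^sub>R F' x) \<in> borel_measurable lborel"
      using A by measurable
    have "(LINT x:A|lborel. F' x) = (LINT x|lebesgue. indicator A x *\<^sub>R F' x)"
      unfolding set_lebesgue_integral_def by (rule integral_completion[OF m, symmetric])
    also have "\<dots> = (LINT x|lebesgue. indicator S x *\<^sub>R (f x * indicator A x))"
    proof (rule integral_cong_AE)
      show "(\<lambda>x. indicator A x *\<^sub>R F' x) \<in> borel_measurable lebesgue"
        by (rule measurable_completion[OF m])
      have "(\<lambda>x. f x * indicator A x) \<in> borel_measurable (lebesgue_on S)"
        using meas_ind[OF A] by measurable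
      then show "(\<lambda>x. indicator S x *\<^sub>R (f x * indicator A x)) \<in> borel_measurable lebesgue"
        by (subst (asm) borel_measurable_restrict_space_iff) (auto simp: S_def)
      show "AE x in lebesgue. indicator A x *\<^sub>R F' x = indicator S x *\<^sub>R (f x * indicator A x)"
        using ae by eventually_elim (auto simp: F_def)
    qed
    also have "\<dots> = (LINT x|lebesgue_on S. f x * indicator A x)"
      by (rule integral_restrict_space[symmetric]) (simp add: S_def)
    finally show ?thesis .
  qed
  define G where "G = range (\<lambda>(a, b). box a b :: 'a set)"
  have borel_G: "sets borel = sigma_sets UNIV G"
    unfolding G_def by (subst borel_eq_box) (auto intro!: sets_measure_of)
  have zero: "(LINT x:A|lborel. F' x) = 0" if "A \<in> sets borel" for A
  proof -
    have whole: "(LINT x:UNIV|lborel. F' x) = 0"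
    proof -
      have "(LINT x:UNIV|lborel. F' x) = (LINT x|lebesgue_on S. f x * indicator UNIV x)"
        by (rule setint) simp
      also have "\<dots> = (LINT x|lebesgue_on S. f x * indicator (box p q) x)"
        by (rule Bochner_Integration.integral_cong) (auto simp: S_def)
      also have "\<dots> = 0" by (rule sub_box) (simp add: S_def)
      finally show ?thesis .
    qed
    have si: "set_integrable lborel A F'" if "A \<in> sets borel" for A
      unfolding set_integrable_def using that F' by (intro integrable_mult_indicator) auto
    have "Int_stable G"
      unfolding G_def Int_stable_def by (auto simp: box_Int_box)
    moreover have "G \<subseteq> Pow UNIV" by simp
    moreover have "A \<in> sigma_sets UNIV G" using that borel_G by simp
    ultimately show ?thesis
    proof (induction rule: sigma_sets_induct_disjoint)
      case (basic A)
      then obtain a b where A: "A = box a b" by (auto simp: G_def)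
      obtain a' b' where i: "box a b \<inter> S = box a' b'"
        using box_Int_box[of a b p q] unfolding S_def by blast
      have "(LINT x:A|lborel. F' x) = (LINT x|lebesgue_on S. f x * indicator (box a b) x)"
        using setint[of A] A by simp
      also have "\<dots> = (LINT x|lebesgue_on S. f x * indicator (box a' b') x)"
        by (rule Bochner_Integration.integral_cong) (auto simp: i[symmetric] indicator_def)
      also have "\<dots> = 0" by (rule sub_box) (use i in blast)
      finally show ?case .
    next
      case empty
      then show ?case by (simp add: set_lebesgue_integral_def)
    next
      case (compl A)
      then have A: "A \<in> sets borel" using borel_G by simp
      have "(LINT x:A \<union> (UNIV - A)|lborel. F' x) = (LINT x:A|lborel. F' x) + (LINT x:UNIV - A|lborel. F' x)"
        using A si by (intro set_integral_Un) auto
      moreover have "A \<union> (UNIV - A) = UNIV" by blast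
      ultimately show ?case using whole compl by simp
    next
      case (union A)
      then have A: "A i \<in> sets borel" for i using borel_G by auto
      have "(LINT x:(\<Union>i. A i)|lborel. F' x) = (\<Sum>i. (LINT x:A i|lborel. F' x))"
      proof (rule lebesgue_integral_countable_add)
        show "set_integrable lborel (\<Union>i. A i) F'" using A by (intro si) auto
      qed (use A union in \<open>auto simp: disjoint_family_on_def\<close>)
      then show ?case using union by simp
    qed
  qed
  have "AE x in lborel. F' x = 0"
  proof (rule density_unique_real[OF F'])
    show "(LINT x:A|lborel. F' x) = (LINT x:A|lborel. 0)" if "A \<in> sets lborel" for A
      using zero[of A] that by (simp add: set_lebesgue_integral_def)
  qed simp
  with FF' have "AE x in lborel. F x = 0" by eventually_elim simp
  then have "AE x in lebesgue. F x = 0" by (rule AE_completion)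
  then have "AE x in lebesgue. x \<in> S \<longrightarrow> f x = 0"
    by eventually_elim (auto simp: F_def)
  then show ?thesis
    unfolding S_def[symmetric] using S by (subst AE_restrict_space_iff) auto
qed

definition gradient :: "('a::euclidean_space \<Rightarrow> real) \<Rightarrow> 'a \<Rightarrow> 'a" where
  "gradient f x = (\<Sum>b\<in>Basis. partial b f x *\<^sub>R b)"

lemma gradient_inner: "b \<in> Basis \<Longrightarrow> gradient f x \<bullet> b = partial b f x"
  by (simp add: gradient_def inner_sum_left_Basis)

lemma norm_gradient_power2: "(norm (gradient f x))\<^sup>2 = (\<Sum>b\<in>Basis. (partial b f x)\<^sup>2)"
proof -
  have "(norm (gradient f x))\<^sup>2 = (\<Sum>b\<in>Basis. (gradient f x \<bullet> b)\<^sup>2)"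
    unfolding power2_norm_eq_inner by (subst euclidean_inner) (simp add: power2_eq_square)
  then show ?thesis by (simp add: gradient_inner)
qed

lemma smooth_gradient_continuous: "smooth f \<Longrightarrow> continuous_on UNIV (gradient f)"
  unfolding gradient_def[abs_def]
  by (intro continuous_intros smooth_continuous smooth_partial)

lemma gradient_diff:
  assumes "smooth f" "smooth g"
  shows "gradient (\<lambda>x. f x - g x) = (\<lambda>x. gradient f x - gradient g x)"
proof
  fix x
  have "partial b (\<lambda>x. f x - g x) x = partial b f x - partial b g x" for b
    unfolding partial_def[of b f] partial_def[of b g]
    by (rule partial_eqI) (intro has_derivative_diff has_derivative_partial smooth_differentiable assms)
  then show "gradient (\<lambda>x. f x - g x) x = gradient f x - gradient g x"
    by (simp add: gradient_def sum_subtractf scaleR_diff_left)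
qed

context box_with_face
begin

text \<open>
  Integrate in direction \<open>b\<close> first: on every line in this direction the fundamental theorem of calculus leaves values
  of \<open>F\<close> at points that are not in the open box.
\<close>

lemma integral_partial_compact_support_eq_0:
  assumes F: "has_partial b F F'" and b: "b \<in> Basis" and supp: "\<And>x. x \<notin> \<Omega> \<Longrightarrow> F x = 0"
  shows "(LINT x|lebesgue_on \<Omega>. F' x) = 0"
proof -
  obtain bs where bs: "distinct bs" "set bs = Basis - {b}"
    using finite_distinct_list[of "Basis - {b}"] by auto
  have cF': "continuous_on UNIV F'" using F by (simp add: has_partial_def)
  have "(LINT x|lebesgue_on \<Omega>. F' x) = iter_integral H (b # bs) F' 0"
    using bs b by (intro box_lebesgue_integral(2) cF') auto
  moreover have "slice_integral H b F' = (\<lambda>_. 0)"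
  proof
    fix x
    have "((\<lambda>s. F' (set_coord b s x)) has_integral (F (set_coord b (H \<bullet> b) x) - F (set_coord b 0 x))) {0..H \<bullet> b}"
      using F sides_pos[OF b] unfolding has_partial_def
      by (intro fundamental_theorem_of_calculus)
        (auto simp: has_real_derivative_iff_has_vector_derivative[symmetric]
          intro: has_field_derivative_at_within)
    moreover have "F (set_coord b t x) = 0" if t: "t = 0 \<or> t = H \<bullet> b" for t
    proof (rule supp)
      have "set_coord b t x \<bullet> b = t" using b by (simp add: set_coord_inner)
      then show "set_coord b t x \<notin> \<Omega>" using t b by (auto simp: mem_box intro!: bexI[of _ b])
    qed
    ultimately show "slice_integral H b F' x = 0"
      by (simp add: slice_integral_def integral_unique)
  qed
  moreover have "iter_integral H bs (\<lambda>_. 0) 0 = 0"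
    using iter_integral_const[of bs H 0] bs sides_pos by auto
  ultimately show ?thesis by simp
qed

lemma smooth_weak_gradient:
  assumes f: "smooth f"
  shows "is_weak_gradient \<Omega> f (gradient f)"
  unfolding is_weak_gradient_def
proof (intro allI impI)
  fix \<phi> :: "'a \<Rightarrow> real" and b :: 'a
  assume \<phi>: "test_function \<Omega> \<phi>" and b: "b \<in> Basis"
  have supp: "\<phi> x = 0" if "x \<notin> \<Omega>" for x
    using \<phi> that closure_subset[of "{x. \<phi> x \<noteq> 0}"] unfolding test_function_def by auto
  have s: "smooth \<phi>" using \<phi> by (simp add: test_function_def)
  have c: "continuous_on UNIV f" "continuous_on UNIV \<phi>" "continuous_on UNIV (partial b f)"
    "continuous_on UNIV (partial b \<phi>)"
    using f s b smooth_continuous smooth_partial by blast+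
  have "(LINT x|lebesgue_on \<Omega>. f x * partial b \<phi> x + partial b f x * \<phi> x) = 0"
    using supp by (intro integral_partial_compact_support_eq_0[OF has_partial_mult b] smooth_has_partial f s b) auto
  moreover have "(LINT x|lebesgue_on \<Omega>. f x * partial b \<phi> x + partial b f x * \<phi> x)
    = (LINT x|lebesgue_on \<Omega>. f x * partial b \<phi> x) + (LINT x|lebesgue_on \<Omega>. partial b f x * \<phi> x)"
    by (intro Bochner_Integration.integral_add \<Omega>_integrable continuous_intros c)
  ultimately show "(LINT x|lebesgue_on \<Omega>. f x * partial b \<phi> x) = - (LINT x|lebesgue_on \<Omega>. (gradient f x \<bullet> b) * \<phi> x)"
    by (simp add: gradient_inner[OF b])
qed

lemma weak_gradient_diff:
  assumes w: "w1 \<in> L2 (lebesgue_on \<Omega>)" "w2 \<in> L2 (lebesgue_on \<Omega>)"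
    and g: "g1 \<in> L2 (lebesgue_on \<Omega>)" "g2 \<in> L2 (lebesgue_on \<Omega>)"
    and wg: "is_weak_gradient \<Omega> w1 g1" "is_weak_gradient \<Omega> w2 g2"
  shows "is_weak_gradient \<Omega> (\<lambda>x. w1 x - w2 x) (\<lambda>x. g1 x - g2 x)"
  unfolding is_weak_gradient_def
proof (intro allI impI)
  fix \<phi> :: "'a \<Rightarrow> real" and b :: 'a
  assume \<phi>: "test_function \<Omega> \<phi>" and b: "b \<in> Basis"
  then have s: "smooth \<phi>" by (simp add: test_function_def)
  have p: "\<phi> \<in> L2 (lebesgue_on \<Omega>)" "partial b \<phi> \<in> L2 (lebesgue_on \<Omega>)"
    using s b by (auto intro!: continuous_L2_\<Omega> smooth_continuous smooth_partial)
  have "(LINT x|lebesgue_on \<Omega>. (w1 x - w2 x) * partial b \<phi> x)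
      = (LINT x|lebesgue_on \<Omega>. w1 x * partial b \<phi> x) - (LINT x|lebesgue_on \<Omega>. w2 x * partial b \<phi> x)"
    unfolding left_diff_distrib by (intro Bochner_Integration.integral_diff L2_mult_integrable w p)
  also have "\<dots> = - (LINT x|lebesgue_on \<Omega>. (g1 x \<bullet> b) * \<phi> x) + (LINT x|lebesgue_on \<Omega>. (g2 x \<bullet> b) * \<phi> x)"
    using wg \<phi> b unfolding is_weak_gradient_def by simp
  also have "\<dots> = - (LINT x|lebesgue_on \<Omega>. (g1 x \<bullet> b) * \<phi> x - (g2 x \<bullet> b) * \<phi> x)"
    by (subst Bochner_Integration.integral_diff) (auto intro!: L2_mult_integrable L2_inner g p b)
  also have "\<dots> = - (LINT x|lebesgue_on \<Omega>. ((g1 x - g2 x) \<bullet> b) * \<phi> x)"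
    by (simp add: inner_diff_left left_diff_distrib)
  finally show "(LINT x|lebesgue_on \<Omega>. (w1 x - w2 x) * partial b \<phi> x)
      = - (LINT x|lebesgue_on \<Omega>. ((g1 x - g2 x) \<bullet> b) * \<phi> x)" .
qed

text \<open>
  The chosen gradient \<open>weak_grad\<close> of the Sobolev norm can be replaced by any weak gradient at hand, in particular by the
  classical one for smooth functions, thanks to this uniqueness.
\<close>

lemma weak_gradient_unique:
  assumes w: "w \<in> L2 (lebesgue_on \<Omega>)"
    and g: "g1 \<in> L2 (lebesgue_on \<Omega>)" "g2 \<in> L2 (lebesgue_on \<Omega>)"
    and wg: "is_weak_gradient \<Omega> w g1" "is_weak_gradient \<Omega> w g2"
  shows "AE x in lebesgue_on \<Omega>. g1 x = g2 x"
proof -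
  have d: "is_weak_gradient \<Omega> (\<lambda>x. w x - w x) (\<lambda>x. g1 x - g2 x)"
    by (rule weak_gradient_diff) (use assms in auto)
  interpret finite_measure "lebesgue_on \<Omega>" by (rule finite_measure_\<Omega>)
  have "AE x in lebesgue_on \<Omega>. (g1 x - g2 x) \<bullet> b = 0" if b: "b \<in> Basis" for b
  proof (rule fundamental_lemma_box)
    show "integrable (lebesgue_on \<Omega>) (\<lambda>x. (g1 x - g2 x) \<bullet> b)"
      by (intro L2_imp_integrable L2_inner L2_diff g b)
    show "(LINT x|lebesgue_on \<Omega>. (g1 x - g2 x) \<bullet> b * \<phi> x) = 0" if "test_function \<Omega> \<phi>" for \<phi>
      using d that b unfolding is_weak_gradient_def by simp
  qed
  then have "AE x in lebesgue_on \<Omega>. \<forall>b\<in>Basis. (g1 x - g2 x) \<bullet> b = 0"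
    by (rule AE_finite_allI[OF finite_Basis])
  then show ?thesis
  proof eventually_elim
    case (elim x)
    then show ?case by (intro euclidean_eqI[of "g1 x"]) (simp add: inner_diff_left)
  qed
qed

lemma weak_grad_props:
  assumes "w \<in> H1 \<Omega>"
  shows "w \<in> L2 (lebesgue_on \<Omega>)" "weak_grad \<Omega> w \<in> L2 (lebesgue_on \<Omega>)" "is_weak_gradient \<Omega> w (weak_grad \<Omega> w)"
proof -
  show "w \<in> L2 (lebesgue_on \<Omega>)" using assms by (simp add: H1_def)
  obtain g where "g \<in> L2 (lebesgue_on \<Omega>) \<and> is_weak_gradient \<Omega> w g"
    using assms by (auto simp: H1_def)
  from someI[of "\<lambda>g. g \<in> L2 (lebesgue_on \<Omega>) \<and> is_weak_gradient \<Omega> w g", OF this]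
  show "weak_grad \<Omega> w \<in> L2 (lebesgue_on \<Omega>)" "is_weak_gradient \<Omega> w (weak_grad \<Omega> w)"
    by (simp_all add: weak_grad_def)
qed

lemma L2_norm_weak_grad_eq:
  assumes "w \<in> L2 (lebesgue_on \<Omega>)" "g \<in> L2 (lebesgue_on \<Omega>)" "is_weak_gradient \<Omega> w g"
  shows "L2_norm (lebesgue_on \<Omega>) (weak_grad \<Omega> w) = L2_norm (lebesgue_on \<Omega>) g"
proof -
  have "w \<in> H1 \<Omega>" using assms by (auto simp: H1_def)
  note p = weak_grad_props[OF this]
  show ?thesis
    by (rule L2_norm_cong_AE[OF p(2) assms(2)]) (rule weak_gradient_unique[OF p(1,2) assms(2) p(3) assms(3)])
qed

lemma smooth_H1:
  assumes "smooth f"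
  shows "f \<in> H1 \<Omega>" "f \<in> L2 (lebesgue_on \<Omega>)" "gradient f \<in> L2 (lebesgue_on \<Omega>)"
  using assms smooth_weak_gradient
  by (auto simp: H1_def intro!: continuous_L2_\<Omega> smooth_continuous smooth_gradient_continuous bexI[of _ "gradient f"])

lemma L2_norm_weak_grad_smooth:
  "smooth f \<Longrightarrow> L2_norm (lebesgue_on \<Omega>) (weak_grad \<Omega> f) = L2_norm (lebesgue_on \<Omega>) (gradient f)"
  by (intro L2_norm_weak_grad_eq smooth_H1 smooth_weak_gradient)

lemma H1_norm_smooth_diff:
  assumes f: "smooth f" and w: "w \<in> H1 \<Omega>"
  shows "H1_norm \<Omega> (\<lambda>x. f x - w x) = sqrt ((L2_norm (lebesgue_on \<Omega>) (\<lambda>x. f x - w x))\<^sup>2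
    + (L2_norm (lebesgue_on \<Omega>) (\<lambda>x. gradient f x - weak_grad \<Omega> w x))\<^sup>2)"
  unfolding H1_norm_def
  using L2_norm_weak_grad_eq[of "\<lambda>x. f x - w x" "\<lambda>x. gradient f x - weak_grad \<Omega> w x"]
    weak_gradient_diff[of f w "gradient f" "weak_grad \<Omega> w"] weak_grad_props[OF w] smooth_H1[OF f]
    smooth_weak_gradient[OF f]
  by (simp add: L2_diff)

end

section \<open>Passage to the Sobolev space by density\<close>

lemma le_mult_of_power2:
  fixes a b K :: real
  assumes "a\<^sup>2 \<le> K\<^sup>2 * b\<^sup>2" "0 \<le> b" "0 \<le> K" shows "a \<le> K * b"
  using assms by (intro power2_le_imp_le[of a]) (auto simp: power_mult_distrib)

lemma powr_minus_half: "0 < (r :: real) \<Longrightarrow> r powr (- 1 / 2) = 1 / sqrt r"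
  by (simp add: powr_minus_divide powr_half_sqrt)

lemma powr_minus_half_power2: "0 < (r :: real) \<Longrightarrow> (r powr (- 1 / 2))\<^sup>2 = 1 / r"
  unfolding powr_minus_half by (simp add: power_divide)

lemma constant_le_of_equality:
  fixes a b K C :: real
  assumes "a\<^sup>2 = K\<^sup>2 * b\<^sup>2" "0 < a\<^sup>2" "0 \<le> a" "0 \<le> b" "0 \<le> K" "a \<le> C * b"
  shows "K \<le> C"
proof -
  have "a = K * b"
    using assms by (intro power2_eq_imp_eq[of a]) (auto simp: power_mult_distrib)
  moreover have "0 < b" using assms by (cases "b = 0") auto
  ultimately show ?thesis using assms(6) by simp
qed

lemma is_traceE:
  assumes "is_trace S \<mu> w t"
  obtains \<phi> where "t \<in> L2 \<mu>" "\<And>n. smooth (\<phi> n)"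
    "(\<lambda>n. H1_norm S (\<lambda>x. \<phi> n x - w x)) \<longlonglongrightarrow> 0" "(\<lambda>n. L2_norm \<mu> (\<lambda>x. \<phi> n x - t x)) \<longlonglongrightarrow> 0"
  using assms unfolding is_trace_def by blast

lemma gradient_const: "gradient (\<lambda>_. c) = (\<lambda>_. 0)"
  by (rule ext) (simp add: gradient_def partial_const)

lemma gradient_diff_const: "smooth f \<Longrightarrow> gradient (\<lambda>x. f x - c) = gradient f"
  using gradient_diff[OF _ smooth_const[of c], of f] by (simp add: gradient_const)

context box_with_face
begin

abbreviation N :: "('a \<Rightarrow> 'b::euclidean_space) \<Rightarrow> real" where "N \<equiv> L2_norm (lebesgue_on \<Omega>)"

lemma \<Omega>_norm_smooth: "smooth f \<Longrightarrow> (N f)\<^sup>2 = box_integral (\<lambda>x. (f x)\<^sup>2)"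
  by (simp add: L2_norm_power2 \<Omega>_integral continuous_intros smooth_continuous)

lemma \<Omega>_norm_gradient:
  assumes "smooth f"
  shows "(N (gradient f))\<^sup>2 = (\<Sum>b\<in>Basis. box_integral (\<lambda>x. (partial b f x)\<^sup>2))"
proof -
  have c: "continuous_on UNIV (\<lambda>x. (partial b f x)\<^sup>2)" if "b \<in> Basis" for b
    using assms that by (intro continuous_intros smooth_continuous smooth_partial)
  have "(N (gradient f))\<^sup>2 = (\<Sum>b\<in>Basis. LINT x|lebesgue_on \<Omega>. (partial b f x)\<^sup>2)"
    unfolding L2_norm_power2 norm_gradient_power2
    by (intro Bochner_Integration.integral_sum \<Omega>_integrable c)
  then show ?thesis using c by (simp add: \<Omega>_integral)
qed

lemma \<sigma>_norm_smooth: "smooth f \<Longrightarrow> (L2_norm \<sigma> f)\<^sup>2 = face_integral (\<lambda>x. (f x)\<^sup>2) 0"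
  by (simp add: L2_norm_power2 \<sigma>_integral continuous_intros smooth_continuous)

lemma smooth_poincare:
  assumes f: "smooth f" and mean: "(LINT x|\<sigma>. f x) = 0"
    and m: "0 < m" "\<And>c. c \<in> Basis - {e} \<Longrightarrow> H \<bullet> c \<le> m"
  shows "N f \<le> max (2 * (H \<bullet> e)) m / pi * N (gradient f)"
proof (rule le_mult_of_power2)
  have "face_integral f 0 = 0" using mean f by (simp add: \<sigma>_integral smooth_continuous)
  then show "(N f)\<^sup>2 \<le> (max (2 * (H \<bullet> e)) m / pi)\<^sup>2 * (N (gradient f))\<^sup>2"
    unfolding \<Omega>_norm_smooth[OF f] \<Omega>_norm_gradient[OF f]
    by (intro box_poincare_inequality smooth_has_partial f m)
qed (use m L2_norm_nonneg in auto)

definition trace_rate :: "real \<Rightarrow> real" where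
  "trace_rate m = pi / m * tanh (pi * (H \<bullet> e) / m)"

lemma trace_rate_pos: "0 < m \<Longrightarrow> 0 < trace_rate m"
  using sides_pos[OF e_Basis] by (simp add: trace_rate_def)

lemma smooth_trace_inequality:
  assumes f: "smooth f" and mean: "(LINT x|\<sigma>. f x) = 0"
    and m: "0 < m" "\<And>c. c \<in> Basis - {e} \<Longrightarrow> H \<bullet> c \<le> m"
  shows "L2_norm \<sigma> f \<le> trace_rate m powr (- 1 / 2) * N (gradient f)"
proof (rule le_mult_of_power2)
  have "face_integral f 0 = 0" using mean f by (simp add: \<sigma>_integral smooth_continuous)
  then have "trace_rate m * (L2_norm \<sigma> f)\<^sup>2 \<le> (N (gradient f))\<^sup>2"
    unfolding \<sigma>_norm_smooth[OF f] \<Omega>_norm_gradient[OF f] trace_rate_def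
    by (intro box_trace_inequality smooth_has_partial f m)
  then show "(L2_norm \<sigma> f)\<^sup>2 \<le> (trace_rate m powr (- 1 / 2))\<^sup>2 * (N (gradient f))\<^sup>2"
    unfolding powr_minus_half_power2[OF trace_rate_pos[OF m(1)]]
    using trace_rate_pos[OF m(1)] by (simp add: field_simps)
qed (auto simp: L2_norm_nonneg)

text \<open>
  A trace bound without a condition on the mean; it is used to compare two approximating sequences.
\<close>

lemma smooth_trace_bound:
  assumes f: "smooth f"
  shows "sqrt (tanh (H \<bullet> e)) * L2_norm \<sigma> f \<le> N f + N (gradient f)"
proof -
  have "tanh (H \<bullet> e) * (L2_norm \<sigma> f)\<^sup>2 \<le> (N f)\<^sup>2 + box_integral (\<lambda>x. (partial e f x)\<^sup>2)"
    unfolding \<sigma>_norm_smooth[OF f] \<Omega>_norm_smooth[OF f]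
    by (rule box_trace_bound[OF smooth_has_partial[OF f e_Basis]])
  also have "box_integral (\<lambda>x. (partial e f x)\<^sup>2) \<le> (N (gradient f))\<^sup>2"
  proof -
    have "0 \<le> box_integral (\<lambda>x. (partial b f x)\<^sup>2)" if "b \<in> Basis" for b
    proof -
      have "continuous_on UNIV (\<lambda>x. (partial b f x)\<^sup>2)"
        using f that by (intro continuous_intros smooth_continuous smooth_partial)
      from \<Omega>_integral[OF this, symmetric] show ?thesis by simp
    qed
    then show ?thesis
      unfolding \<Omega>_norm_gradient[OF f] using e_Basis by (intro member_le_sum) auto
  qed
  finally have "tanh (H \<bullet> e) * (L2_norm \<sigma> f)\<^sup>2 \<le> (N f)\<^sup>2 + (N (gradient f))\<^sup>2" by simp
  also have "\<dots> \<le> (N f + N (gradient f))\<^sup>2"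
    using L2_norm_nonneg[of _ f] L2_norm_nonneg[of _ "gradient f"] by (simp add: power2_sum)
  finally have "sqrt (tanh (H \<bullet> e) * (L2_norm \<sigma> f)\<^sup>2) \<le> sqrt ((N f + N (gradient f))\<^sup>2)"
    by (rule real_sqrt_le_mono)
  then show ?thesis
    using L2_norm_nonneg[of _ f] L2_norm_nonneg[of _ "gradient f"] L2_norm_nonneg[of \<sigma> f]
    by (simp add: real_sqrt_mult)
qed

lemma H1_approximation:
  assumes w: "w \<in> H1 \<Omega>" and \<phi>: "\<And>n. smooth (\<phi> n)"
    and lim: "(\<lambda>n. H1_norm \<Omega> (\<lambda>x. \<phi> n x - w x)) \<longlonglongrightarrow> 0"
  shows "(\<lambda>n. N (\<lambda>x. \<phi> n x - w x)) \<longlonglongrightarrow> 0"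
    and "(\<lambda>n. N (\<lambda>x. gradient (\<phi> n) x - weak_grad \<Omega> w x)) \<longlonglongrightarrow> 0"
proof -
  note eq = H1_norm_smooth_diff[OF \<phi> w]
  show "(\<lambda>n. N (\<lambda>x. \<phi> n x - w x)) \<longlonglongrightarrow> 0"
    by (rule tendsto_sandwich[OF _ _ tendsto_const lim]) (auto simp: eq L2_norm_nonneg)
  show "(\<lambda>n. N (\<lambda>x. gradient (\<phi> n) x - weak_grad \<Omega> w x)) \<longlonglongrightarrow> 0"
    by (rule tendsto_sandwich[OF _ _ tendsto_const lim]) (auto simp: eq L2_norm_nonneg)
qed

lemma \<sigma>_integral_tendsto:
  assumes t: "t \<in> L2 \<sigma>" and \<phi>: "\<And>n. smooth (\<phi> n)"
    and lim: "(\<lambda>n. L2_norm \<sigma> (\<lambda>x. \<phi> n x - t x)) \<longlonglongrightarrow> 0"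
  shows "(\<lambda>n. LINT x|\<sigma>. \<phi> n x) \<longlonglongrightarrow> (LINT x|\<sigma>. t x)"
proof -
  interpret finite_measure \<sigma> by (rule finite_measure_\<sigma>)
  have \<phi>2: "\<phi> n \<in> L2 \<sigma>" for n by (intro continuous_L2_\<sigma> smooth_continuous \<phi>)
  have "(\<lambda>n. (LINT x|\<sigma>. \<phi> n x) - (LINT x|\<sigma>. t x)) \<longlonglongrightarrow> 0"
  proof (rule Lim_null_comparison)
    show "(\<lambda>n. sqrt (measure \<sigma> (space \<sigma>)) * L2_norm \<sigma> (\<lambda>x. \<phi> n x - t x)) \<longlonglongrightarrow> 0"
      using tendsto_mult[OF tendsto_const lim] by simp
    have "norm ((LINT x|\<sigma>. \<phi> n x) - (LINT x|\<sigma>. t x)) \<le> sqrt (measure \<sigma> (space \<sigma>)) * L2_norm \<sigma> (\<lambda>x. \<phi> n x - t x)" for n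
      using integral_le_L2_norm[OF L2_diff[OF \<phi>2[of n] t]] L2_imp_integrable[OF t] L2_imp_integrable[OF \<phi>2[of n]]
      by simp
    then show "\<forall>\<^sub>F n in sequentially. norm ((LINT x|\<sigma>. \<phi> n x) - (LINT x|\<sigma>. t x))
        \<le> sqrt (measure \<sigma> (space \<sigma>)) * L2_norm \<sigma> (\<lambda>x. \<phi> n x - t x)"
      by simp
  qed
  then show ?thesis by (simp add: LIM_zero_iff)
qed

text \<open>
  Membership in \<open>H1_tilde\<close> only asserts that some trace has mean zero, whereas the second constant quantifies over all
  traces. The difference of two approximating sequences tends to zero in the Sobolev norm, hence also on the face.
\<close>

lemma trace_integral_unique:
  assumes w: "w \<in> H1 \<Omega>" and t: "is_trace \<Omega> \<sigma> w t" and s: "is_trace \<Omega> \<sigma> w s"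
  shows "(LINT x|\<sigma>. t x) = (LINT x|\<sigma>. s x)"
proof -
  interpret finite_measure \<sigma> by (rule finite_measure_\<sigma>)
  obtain \<phi> where t2: "t \<in> L2 \<sigma>" and \<phi>: "\<And>n. smooth (\<phi> n)"
    and \<phi>w: "(\<lambda>n. H1_norm \<Omega> (\<lambda>x. \<phi> n x - w x)) \<longlonglongrightarrow> 0"
    and \<phi>t: "(\<lambda>n. L2_norm \<sigma> (\<lambda>x. \<phi> n x - t x)) \<longlonglongrightarrow> 0"
    using is_traceE[OF t] by blast
  obtain \<psi> where s2: "s \<in> L2 \<sigma>" and \<psi>: "\<And>n. smooth (\<psi> n)"
    and \<psi>w: "(\<lambda>n. H1_norm \<Omega> (\<lambda>x. \<psi> n x - w x)) \<longlonglongrightarrow> 0"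
    and \<psi>s: "(\<lambda>n. L2_norm \<sigma> (\<lambda>x. \<psi> n x - s x)) \<longlonglongrightarrow> 0"
    using is_traceE[OF s] by blast
  define q where "q = sqrt (tanh (H \<bullet> e))"
  have q: "q > 0" using sides_pos[OF e_Basis] by (simp add: q_def)
  define r where "r n = (N (\<lambda>x. \<phi> n x - w x) + N (\<lambda>x. \<psi> n x - w x))
    + (N (\<lambda>x. gradient (\<phi> n) x - weak_grad \<Omega> w x) + N (\<lambda>x. gradient (\<psi> n) x - weak_grad \<Omega> w x))" for n
  have "r \<longlonglongrightarrow> (0 + 0) + (0 + 0)"
    unfolding r_def[abs_def] by (intro tendsto_add H1_approximation[OF w] \<phi> \<psi> \<phi>w \<psi>w)
  then have "(\<lambda>n. sqrt (measure \<sigma> (space \<sigma>)) * (r n / q)) \<longlonglongrightarrow> sqrt (measure \<sigma> (space \<sigma>)) * (0 / q)"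
    using q by (intro tendsto_intros) auto
  then have r0: "(\<lambda>n. sqrt (measure \<sigma> (space \<sigma>)) * (r n / q)) \<longlonglongrightarrow> 0" by simp
  have bound: "\<bar>(LINT x|\<sigma>. \<phi> n x) - (LINT x|\<sigma>. \<psi> n x)\<bar> \<le> sqrt (measure \<sigma> (space \<sigma>)) * (r n / q)" for n
  proof -
    define d where "d x = \<phi> n x - \<psi> n x" for x
    have sd: "smooth d" unfolding d_def[abs_def] by (intro smooth_diff \<phi> \<psi>)
    have d2: "d \<in> L2 \<sigma>" by (intro continuous_L2_\<sigma> smooth_continuous sd)
    have "N d \<le> N (\<lambda>x. \<phi> n x - w x) + N (\<lambda>x. w x - \<psi> n x)"
      using L2_norm_triangle[OF L2_diff[OF smooth_H1(2)[OF \<phi>[of n]] weak_grad_props(1)[OF w]]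
        L2_diff[OF weak_grad_props(1)[OF w] smooth_H1(2)[OF \<psi>[of n]]]]
      by (simp add: d_def[abs_def])
    moreover have "N (gradient d) \<le> N (\<lambda>x. gradient (\<phi> n) x - weak_grad \<Omega> w x) + N (\<lambda>x. weak_grad \<Omega> w x - gradient (\<psi> n) x)"
      using L2_norm_triangle[OF L2_diff[OF smooth_H1(3)[OF \<phi>[of n]] weak_grad_props(2)[OF w]]
        L2_diff[OF weak_grad_props(2)[OF w] smooth_H1(3)[OF \<psi>[of n]]]]
      by (simp add: d_def[abs_def] gradient_diff[OF \<phi> \<psi>])
    ultimately have "N d + N (gradient d) \<le> r n"
      unfolding r_def L2_norm_minus_commute[of _ w] L2_norm_minus_commute[of _ "weak_grad \<Omega> w"] by simp
    then have "q * L2_norm \<sigma> d \<le> r n"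
      using smooth_trace_bound[OF sd] unfolding q_def by linarith
    then have "L2_norm \<sigma> d \<le> r n / q" using q by (simp add: field_simps)
    then have "sqrt (measure \<sigma> (space \<sigma>)) * L2_norm \<sigma> d \<le> sqrt (measure \<sigma> (space \<sigma>)) * (r n / q)"
      by (intro mult_left_mono) auto
    moreover have "(LINT x|\<sigma>. \<phi> n x) - (LINT x|\<sigma>. \<psi> n x) = (LINT x|\<sigma>. d x)"
      unfolding d_def by (intro Bochner_Integration.integral_diff[symmetric] \<sigma>_integrable smooth_continuous \<phi> \<psi>)
    ultimately show ?thesis using integral_le_L2_norm[OF d2] by simp
  qed
  have "(\<lambda>n. (LINT x|\<sigma>. \<phi> n x) - (LINT x|\<sigma>. \<psi> n x)) \<longlonglongrightarrow> 0"
    using bound by (intro Lim_null_comparison[OF _ r0]) simp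
  moreover have "(\<lambda>n. (LINT x|\<sigma>. \<phi> n x) - (LINT x|\<sigma>. \<psi> n x)) \<longlonglongrightarrow> (LINT x|\<sigma>. t x) - (LINT x|\<sigma>. s x)"
    by (intro tendsto_diff \<sigma>_integral_tendsto t2 s2 \<phi> \<psi> \<phi>t \<psi>s)
  ultimately show ?thesis using LIMSEQ_unique by fastforce
qed

text \<open>
  Subtracting from each approximating function its mean over the face makes the smooth inequality applicable and leaves
  the gradient unchanged; the means tend to zero together with the integral of the trace. The measure \<open>\<mu>\<close> is that of the box for
  the first constant (with \<open>u = w\<close>) and the surface measure for the second (with \<open>u = t\<close>).
\<close>

lemma inequality_by_density:
  fixes u t :: "'a \<Rightarrow> real"
  assumes fin: "finite_measure \<mu>" and cont: "\<And>f :: 'a \<Rightarrow> real. smooth f \<Longrightarrow> f \<in> L2 \<mu>"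
    and K: "0 \<le> K"
    and ineq: "\<And>f. \<lbrakk>smooth f; (LINT x|\<sigma>. f x) = 0\<rbrakk> \<Longrightarrow> L2_norm \<mu> f \<le> K * N (gradient f)"
    and w: "w \<in> H1 \<Omega>" and t: "t \<in> L2 \<sigma>" "(LINT x|\<sigma>. t x) = 0" and u: "u \<in> L2 \<mu>"
    and \<phi>: "\<And>n. smooth (\<phi> n)"
    and \<phi>w: "(\<lambda>n. H1_norm \<Omega> (\<lambda>x. \<phi> n x - w x)) \<longlonglongrightarrow> 0"
    and \<phi>t: "(\<lambda>n. L2_norm \<sigma> (\<lambda>x. \<phi> n x - t x)) \<longlonglongrightarrow> 0"
    and \<phi>u: "(\<lambda>n. L2_norm \<mu> (\<lambda>x. \<phi> n x - u x)) \<longlonglongrightarrow> 0"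
  shows "L2_norm \<mu> u \<le> K * N (weak_grad \<Omega> w)"
proof -
  interpret finite_measure \<mu> by (rule fin)
  define c where "c n = (LINT x|\<sigma>. \<phi> n x) / face_area" for n
  define V where "V = sqrt (measure \<mu> (space \<mu>))"
  have c0: "c \<longlonglongrightarrow> 0"
    using tendsto_divide[OF \<sigma>_integral_tendsto[OF t(1) \<phi> \<phi>t] tendsto_const[of face_area]] face_area_pos t(2)
    by (simp add: c_def[abs_def])
  have bound: "L2_norm \<mu> u \<le> (K * (N (weak_grad \<Omega> w) + N (\<lambda>x. gradient (\<phi> n) x - weak_grad \<Omega> w x)) + \<bar>c n\<bar> * V)
     + L2_norm \<mu> (\<lambda>x. \<phi> n x - u x)" for n
  proof -
    define f where "f x = \<phi> n x - c n" for x
    have sf: "smooth f" unfolding f_def[abs_def] by (intro smooth_diff smooth_const \<phi>)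
    have "(LINT x|\<sigma>. f x) = (LINT x|\<sigma>. \<phi> n x) - (LINT x|\<sigma>. c n)"
      unfolding f_def by (intro Bochner_Integration.integral_diff \<sigma>_integrable smooth_continuous \<phi> smooth_const)
    also have "\<dots> = 0" using face_area_pos by (simp add: measure_\<sigma> c_def)
    finally have "L2_norm \<mu> f \<le> K * N (gradient f)" by (rule ineq[OF sf])
    also have "gradient f = gradient (\<phi> n)" unfolding f_def[abs_def] by (rule gradient_diff_const[OF \<phi>])
    also have "K * N (gradient (\<phi> n)) \<le> K * (N (weak_grad \<Omega> w) + N (\<lambda>x. weak_grad \<Omega> w x - gradient (\<phi> n) x))"
      by (intro mult_left_mono L2_norm_le_add_diff smooth_H1 weak_grad_props[OF w] \<phi> K)
    finally have f: "L2_norm \<mu> f \<le> K * (N (weak_grad \<Omega> w) + N (\<lambda>x. gradient (\<phi> n) x - weak_grad \<Omega> w x))"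
      unfolding L2_norm_minus_commute[of _ "weak_grad \<Omega> w"] .
    have "L2_norm \<mu> (\<phi> n) \<le> L2_norm \<mu> f + L2_norm \<mu> (\<lambda>x. c n)"
      using L2_norm_triangle[OF cont[OF sf] L2_const[of "c n"]] by (simp add: f_def[abs_def])
    moreover have "L2_norm \<mu> u \<le> L2_norm \<mu> (\<phi> n) + L2_norm \<mu> (\<lambda>x. \<phi> n x - u x)"
      by (intro L2_norm_le_add_diff u cont \<phi>)
    ultimately show ?thesis using f by (simp add: L2_norm_const V_def)
  qed
  have "(\<lambda>n. (K * (N (weak_grad \<Omega> w) + N (\<lambda>x. gradient (\<phi> n) x - weak_grad \<Omega> w x)) + \<bar>c n\<bar> * V)
     + L2_norm \<mu> (\<lambda>x. \<phi> n x - u x)) \<longlonglongrightarrow> (K * (N (weak_grad \<Omega> w) + 0) + \<bar>0\<bar> * V) + 0"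
    by (intro tendsto_intros H1_approximation(2)[OF w \<phi> \<phi>w] c0 \<phi>u)
  then show ?thesis
    using bound by (intro LIMSEQ_le_const) auto
qed

lemma H1_tildeE:
  assumes "w \<in> H1_tilde \<Omega> \<sigma>"
  obtains t where "w \<in> H1 \<Omega>" "is_trace \<Omega> \<sigma> w t" "(LINT x|\<sigma>. t x) = 0"
  using assms face_area_pos unfolding H1_tilde_def mean_value_def measure_\<sigma> by auto

lemma smooth_is_trace:
  assumes f: "smooth f" shows "is_trace \<Omega> \<sigma> f f"
proof -
  have "H1_norm \<Omega> (\<lambda>x. f x - f x) = 0"
    unfolding H1_norm_smooth_diff[OF f smooth_H1(1)[OF f]]
    using L2_norm_cong_AE[of "\<lambda>x. gradient f x - weak_grad \<Omega> f x" "lebesgue_on \<Omega>" "\<lambda>_. 0"]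
      weak_gradient_unique[OF _ _ _ smooth_weak_gradient[OF f] weak_grad_props(3)]
      smooth_H1[OF f] weak_grad_props[OF smooth_H1(1)[OF f]]
    by (simp add: L2_diff continuous_L2_\<Omega> L2_norm_def)
  then show ?thesis
    unfolding is_trace_def using f
    by (auto intro!: continuous_L2_\<sigma> smooth_continuous exI[of _ "\<lambda>_. f"] simp: L2_norm_def)
qed

lemma smooth_H1_tilde:
  assumes "smooth f" "(LINT x|\<sigma>. f x) = 0" shows "f \<in> H1_tilde \<Omega> \<sigma>"
  unfolding H1_tilde_def mean_value_def
  using assms smooth_H1(1)[of f] smooth_is_trace[of f] by (auto intro!: exI[of _ f])

lemma poincare_constant_valid:
  assumes m: "0 < m" "\<And>c. c \<in> Basis - {e} \<Longrightarrow> H \<bullet> c \<le> m" and w: "w \<in> H1_tilde \<Omega> \<sigma>"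
  shows "N w \<le> max (2 * (H \<bullet> e)) m / pi * N (weak_grad \<Omega> w)"
proof -
  obtain t where w1: "w \<in> H1 \<Omega>" and t: "is_trace \<Omega> \<sigma> w t" "(LINT x|\<sigma>. t x) = 0"
    using H1_tildeE[OF w] .
  obtain \<phi> where t2: "t \<in> L2 \<sigma>" and \<phi>: "\<And>n. smooth (\<phi> n)"
    and \<phi>w: "(\<lambda>n. H1_norm \<Omega> (\<lambda>x. \<phi> n x - w x)) \<longlonglongrightarrow> 0"
    and \<phi>t: "(\<lambda>n. L2_norm \<sigma> (\<lambda>x. \<phi> n x - t x)) \<longlonglongrightarrow> 0"
    using is_traceE[OF t(1)] by blast
  show ?thesis
    using m
    by (intro inequality_by_density[OF finite_measure_\<Omega> smooth_H1(2) _ smooth_poincare w1 t2 t(2)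
          weak_grad_props(1)[OF w1] \<phi> \<phi>w \<phi>t H1_approximation(1)[OF w1 \<phi> \<phi>w]]) auto
qed

lemma trace_constant_valid:
  assumes m: "0 < m" "\<And>c. c \<in> Basis - {e} \<Longrightarrow> H \<bullet> c \<le> m" and w: "w \<in> H1_tilde \<Omega> \<sigma>"
    and t: "is_trace \<Omega> \<sigma> w t"
  shows "L2_norm \<sigma> t \<le> trace_rate m powr (- 1 / 2) * N (weak_grad \<Omega> w)"
proof -
  obtain s where w1: "w \<in> H1 \<Omega>" and s: "is_trace \<Omega> \<sigma> w s" "(LINT x|\<sigma>. s x) = 0"
    using H1_tildeE[OF w] .
  have t0: "(LINT x|\<sigma>. t x) = 0" using trace_integral_unique[OF w1 t s(1)] s(2) by simp
  obtain \<phi> where t2: "t \<in> L2 \<sigma>" and \<phi>: "\<And>n. smooth (\<phi> n)"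
    and \<phi>w: "(\<lambda>n. H1_norm \<Omega> (\<lambda>x. \<phi> n x - w x)) \<longlonglongrightarrow> 0"
    and \<phi>t: "(\<lambda>n. L2_norm \<sigma> (\<lambda>x. \<phi> n x - t x)) \<longlonglongrightarrow> 0"
    using is_traceE[OF t(1)] by blast
  show ?thesis
    using m
    by (intro inequality_by_density[OF finite_measure_\<sigma> _ _ smooth_trace_inequality w1 t2 t0 t2 \<phi> \<phi>w \<phi>t \<phi>t])
      (auto intro: continuous_L2_\<sigma> smooth_continuous)
qed

end

section \<open>Extremal functions and sharpness\<close>

text \<open>
  Integrating out a coordinate of a product of one-variable functions replaces one factor by a constant function,
  which keeps the product form and makes induction over the coordinates possible.
\<close>

lemma slice_integral_separable:
  fixes q :: "'a::euclidean_space \<Rightarrow> real \<Rightarrow> real"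
  assumes c: "c \<in> Basis"
  shows "slice_integral H c (\<lambda>x. \<Prod>b\<in>Basis. q b (x \<bullet> b))
    = (\<lambda>x. \<Prod>b\<in>Basis. (q(c := \<lambda>_. integral {0..H \<bullet> c} (q c))) b (x \<bullet> b))"
proof
  fix x
  have "(\<Prod>b\<in>Basis. q b (set_coord c s x \<bullet> b)) = (\<Prod>b\<in>Basis - {c}. q b (x \<bullet> b)) * q c s" for s
    using c by (subst prod.remove[OF finite_Basis c]) (auto simp: set_coord_inner mult.commute intro!: prod.cong)
  then have "slice_integral H c (\<lambda>x. \<Prod>b\<in>Basis. q b (x \<bullet> b)) x
      = (\<Prod>b\<in>Basis - {c}. q b (x \<bullet> b)) * integral {0..H \<bullet> c} (q c)"
    by (simp add: slice_integral_def)
  then show "slice_integral H c (\<lambda>x. \<Prod>b\<in>Basis. q b (x \<bullet> b)) x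
    = (\<Prod>b\<in>Basis. (q(c := \<lambda>_. integral {0..H \<bullet> c} (q c))) b (x \<bullet> b))"
    by (subst prod.remove[OF finite_Basis c]) (simp add: mult.commute)
qed

lemma iter_integral_separable:
  fixes q :: "'a::euclidean_space \<Rightarrow> real \<Rightarrow> real"
  assumes "distinct bs" "set bs \<subseteq> Basis"
  shows "iter_integral H bs (\<lambda>x. \<Prod>b\<in>Basis. q b (x \<bullet> b)) x
    = (\<Prod>b\<in>Basis. if b \<in> set bs then integral {0..H \<bullet> b} (q b) else q b (x \<bullet> b))"
  using assms
proof (induction bs arbitrary: q)
  case (Cons c bs)
  show ?case
    unfolding iter_integral_simps slice_integral_separable[of c, OF subsetD[OF Cons.prems(2)], simplified]
    using Cons.prems by (subst Cons.IH) (auto intro!: prod.cong)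
qed simp

text \<open>
  Differentiating a sine is a phase shift by \<open>pi / 2\<close>, which writes all derivatives uniformly.
\<close>

lemma smooth_sin_ridge: "smooth (\<lambda>x :: 'a::euclidean_space. sin (x \<bullet> a + \<beta>))"
proof -
  have "((\<lambda>t. sin (t + real j * (pi / 2))) has_real_derivative sin (t + real (Suc j) * (pi / 2))) (at t)" for j t
  proof -
    have "sin (t + real (Suc j) * (pi / 2)) = cos (t + real j * (pi / 2))"
    proof -
      have "t + real (Suc j) * (pi / 2) = (t + real j * (pi / 2)) + pi / 2"
        by (simp add: distrib_right)
      moreover have "sin (y + pi / 2) = cos y" for y :: real
        by (simp add: sin_add)
      ultimately show ?thesis by (simp only:)
    qed
    then show ?thesis by (auto intro!: derivative_eq_intros)
  qed
  from smooth_ridge[where D = "\<lambda>j t. sin (t + real j * (pi / 2))" and j = 0, OF this]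
  show ?thesis by simp
qed

lemma smooth_cos_ridge: "smooth (\<lambda>x :: 'a::euclidean_space. cos (x \<bullet> a + \<beta>))"
  using smooth_sin_ridge[of a "\<beta> + pi / 2"] by (simp add: sin_add flip: add.assoc)

lemma smooth_cosh_ridge: "smooth (\<lambda>x :: 'a::euclidean_space. cosh (x \<bullet> a + \<beta>))"
proof -
  have "((if even j then cosh else sinh) has_real_derivative (if even (Suc j) then cosh else sinh) t) (at t)"
    for j and t :: real
    by (auto intro!: derivative_eq_intros)
  from smooth_ridge[where D = "\<lambda>j. if even j then cosh else sinh" and j = 0, OF this]
  show ?thesis by simp
qed

lemma integral_sin_cos_squared:
  fixes L k :: real
  assumes "0 \<le> L" "k \<noteq> 0" "sin (2 * k * L) = 0"
  shows "integral {0..L} (\<lambda>x. (sin (k * x))\<^sup>2) = L / 2" "integral {0..L} (\<lambda>x. (cos (k * x))\<^sup>2) = L / 2"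
proof -
  have "((\<lambda>x. (sin (k * x))\<^sup>2) has_integral (L / 2 - sin (2 * k * L) / (4 * k) - (0 / 2 - sin (2 * k * 0) / (4 * k)))) {0..L}"
  proof (rule fundamental_theorem_of_calculus[OF assms(1)])
    fix x
    have "((\<lambda>x. x / 2 - sin (2 * k * x) / (4 * k)) has_real_derivative (1 / 2 - cos (2 * (k * x)) / 2)) (at x within {0..L})"
      using assms(2) by (auto intro!: derivative_eq_intros simp: field_simps)
    also have "1 / 2 - cos (2 * (k * x)) / 2 = (sin (k * x))\<^sup>2"
      by (simp add: cos_double_sin diff_divide_distrib)
    finally show "((\<lambda>x. x / 2 - sin (2 * k * x) / (4 * k)) has_vector_derivative (sin (k * x))\<^sup>2) (at x within {0..L})"
      by (simp add: has_real_derivative_iff_has_vector_derivative)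
  qed
  then have s: "((\<lambda>x. (sin (k * x))\<^sup>2) has_integral (L / 2)) {0..L}" using assms(3) by simp
  have "((\<lambda>x. 1 - (sin (k * x))\<^sup>2) has_integral (L - L / 2)) {0..L}"
    using has_integral_const_real[of "1::real" 0 L] assms(1) by (intro has_integral_diff s) simp
  moreover have "(\<lambda>x. 1 - (sin (k * x))\<^sup>2) = (\<lambda>x. (cos (k * x))\<^sup>2)"
    by (simp add: cos_squared_eq)
  ultimately show "integral {0..L} (\<lambda>x. (sin (k * x))\<^sup>2) = L / 2" "integral {0..L} (\<lambda>x. (cos (k * x))\<^sup>2) = L / 2"
    using s by (auto simp: integral_unique)
qed

lemma integral_cos_zero:
  fixes L k :: real
  assumes "0 \<le> L" "k \<noteq> 0" "sin (k * L) = 0"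
  shows "integral {0..L} (\<lambda>x. cos (k * x)) = 0"
proof -
  have "((\<lambda>x. cos (k * x)) has_integral (sin (k * L) / k - sin (k * 0) / k)) {0..L}"
    using assms(1,2) by (intro fundamental_theorem_of_calculus)
      (auto intro!: derivative_eq_intros simp flip: has_real_derivative_iff_has_vector_derivative)
  then show ?thesis using assms(3) by (simp add: integral_unique)
qed

lemma integral_sinh_cosh_squared:
  fixes h \<kappa> :: real
  assumes "0 \<le> h" "\<kappa> \<noteq> 0"
  shows "integral {0..h} (\<lambda>x. (sinh (\<kappa> * (h - x)))\<^sup>2) + integral {0..h} (\<lambda>x. (cosh (\<kappa> * (h - x)))\<^sup>2)
    = sinh (\<kappa> * h) * cosh (\<kappa> * h) / \<kappa>"
proof -
  define F where "F x = - (sinh (\<kappa> * (h - x)) * cosh (\<kappa> * (h - x)) / \<kappa>)" for x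
  have "((\<lambda>x. (sinh (\<kappa> * (h - x)))\<^sup>2 + (cosh (\<kappa> * (h - x)))\<^sup>2) has_integral (F h - F 0)) {0..h}"
    unfolding F_def using assms by (intro fundamental_theorem_of_calculus)
      (auto intro!: derivative_eq_intros simp: power2_eq_square field_simps simp flip: has_real_derivative_iff_has_vector_derivative)
  moreover have "(\<lambda>x. (sinh (\<kappa> * (h - x)))\<^sup>2) integrable_on {0..h}" "(\<lambda>x. (cosh (\<kappa> * (h - x)))\<^sup>2) integrable_on {0..h}"
    by (intro integrable_continuous_real continuous_intros)+
  ultimately have "integral {0..h} (\<lambda>x. (sinh (\<kappa> * (h - x)))\<^sup>2) + integral {0..h} (\<lambda>x. (cosh (\<kappa> * (h - x)))\<^sup>2) = F h - F 0"
    by (simp add: integral_unique flip: Henstock_Kurzweil_Integration.integral_add)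
  then show ?thesis by (simp add: F_def)
qed

lemma partial_product_two:
  assumes "\<And>t. (u has_real_derivative u' t) (at t)" "\<And>t. (v has_real_derivative v' t) (at t)"
  shows "partial b (\<lambda>x. u (x \<bullet> e) * v (x \<bullet> c)) x
    = (b \<bullet> e) * (u' (x \<bullet> e) * v (x \<bullet> c)) + (b \<bullet> c) * (u (x \<bullet> e) * v' (x \<bullet> c))"
proof -
  have inner: "((\<lambda>x. x \<bullet> a) has_derivative (\<lambda>h. h \<bullet> a)) (at x)" for a
    by (auto intro!: derivative_eq_intros)
  have "((\<lambda>x. u (x \<bullet> e) * v (x \<bullet> c)) has_derivative
    (\<lambda>h. u (x \<bullet> e) * (v' (x \<bullet> c) * (h \<bullet> c)) + u' (x \<bullet> e) * (h \<bullet> e) * v (x \<bullet> c))) (at x)"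
    by (intro has_derivative_mult has_derivative_compose[OF inner assms(1)[THEN has_field_derivative_imp_has_derivative]]
      has_derivative_compose[OF inner assms(2)[THEN has_field_derivative_imp_has_derivative]])
  from partial_eqI[OF this] show ?thesis by (simp add: algebra_simps)
qed

context box_with_face
begin

lemma integrals_of_two_factors:
  assumes c: "c \<in> Basis - {e}"
  obtains R where "0 < R"
    "\<And>u v. box_integral (\<lambda>x. u (x \<bullet> e) * v (x \<bullet> c)) = R * (integral {0..H \<bullet> e} u * integral {0..H \<bullet> c} v)"
    "\<And>u v. face_integral (\<lambda>x. u (x \<bullet> e) * v (x \<bullet> c)) 0 = R * (u 0 * integral {0..H \<bullet> c} v)"
proof -
  define R where "R = (\<Prod>b\<in>Basis - {e, c}. H \<bullet> b)"
  have c': "c \<in> Basis" "c \<noteq> e" using c by auto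
  have split: "prod g Basis = g e * g c * prod g (Basis - {e, c})" for g :: "'a \<Rightarrow> real"
  proof -
    have "Basis - {e} - {c} = Basis - {e, c}" by blast
    then show ?thesis
      using prod.remove[OF finite_Basis e_Basis, of g] prod.remove[of "Basis - {e}" c g] c by simp
  qed
  \<comment> \<open>the one-variable factors: constant except in the directions of the two given functions\<close>
  define q where "q u v = ((\<lambda>_ _. 1)(e := u, c := v))" for u v :: "real \<Rightarrow> real"
  have q: "(\<lambda>x. u (x \<bullet> e) * v (x \<bullet> c)) = (\<lambda>x. \<Prod>b\<in>Basis. q u v b (x \<bullet> b))" for u v
    unfolding split using c' by (intro ext) (simp add: q_def)
  have R: "(\<Prod>b\<in>Basis - {e, c}. integral {0..H \<bullet> b} (q u v b)) = R" for u v
    unfolding R_def using sides_pos by (intro prod.cong) (auto simp: q_def less_imp_le)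
  show ?thesis
  proof (rule that)
    show "0 < R" unfolding R_def using sides_pos by (intro prod_pos) auto
    show "box_integral (\<lambda>x. u (x \<bullet> e) * v (x \<bullet> c)) = R * (integral {0..H \<bullet> e} u * integral {0..H \<bullet> c} v)" for u v
    proof -
      have "box_integral (\<lambda>x. u (x \<bullet> e) * v (x \<bullet> c)) = (\<Prod>b\<in>Basis. integral {0..H \<bullet> b} (q u v b))"
        unfolding q box_integral_def using distinct_cs set_cs e_Basis
        by (subst iter_integral_separable) (auto intro!: prod.cong)
      then show ?thesis unfolding split R using c' by (simp add: q_def)
    qed
    show "face_integral (\<lambda>x. u (x \<bullet> e) * v (x \<bullet> c)) 0 = R * (u 0 * integral {0..H \<bullet> c} v)" for u v
    proof -
      have "face_integral (\<lambda>x. u (x \<bullet> e) * v (x \<bullet> c)) 0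
          = (\<Prod>b\<in>Basis. if b \<in> set cs then integral {0..H \<bullet> b} (q u v b) else q u v b (0 \<bullet> b))"
        unfolding q using distinct_cs set_cs by (subst iter_integral_separable) auto
      also have "\<dots> = u 0 * integral {0..H \<bullet> c} v * (\<Prod>b\<in>Basis - {e, c}. integral {0..H \<bullet> b} (q u v b))"
        unfolding split using c' set_cs by (auto simp: q_def intro!: prod.cong)
      finally show ?thesis unfolding R by simp
    qed
  qed
qed

text \<open>
  The extremal functions depend only on the normal coordinate and on the coordinate of a longest side of the face; the
  other sides enter all integrals through the same factor \<open>R\<close>.
\<close>

lemma two_factor_test_function:
  assumes c: "c \<in> Basis - {e}" and sm: "smooth (\<lambda>x. u (x \<bullet> e) * v (x \<bullet> c))"
    and du: "\<And>t. (u has_real_derivative u' t) (at t)" and dv: "\<And>t. (v has_real_derivative v' t) (at t)"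
  defines "f \<equiv> \<lambda>x. u (x \<bullet> e) * v (x \<bullet> c)"
  obtains R where "0 < R"
    "(N f)\<^sup>2 = R * (integral {0..H \<bullet> e} (\<lambda>t. (u t)\<^sup>2) * integral {0..H \<bullet> c} (\<lambda>t. (v t)\<^sup>2))"
    "(N (weak_grad \<Omega> f))\<^sup>2 = R * (integral {0..H \<bullet> e} (\<lambda>t. (u' t)\<^sup>2) * integral {0..H \<bullet> c} (\<lambda>t. (v t)\<^sup>2)
      + integral {0..H \<bullet> e} (\<lambda>t. (u t)\<^sup>2) * integral {0..H \<bullet> c} (\<lambda>t. (v' t)\<^sup>2))"
    "(L2_norm \<sigma> f)\<^sup>2 = R * ((u 0)\<^sup>2 * integral {0..H \<bullet> c} (\<lambda>t. (v t)\<^sup>2))"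
    "(LINT x|\<sigma>. f x) = R * (u 0 * integral {0..H \<bullet> c} v)"
proof -
  obtain R where R: "0 < R"
    "\<And>u v. box_integral (\<lambda>x. u (x \<bullet> e) * v (x \<bullet> c)) = R * (integral {0..H \<bullet> e} u * integral {0..H \<bullet> c} v)"
    "\<And>u v. face_integral (\<lambda>x. u (x \<bullet> e) * v (x \<bullet> c)) 0 = R * (u 0 * integral {0..H \<bullet> c} v)"
    using integrals_of_two_factors[OF c] by blast
  have c': "c \<in> Basis" "c \<noteq> e" using c by auto
  have sf: "smooth f" using sm by (simp add: f_def)
  have p: "partial b f = (\<lambda>x. (b \<bullet> e) * (u' (x \<bullet> e) * v (x \<bullet> c)) + (b \<bullet> c) * (u (x \<bullet> e) * v' (x \<bullet> c)))" for b
    unfolding f_def using partial_product_two[OF du dv] by blast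
  have pe: "partial e f = (\<lambda>x. u' (x \<bullet> e) * v (x \<bullet> c))" and pc: "partial c f = (\<lambda>x. u (x \<bullet> e) * v' (x \<bullet> c))"
    unfolding p using c' e_Basis by (auto simp: inner_Basis)
  have p0: "partial b f = (\<lambda>_. 0)" if "b \<in> Basis - {e} - {c}" for b
    unfolding p using that c' e_Basis by (auto simp: inner_Basis)
  show ?thesis
  proof (rule that[OF R(1)])
    show "(N f)\<^sup>2 = R * (integral {0..H \<bullet> e} (\<lambda>t. (u t)\<^sup>2) * integral {0..H \<bullet> c} (\<lambda>t. (v t)\<^sup>2))"
      unfolding \<Omega>_norm_smooth[OF sf] unfolding f_def power_mult_distrib by (rule R(2))
    show "(L2_norm \<sigma> f)\<^sup>2 = R * ((u 0)\<^sup>2 * integral {0..H \<bullet> c} (\<lambda>t. (v t)\<^sup>2))"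
      unfolding \<sigma>_norm_smooth[OF sf] unfolding f_def power_mult_distrib by (rule R(3))
    show "(LINT x|\<sigma>. f x) = R * (u 0 * integral {0..H \<bullet> c} v)"
      unfolding \<sigma>_integral[OF smooth_continuous[OF sf]] unfolding f_def by (rule R(3))
    have "(N (weak_grad \<Omega> f))\<^sup>2 = (\<Sum>b\<in>Basis. box_integral (\<lambda>x. (partial b f x)\<^sup>2))"
      unfolding L2_norm_weak_grad_smooth[OF sf] \<Omega>_norm_gradient[OF sf] ..
    also have "\<dots> = box_integral (\<lambda>x. (partial e f x)\<^sup>2) + box_integral (\<lambda>x. (partial c f x)\<^sup>2)
        + (\<Sum>b\<in>Basis - {e} - {c}. box_integral (\<lambda>x. (partial b f x)\<^sup>2))"
      using sum.remove[OF finite_Basis e_Basis, of "\<lambda>b. box_integral (\<lambda>x. (partial b f x)\<^sup>2)"]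
        sum.remove[of "Basis - {e}" c "\<lambda>b. box_integral (\<lambda>x. (partial b f x)\<^sup>2)"] c
      by simp
    also have "(\<Sum>b\<in>Basis - {e} - {c}. box_integral (\<lambda>x. (partial b f x)\<^sup>2)) = 0"
      using p0 R(2)[of "\<lambda>_. 0" "\<lambda>_. 0"] by (intro sum.neutral) simp
    finally show "(N (weak_grad \<Omega> f))\<^sup>2 = R * (integral {0..H \<bullet> e} (\<lambda>t. (u' t)\<^sup>2) * integral {0..H \<bullet> c} (\<lambda>t. (v t)\<^sup>2)
      + integral {0..H \<bullet> e} (\<lambda>t. (u t)\<^sup>2) * integral {0..H \<bullet> c} (\<lambda>t. (v' t)\<^sup>2))"
      unfolding pe pc power_mult_distrib
      using R(2)[of "\<lambda>t. (u' t)\<^sup>2" "\<lambda>t. (v t)\<^sup>2"] R(2)[of "\<lambda>t. (u t)\<^sup>2" "\<lambda>t. (v' t)\<^sup>2"]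
      by (simp add: distrib_left)
  qed
qed

text \<open>
  For the sine, \<open>k = pi / (2 * h)\<close> makes the trace vanish on the face; for the cosine, \<open>k = pi / (H \<bullet> c)\<close> makes the mean over the face
  vanish. In both cases the gradient norm is \<open>k\<close> times the norm of the function.
\<close>

lemma poincare_constant_lower_bound:
  assumes c: "c \<in> Basis - {e}" and C: "\<And>w. w \<in> H1_tilde \<Omega> \<sigma> \<Longrightarrow> N w \<le> C * N (weak_grad \<Omega> w)"
  shows "2 * (H \<bullet> e) / pi \<le> C" and "H \<bullet> c / pi \<le> C"
proof -
  define h m where "h = H \<bullet> e" and "m = H \<bullet> c"
  have pos: "0 < h" "0 < m" using sides_pos e_Basis c by (auto simp: h_def m_def)
  show "2 * (H \<bullet> e) / pi \<le> C"
  proof -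
    define k where "k = pi / (2 * h)"
    have k: "k > 0" "k * h = pi / 2" "2 * k * h = pi" using pos by (auto simp: k_def)
    define f where "f = (\<lambda>x :: 'a. sin (k * (x \<bullet> e)) * 1)"
    have du: "((\<lambda>t. sin (k * t)) has_real_derivative k * cos (k * t)) (at t)" for t
      by (auto intro!: derivative_eq_intros)
    have sm: "smooth (\<lambda>x :: 'a. sin (k * (x \<bullet> e)) * 1)"
      using smooth_sin_ridge[of "k *\<^sub>R e" 0] by simp
    obtain R where R: "0 < R"
      "(N f)\<^sup>2 = R * (integral {0..h} (\<lambda>t. (sin (k * t))\<^sup>2) * integral {0..m} (\<lambda>t. 1\<^sup>2))"
      "(N (weak_grad \<Omega> f))\<^sup>2 = R * (integral {0..h} (\<lambda>t. (k * cos (k * t))\<^sup>2) * integral {0..m} (\<lambda>t. 1\<^sup>2)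
        + integral {0..h} (\<lambda>t. (sin (k * t))\<^sup>2) * integral {0..m} (\<lambda>t. 0\<^sup>2))"
      "(LINT x|\<sigma>. f x) = R * (sin (k * 0) * integral {0..m} (\<lambda>_. 1))"
      by (rule two_factor_test_function[where u = "\<lambda>t. sin (k * t)" and v = "\<lambda>_. 1",
          OF c sm du DERIV_const, folded h_def m_def f_def])
    have N2: "(N f)\<^sup>2 = R * (h / 2 * m)" "(N (weak_grad \<Omega> f))\<^sup>2 = R * (k\<^sup>2 * (h / 2) * m)"
      unfolding R(2,3) using integral_sin_cos_squared[of h k] k pos by (simp_all add: power_mult_distrib)
    have "smooth f" using sm by (simp add: f_def)
    then have "f \<in> H1_tilde \<Omega> \<sigma>" using R(4) by (intro smooth_H1_tilde) auto
    note bound = C[OF this]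
    have "1 / k \<le> C"
      by (rule constant_le_of_equality[OF _ _ _ _ _ bound])
        (use k R(1) pos in \<open>auto simp: N2 L2_norm_nonneg power_divide\<close>)
    then show ?thesis by (simp add: k_def h_def)
  qed
  show "H \<bullet> c / pi \<le> C"
  proof -
    define k where "k = pi / m"
    have k: "k > 0" "k * m = pi" "2 * k * m = 2 * pi" using pos by (auto simp: k_def)
    define f where "f = (\<lambda>x :: 'a. 1 * cos (k * (x \<bullet> c)))"
    have dv: "((\<lambda>t. cos (k * t)) has_real_derivative - (k * sin (k * t))) (at t)" for t
      by (auto intro!: derivative_eq_intros)
    have sm: "smooth (\<lambda>x :: 'a. 1 * cos (k * (x \<bullet> c)))"
      using smooth_cos_ridge[of "k *\<^sub>R c" 0] by simp
    obtain R where R: "0 < R"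
      "(N f)\<^sup>2 = R * (integral {0..h} (\<lambda>t. 1\<^sup>2) * integral {0..m} (\<lambda>t. (cos (k * t))\<^sup>2))"
      "(N (weak_grad \<Omega> f))\<^sup>2 = R * (integral {0..h} (\<lambda>t. 0\<^sup>2) * integral {0..m} (\<lambda>t. (cos (k * t))\<^sup>2)
        + integral {0..h} (\<lambda>t. 1\<^sup>2) * integral {0..m} (\<lambda>t. (- (k * sin (k * t)))\<^sup>2))"
      "(LINT x|\<sigma>. f x) = R * (1 * integral {0..m} (\<lambda>t. cos (k * t)))"
      by (rule two_factor_test_function[where u = "\<lambda>_. 1" and v = "\<lambda>t. cos (k * t)",
          OF c sm DERIV_const dv, folded h_def m_def f_def])
    have N2: "(N f)\<^sup>2 = R * (h * (m / 2))" "(N (weak_grad \<Omega> f))\<^sup>2 = R * (h * (k\<^sup>2 * (m / 2)))"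
      unfolding R(2,3) using integral_sin_cos_squared[of m k] k pos by (simp_all add: power_mult_distrib)
    have "(LINT x|\<sigma>. f x) = 0"
      unfolding R(4) using integral_cos_zero[of m k] k pos by simp
    moreover have "smooth f" using sm by (simp add: f_def)
    ultimately have "f \<in> H1_tilde \<Omega> \<sigma>" by (intro smooth_H1_tilde)
    note bound = C[OF this]
    have "1 / k \<le> C"
      by (rule constant_le_of_equality[OF _ _ _ _ _ bound])
        (use k R(1) pos in \<open>auto simp: N2 L2_norm_nonneg power_divide\<close>)
    then show ?thesis by (simp add: k_def m_def)
  qed
qed

text \<open>
  The normal factor \<open>cosh (k * (h - t))\<close> solves \<open>F'' = k\<^sup>2 * F\<close> and has zero slope at the far end of the box; its logarithmic
  derivative is the function \<open>p\<close> of \<open>face_riccati\<close>, so every estimate in the trace inequality is an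
  equality for this function.
\<close>

lemma trace_constant_lower_bound:
  assumes c: "c \<in> Basis - {e}"
    and C: "\<And>w t. \<lbrakk>w \<in> H1_tilde \<Omega> \<sigma>; is_trace \<Omega> \<sigma> w t\<rbrakk> \<Longrightarrow> L2_norm \<sigma> t \<le> C * N (weak_grad \<Omega> w)"
  shows "trace_rate (H \<bullet> c) powr (- 1 / 2) \<le> C"
proof -
  define h m k where "h = H \<bullet> e" and "m = H \<bullet> c" and "k = pi / m"
  have pos: "0 < h" "0 < m" using sides_pos e_Basis c by (auto simp: h_def m_def)
  have k: "k > 0" "k * m = pi" "2 * k * m = 2 * pi" using pos by (auto simp: k_def)
  define f where "f = (\<lambda>x :: 'a. cosh (k * (h - x \<bullet> e)) * cos (k * (x \<bullet> c)))"
  have du: "((\<lambda>t. cosh (k * (h - t))) has_real_derivative - (k * sinh (k * (h - t)))) (at t)" for t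
    by (auto intro!: derivative_eq_intros)
  have dv: "((\<lambda>t. cos (k * t)) has_real_derivative - (k * sin (k * t))) (at t)" for t
    by (auto intro!: derivative_eq_intros)
  have sm: "smooth (\<lambda>x :: 'a. cosh (k * (h - x \<bullet> e)) * cos (k * (x \<bullet> c)))"
  proof (rule smooth_mult)
    show "smooth (\<lambda>x :: 'a. cosh (k * (h - x \<bullet> e)))"
      using smooth_cosh_ridge[of "- k *\<^sub>R e" "k * h"] by (simp add: algebra_simps)
    show "smooth (\<lambda>x :: 'a. cos (k * (x \<bullet> c)))"
      using smooth_cos_ridge[of "k *\<^sub>R c" 0] by simp
  qed
  obtain R where R: "0 < R"
    "(N (weak_grad \<Omega> f))\<^sup>2 = R * (integral {0..h} (\<lambda>t. (- (k * sinh (k * (h - t))))\<^sup>2) * integral {0..m} (\<lambda>t. (cos (k * t))\<^sup>2)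
      + integral {0..h} (\<lambda>t. (cosh (k * (h - t)))\<^sup>2) * integral {0..m} (\<lambda>t. (- (k * sin (k * t)))\<^sup>2))"
    "(L2_norm \<sigma> f)\<^sup>2 = R * ((cosh (k * (h - 0)))\<^sup>2 * integral {0..m} (\<lambda>t. (cos (k * t))\<^sup>2))"
    "(LINT x|\<sigma>. f x) = R * (cosh (k * (h - 0)) * integral {0..m} (\<lambda>t. cos (k * t)))"
    by (rule two_factor_test_function[where u = "\<lambda>t. cosh (k * (h - t))" and v = "\<lambda>t. cos (k * t)",
        OF c sm du dv, folded f_def, folded h_def m_def])
  have sq: "integral {0..m} (\<lambda>t. (sin (k * t))\<^sup>2) = m / 2" "integral {0..m} (\<lambda>t. (cos (k * t))\<^sup>2) = m / 2"
    using integral_sin_cos_squared[of m k] k pos by simp_all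
  define I J where "I = integral {0..h} (\<lambda>t. (sinh (k * (h - t)))\<^sup>2)" and "J = integral {0..h} (\<lambda>t. (cosh (k * (h - t)))\<^sup>2)"
  have "(N (weak_grad \<Omega> f))\<^sup>2 = R * (m / 2) * k\<^sup>2 * (I + J)"
    unfolding R(2) power2_minus power_mult_distrib integral_mult_right sq I_def[symmetric] J_def[symmetric]
    by (simp add: algebra_simps)
  also have "I + J = sinh (k * h) * cosh (k * h) / k"
    unfolding I_def J_def using integral_sinh_cosh_squared[of h k] k pos by simp
  finally have G: "(N (weak_grad \<Omega> f))\<^sup>2 = R * (m / 2) * (k * (sinh (k * h) * cosh (k * h)))"
    using k by (simp add: power2_eq_square)
  have S: "(L2_norm \<sigma> f)\<^sup>2 = R * (m / 2) * (cosh (k * h))\<^sup>2"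
    unfolding R(3) using integral_sin_cos_squared[of m k] k pos by simp
  have rate: "trace_rate (H \<bullet> c) = k * tanh (k * h)" "0 < trace_rate (H \<bullet> c)"
    using trace_rate_pos[of m] pos by (simp_all add: trace_rate_def k_def h_def m_def)
  have "(LINT x|\<sigma>. f x) = 0"
    unfolding R(4) using integral_cos_zero[of m k] k pos by simp
  moreover have sf: "smooth f" using sm by (simp add: f_def)
  ultimately have "f \<in> H1_tilde \<Omega> \<sigma>" by (intro smooth_H1_tilde)
  note bound = C[OF this smooth_is_trace[OF sf]]
  show ?thesis
  proof (rule constant_le_of_equality[OF _ _ _ _ _ bound])
    show "0 < (L2_norm \<sigma> f)\<^sup>2" unfolding S using R(1) pos by simp
    have "trace_rate (H \<bullet> c) * (L2_norm \<sigma> f)\<^sup>2 = (N (weak_grad \<Omega> f))\<^sup>2"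
      unfolding rate(1) G S by (simp add: tanh_def power2_eq_square)
    then show "(L2_norm \<sigma> f)\<^sup>2 = (trace_rate (H \<bullet> c) powr (- 1 / 2))\<^sup>2 * (N (weak_grad \<Omega> f))\<^sup>2"
      unfolding powr_minus_half_power2[OF rate(2)] using rate(2) by (simp add: field_simps)
  qed (auto simp: L2_norm_nonneg)
qed

theorem sharp_constants_box:
  assumes c: "c \<in> Basis - {e}" and max: "\<And>b. b \<in> Basis - {e} \<Longrightarrow> H \<bullet> b \<le> H \<bullet> c"
  shows "is_sharp_C1 \<Omega> \<sigma> (1 / pi * max (2 * (H \<bullet> e)) (H \<bullet> c))"
    and "is_sharp_C2 \<Omega> \<sigma> ((pi / (H \<bullet> c) * tanh (pi * (H \<bullet> e) / (H \<bullet> c))) powr (- 1 / 2))"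
proof -
  have m: "0 < H \<bullet> c" using sides_pos c by simp
  show "is_sharp_C1 \<Omega> \<sigma> (1 / pi * max (2 * (H \<bullet> e)) (H \<bullet> c))"
    unfolding is_sharp_C1_def is_smallest_def
    using poincare_constant_valid[OF m max] poincare_constant_lower_bound[OF c]
    by (auto simp: max_def)
  show "is_sharp_C2 \<Omega> \<sigma> ((pi / (H \<bullet> c) * tanh (pi * (H \<bullet> e) / (H \<bullet> c))) powr (- 1 / 2))"
    unfolding is_sharp_C2_def is_smallest_def trace_rate_def[symmetric]
    using trace_constant_valid[OF m max] trace_constant_lower_bound[OF c]
    by blast
qed

end

theorem proposition2p1:
  fixes h1 h2 h3 :: real
  assumes "h1 > 0" and "h2 > 0" and "h3 > 0"
  shows
    "(let \<Omega> = {x :: real^2. 0 < x$1 \<and> x$1 < h1 \<and> 0 < x$2 \<and> x$2 < h2};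
          \<Gamma> = {x :: real^2. x$1 = 0 \<and> 0 \<le> x$2 \<and> x$2 \<le> h2};
          \<sigma> = flat_surface_measure (axis 1 1) \<Gamma>
      in is_sharp_C1 \<Omega> \<sigma> (1 / pi * max (2 * h1) h2) \<and>
         is_sharp_C2 \<Omega> \<sigma> ((pi / h2 * tanh (pi * h1 / h2)) powr (- 1 / 2))) \<and>
     (let \<Omega> = {x :: real^3. 0 < x$1 \<and> x$1 < h1 \<and> 0 < x$2 \<and> x$2 < h2 \<and> 0 < x$3 \<and> x$3 < h3};
          \<Gamma> = frontier \<Omega> \<inter> {x. x$1 = 0};
          \<sigma> = flat_surface_measure (axis 1 1) \<Gamma>
      in is_sharp_C1 \<Omega> \<sigma> (1 / pi * max (2 * h1) (max h2 h3)) \<and>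
         is_sharp_C2 \<Omega> \<sigma> ((pi / max h2 h3 * tanh (pi * h1 / max h2 h3)) powr (- 1 / 2)))"
proof -
  have part1: "is_sharp_C1 D (flat_surface_measure (axis 1 1) G) (1 / pi * max (2 * h1) h2) \<and>
      is_sharp_C2 D (flat_surface_measure (axis 1 1) G) ((pi / h2 * tanh (pi * h1 / h2)) powr (- 1 / 2))"
    if D: "D = {x :: real^2. 0 < x$1 \<and> x$1 < h1 \<and> 0 < x$2 \<and> x$2 < h2}"
      and G: "G = {x :: real^2. x$1 = 0 \<and> 0 \<le> x$2 \<and> x$2 \<le> h2}" for D G
  proof -
    define H :: "real^2" where "H = vector [h1, h2]"
    have H: "H \<bullet> axis 1 1 = h1" "H \<bullet> axis 2 1 = h2" by (simp_all add: H_def inner_axis)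
    have Basis: "(Basis :: (real^2) set) = {axis 1 1, axis 2 1}"
      by (auto simp: Basis_vec_def UNIV_2)
    have ne: "axis 1 1 \<noteq> (axis 2 1 :: real^2)" by (simp add: axis_eq_axis)
    interpret box_with_face H "axis 1 1" "[axis 2 1]"
      using assms H ne by unfold_locales (auto simp: Basis)
    have "box 0 H = D"
      unfolding D by (auto simp: mem_box Basis inner_axis H_def)
    moreover have "face = G"
      unfolding G face_def using ne by (auto simp: Basis inner_axis H_def)
    ultimately show ?thesis
      using sharp_constants_box[of "axis 2 1"] ne H by (auto simp: Basis)
  qed
  have part2: "is_sharp_C1 D (flat_surface_measure (axis 1 1) G) (1 / pi * max (2 * h1) (max h2 h3)) \<and>
      is_sharp_C2 D (flat_surface_measure (axis 1 1) G) ((pi / max h2 h3 * tanh (pi * h1 / max h2 h3)) powr (- 1 / 2))"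
    if D: "D = {x :: real^3. 0 < x$1 \<and> x$1 < h1 \<and> 0 < x$2 \<and> x$2 < h2 \<and> 0 < x$3 \<and> x$3 < h3}"
      and G: "G = frontier D \<inter> {x. x$1 = 0}" for D G
  proof -
    define H :: "real^3" where "H = vector [h1, h2, h3]"
    have H: "H \<bullet> axis 1 1 = h1" "H \<bullet> axis 2 1 = h2" "H \<bullet> axis 3 1 = h3"
      by (simp_all add: H_def inner_axis)
    have Basis: "(Basis :: (real^3) set) = {axis 1 1, axis 2 1, axis 3 1}"
      by (auto simp: Basis_vec_def UNIV_3)
    have ne: "axis 1 1 \<noteq> (axis 2 1 :: real^3)" "axis 1 1 \<noteq> (axis 3 1 :: real^3)" "axis 2 1 \<noteq> (axis 3 1 :: real^3)"
      by (simp_all add: axis_eq_axis)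
    interpret box_with_face H "axis 1 1" "[axis 2 1, axis 3 1]"
      using assms H ne by unfold_locales (auto simp: Basis)
    have D_box: "D = box 0 H"
      unfolding D by (auto simp: mem_box Basis inner_axis H_def)
    \<comment> \<open>the frontier is the closed box without the open one; of its points with vanishing first coordinate none lies in the open box\<close>
    have "box 0 H \<noteq> {}" using assms H by (auto simp: box_ne_empty Basis)
    then have "G = (cbox 0 H - box 0 H) \<inter> {x. x $ 1 = 0}"
      unfolding G D_box by (simp add: frontier_box)
    also have "\<dots> = face"
      unfolding face_def using ne assms by (auto simp: mem_box Basis inner_axis H_def)
    finally have G_face: "G = face" .
    show ?thesis
    proof (cases "h3 \<le> h2")
      case True
      have "axis 2 1 \<in> Basis - {axis 1 1 :: real^3}"
        and "\<And>b. b \<in> Basis - {axis 1 1} \<Longrightarrow> H \<bullet> b \<le> H \<bullet> axis 2 1"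
        using ne H True by (auto simp: Basis)
      from sharp_constants_box[OF this, unfolded H] show ?thesis
        unfolding D_box G_face using True by simp
    next
      case False
      have "axis 3 1 \<in> Basis - {axis 1 1 :: real^3}"
        and "\<And>b. b \<in> Basis - {axis 1 1} \<Longrightarrow> H \<bullet> b \<le> H \<bullet> axis 3 1"
        using ne H False by (auto simp: Basis)
      from sharp_constants_box[OF this, unfolded H] show ?thesis
        unfolding D_box G_face using False by simp
    qed
  qed
  show ?thesis
    unfolding Let_def using part1[OF refl refl] part2[OF refl refl] by (rule conjI)
qed

end
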